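(* Let $1<p\leq q<\infty$ and let $u,v$ be weights on $\mathbf{R}^n$ with $(u,v)\in N_{\mathcal Q}(p,q)$. Suppose that either (a) or (b) below holds: (a) $p'\geq q$, $p\neq 2$, and there is a constant $C$ such that for all cubes $Q$ and all measurable sets $E\subset Q$, $$\frac{u(E)}{u(Q)}\leq C\left(\frac{|E|}{|Q|}\right)^{q/p'};$$ (b) $p'\leq q$, $q\neq 2$, and there is a constant $C$ such that for all cubes $Q$ and all measurable sets $E\subset Q$, $$\frac{|E|}{|Q|}\leq C\left(\frac{v(E)}{v(Q)}\right)^{q'/p}.$$ Then the weighted Fourier inequality holds: there is a constant $C$ such that $$\left(\int_{\mathbf{R}^n} |\widehat f|^{q}\, u\right)^{1/q}\leq C\left(\int_{\mathbf{R}^n} |f|^{p}\,v\right)^{1/p}$$ for all $f\in L^1(\mathbf{R}^n)$.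
   Context: A weight is a nonnegative, locally integrable function on $\mathbf{R}^n$. Here $p'=p/(p-1)$, $q'=q/(q-1)$, and $w=v^{-p'/p}$ is assumed to be locally integrable. For a measurable set $E$, $|E|$ is its Lebesgue measure and $u(E)=\int_E u$, $v(E)=\int_E v$, $w(E)=\int_E w$. The Fourier transform is $\widehat f(z)=\int_{\mathbf{R}^n} f(x)e^{-ix\cdot z}\,dx$. For a bounded set $A\subset\mathbf{R}^n$ containing the origin, its polar is $A^\circ=\{z\in\mathbf{R}^n: |x\cdot z|\le 1\text{ for all }x\in A\}$. One says $(u,v)\in N_{\mathcal Q}(p,q)$ if and only if there is a constant $C$ such that for all cubes $Q$ with sides parallel to the coordinate axes, all $-\mu\in Q$, and all $\tau\in\mathbf{R}^n$, $$u(Q)^{1/q}\,w((Q+\mu)^\circ+\tau)^{1/p'}\leq C\quad\text{and}\quad u((Q+\mu)^\circ+\tau)^{1/q}\,w(Q)^{1/p'}\leq C.$$ *)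

theory Defs
  imports "HOL-Analysis.Analysis"
begin

definition conj_exp :: "real \<Rightarrow> real" where
  "conj_exp p = p / (p - 1)"

text \<open>Real powers of extended nonnegative reals. For negative exponents the value at 0
  is infinity, whereas \<open>powr\<close> on the reals gives 0 there.\<close>

definition ennreal_powr :: "ennreal \<Rightarrow> real \<Rightarrow> ennreal" where
  "ennreal_powr x a =
     (if a = 0 then 1
      else if x = 0 then (if 0 < a then 0 else \<infinity>)
      else if x = \<infinity> then (if 0 < a then \<infinity> else 0)
      else ennreal (enn2real x powr a))"

definition locally_integrable :: "(real ^ 'n \<Rightarrow> ennreal) \<Rightarrow> bool" where
  "locally_integrable g \<longleftrightarrow>
     g \<in> borel_measurable lebesgue \<and> (\<forall>K. compact K \<longrightarrow> (\<integral>\<^sup>+x\<in>K. g x \<partial>lebesgue) < \<infinity>)"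

definition weight :: "(real ^ 'n \<Rightarrow> real) \<Rightarrow> bool" where
  "weight u \<longleftrightarrow> (\<forall>x. 0 \<le> u x) \<and> locally_integrable (\<lambda>x. ennreal (u x))"

text \<open>The function \<open>w = v powr (- p' / p)\<close>. It is infinite where \<open>v\<close> vanishes, so its
  local integrability forces \<open>v > 0\<close> almost everywhere.\<close>

definition dual_weight :: "real \<Rightarrow> (real ^ 'n \<Rightarrow> real) \<Rightarrow> real ^ 'n \<Rightarrow> ennreal" where
  "dual_weight p v x = ennreal_powr (ennreal (v x)) (- conj_exp p / p)"

text \<open>Closed nondegenerate cubes with sides parallel to the coordinate axes.\<close>

definition cubes :: "(real ^ 'n) set set" where
  "cubes = {cbox a (a + (\<chi> i. s)) | a s. 0 < s}"

definition polar :: "(real ^ 'n) set \<Rightarrow> (real ^ 'n) set" where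
  "polar A = {z. \<forall>x\<in>A. \<bar>x \<bullet> z\<bar> \<le> 1}"

definition translate :: "(real ^ 'n) set \<Rightarrow> real ^ 'n \<Rightarrow> (real ^ 'n) set" where
  "translate A t = (\<lambda>x. x + t) ` A"

definition mass :: "(real ^ 'n \<Rightarrow> ennreal) \<Rightarrow> (real ^ 'n) set \<Rightarrow> ennreal" where
  "mass g E = (\<integral>\<^sup>+x\<in>E. g x \<partial>lebesgue)"

definition N_Q :: "real \<Rightarrow> real \<Rightarrow> (real ^ 'n \<Rightarrow> real) \<Rightarrow> (real ^ 'n \<Rightarrow> real) \<Rightarrow> bool" where
  "N_Q p q u v \<longleftrightarrow>
     (\<exists>C::real. \<forall>Q\<in>cubes. \<forall>\<mu> \<tau>. - \<mu> \<in> Q \<longrightarrow>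
        ennreal_powr (mass (\<lambda>x. ennreal (u x)) Q) (1 / q) *
          ennreal_powr (mass (dual_weight p v) (translate (polar (translate Q \<mu>)) \<tau>)) (1 / conj_exp p)
          \<le> ennreal C \<and>
        ennreal_powr (mass (\<lambda>x. ennreal (u x)) (translate (polar (translate Q \<mu>)) \<tau>)) (1 / q) *
          ennreal_powr (mass (dual_weight p v) Q) (1 / conj_exp p)
          \<le> ennreal C)"

definition fourier :: "(real ^ 'n \<Rightarrow> complex) \<Rightarrow> real ^ 'n \<Rightarrow> complex" where
  "fourier f z = (LINT x|lebesgue. f x * exp (- \<i> * complex_of_real (x \<bullet> z)))"

end

theory Submission
  imports Defs "HOL-Probability.Probability"
begin

text \<open>
  Put \<open>w = v powr (- p' / p)\<close>. Up to a dimensional constant, the polar of a cube of side \<open>s\<close> around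
  the origin contains a cube of side \<open>1/s\<close>, so the hypothesis on \<open>(u, v)\<close> bounds
  \<open>u(Q) powr (1/q) * w(P) powr (1/p')\<close> for all cubes \<open>Q\<close>, \<open>P\<close> of reciprocal sides, wherever they lie.
  Since \<open>P\<close> may be placed where \<open>w\<close> has positive density, letting \<open>Q\<close> grow bounds the growth of
  \<open>u(Q)\<close>; together with (a) this puts \<open>u\<close> into weak \<open>L\<^sup>r\<close> with \<open>1/r = 1 - q/p'\<close>. Conversely, (a) bounds
  \<open>u(Q)\<close> from below for large \<open>Q\<close>, which bounds the averages of \<open>w\<close> over small cubes, hence \<open>w\<close>.
  So in case (a) the theorem reduces to a Paley inequality for weights in weak \<open>L\<^sup>r\<close> with \<open>p < 2\<close>. In
  case (b), by Hoelder's inequality, the same argument with \<open>u\<close> and \<open>w\<close> exchanged shows that \<open>u\<close> is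
  bounded and \<open>w\<close> is of weak type, and the theorem is the dual of that Paley inequality.

  The Paley inequality follows from Hoermander's interpolation of \<open>f \<mapsto> fourier f / \<phi>\<close> with respect to
  the measure \<open>\<phi>\<^sup>2 dz\<close>, where \<open>\<phi>\<close> is allowed to depend on \<open>f\<close>: the choice
  \<open>\<phi> powr (2 - p) = \<bar>fourier f\<bar> powr (q - p) * u\<close> lies in weak \<open>L\<^sup>1\<close> by the weak Hausdorff-Young inequality.
\<close>

subsection \<open>Gaussians and their Fourier transforms\<close>

text \<open>For q > p a Paley inequality, which has the exponent p on both sides, does not match;
  the surplus \<open>cmod (fourier f z) powr (q - p)\<close> is therefore counted as part of the
  weight. The resulting \<phi> is not linear in f: its weak L^1 constant is uniform only over the
  unit ball of L^p, and general f follow by homogeneity. The scheme closes because (q - p)/p' + (1 -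
  q/p') = 2 - p: the weak L^p' bound for the transform and the weak type of u combine to exactly the
  decay 1/t. The case q = p' is r = \<infinity>, where weak type means boundedness.

  In (a), p \<le> q \<le> p' forces p \<le> 2. The interpolation ends at L^2, where its constant
  1/(2 - p) blows up, which is what p \<noteq> 2 excludes; in (b) duality turns this into q > 2.

  The growth argument requires both weights to be nontrivial. For w this is automatic, since v is
  finite and positive almost everywhere. If u vanishes almost everywhere, no bound on w follows, and
  the inequality holds because its left-hand side is 0.\<close>

lemma gauss_fourier_real:
  fixes x e :: real
  assumes "0 < e"
  shows "integrable lborel (\<lambda>t. complex_of_real (exp (- (e * t)\<^sup>2 / 2)) * exp (- \<i> * complex_of_real (t * x)))" (is ?A)
    and "(LINT t|lborel. complex_of_real (exp (- (e * t)\<^sup>2 / 2)) * exp (- \<i> * complex_of_real (t * x)))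
           = complex_of_real (sqrt (2 * pi) / e * exp (- (x / e)\<^sup>2 / 2))" (is ?B)
proof -
  \<comment> \<open>The known transform is the characteristic function of the standard normal
    distribution; it is evaluated at -x/e and rescaled by y = e t, which produces the factor
    1/e.\<close>
  let ?F = "\<lambda>y. std_normal_density y *\<^sub>R exp (\<i> * complex_of_real ((- x / e) * y))"
  have "integrable lborel ?F"
    by (rule Bochner_Integration.integrable_bound[of _ std_normal_density]) auto
  then have F: "has_bochner_integral lborel ?F (complex_of_real (exp (- (x / e)\<^sup>2 / 2)))"
    using fun_cong[OF char_std_normal_distribution, of "- x / e"]
    by (simp add: char_def has_bochner_integral_iff integral_density mult_ac)
  from lborel_has_bochner_integral_real_affine_iff[of e ?F _ 0] F \<open>0 < e\<close>
  have G: "has_bochner_integral lborel (\<lambda>t. ?F (e * t)) (complex_of_real (exp (- (x / e)\<^sup>2 / 2)) /\<^sub>R e)"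
    by simp
  have "(\<lambda>t. sqrt (2 * pi) *\<^sub>R ?F (e * t))
          = (\<lambda>t. complex_of_real (exp (- (e * t)\<^sup>2 / 2)) * exp (- \<i> * complex_of_real (t * x)))"
    using \<open>0 < e\<close> by (auto simp: fun_eq_iff std_normal_density_def scaleR_conv_of_real mult_ac simp del: of_real_exp)
  moreover have "has_bochner_integral lborel (\<lambda>t. sqrt (2 * pi) *\<^sub>R ?F (e * t))
      (sqrt (2 * pi) *\<^sub>R (complex_of_real (exp (- (x / e)\<^sup>2 / 2)) /\<^sub>R e))"
    by (intro has_bochner_integral_scaleR_right G)
  ultimately have "has_bochner_integral lborel (\<lambda>t. complex_of_real (exp (- (e * t)\<^sup>2 / 2)) * exp (- \<i> * complex_of_real (t * x)))
          (sqrt (2 * pi) *\<^sub>R (complex_of_real (exp (- (x / e)\<^sup>2 / 2)) /\<^sub>R e))"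
    by simp
  then show ?A ?B
    by (auto simp: has_bochner_integral_iff scaleR_conv_of_real field_simps simp del: of_real_exp)
qed

text \<open>The integrand is 2 pi times the normal density with deviation e. That the mass does not
  depend on e is what later makes the Gaussian regularisation uniform.\<close>

lemma gauss_integral_real:
  fixes e :: real
  assumes "0 < e"
  shows "(\<integral>\<^sup>+x. ennreal (sqrt (2 * pi) / e * exp (- (x / e)\<^sup>2 / 2)) \<partial>lborel) = ennreal (2 * pi)"
proof -
  have "(\<integral>\<^sup>+x. ennreal (normal_density 0 e x) \<partial>lborel) = ennreal 1"
    using integral_normal_density[OF assms, of 0] integrable_normal_density[OF assms, of 0]
    by (subst nn_integral_eq_integral) auto
  moreover have "sqrt (2 * pi) / e * exp (- (x / e)\<^sup>2 / 2) = (2 * pi) * normal_density 0 e x" for x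
    using assms by (simp add: normal_density_def real_sqrt_mult field_simps)
  ultimately show ?thesis
    by (simp add: ennreal_mult nn_integral_cmult)
qed

lemma lborel_integral_prod:
  fixes g :: "'a::euclidean_space \<Rightarrow> real \<Rightarrow> complex"
  assumes "\<And>b. b \<in> Basis \<Longrightarrow> integrable lborel (g b)"
  shows "integrable lborel (\<lambda>x. \<Prod>b\<in>Basis. g b (x \<bullet> b))"
    and "(LINT x|lborel. (\<Prod>b\<in>Basis. g b (x \<bullet> b))) = (\<Prod>b\<in>Basis. LINT t|lborel. g b t)"
proof -
  interpret product_sigma_finite "\<lambda>_::'a. lborel :: real measure"
    by standard
  have m[measurable]: "g b \<in> borel_measurable borel" if "b \<in> Basis" for b
    using borel_measurable_integrable[OF assms[OF that]] by simp
  have s: "(\<Prod>b\<in>Basis. g b ((\<Sum>c\<in>Basis. f c *\<^sub>R c) \<bullet> b)) = (\<Prod>b\<in>Basis. g b (f b))" for f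
    by (intro prod.cong refl) simp
  show "integrable lborel (\<lambda>x. \<Prod>b\<in>Basis. g b (x \<bullet> b))"
    by (subst lborel_eq, subst integrable_distr_eq) (auto simp: s intro!: product_integrable_prod assms)
  show "(LINT x|lborel. (\<Prod>b\<in>Basis. g b (x \<bullet> b))) = (\<Prod>b\<in>Basis. LINT t|lborel. g b t)"
    by (subst lborel_eq, subst integral_distr) (auto simp: s product_integral_prod assms)
qed

definition gauss :: "real \<Rightarrow> 'a::euclidean_space \<Rightarrow> real" where
  "gauss e z = exp (- (e * norm z)\<^sup>2 / 2)"

text \<open>The transform of \<open>gauss e\<close>: up to normalisation an approximate identity as
  e tends to 0. The product over coordinates, instead of a function of the norm, lets both the
  transform and the mass be computed one coordinate at a time.\<close>

definition gauss_hat :: "real \<Rightarrow> 'a::euclidean_space \<Rightarrow> real" where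
  "gauss_hat e x = (\<Prod>b\<in>Basis. sqrt (2 * pi) / e * exp (- ((x \<bullet> b) / e)\<^sup>2 / 2))"

lemma gauss_prod: "gauss e z = (\<Prod>b\<in>Basis. exp (- (e * (z \<bullet> b))\<^sup>2 / 2))"
proof -
  have "(norm z)\<^sup>2 = (\<Sum>b\<in>Basis. (z \<bullet> b)\<^sup>2)"
    unfolding power2_norm_eq_inner by (subst euclidean_inner) (simp add: power2_eq_square)
  then show ?thesis
    by (simp only: gauss_def exp_sum[symmetric, OF finite_Basis] power_mult_distrib sum_distrib_left sum_divide_distrib minus_divide_left[symmetric] sum_negf)
qed

lemma gauss_fourier:
  fixes x :: "'a::euclidean_space"
  assumes "0 < e"
  shows "integrable lborel (\<lambda>z. complex_of_real (gauss e z) * exp (- \<i> * complex_of_real (z \<bullet> x)))"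
    and "(LINT z|lborel. complex_of_real (gauss e z) * exp (- \<i> * complex_of_real (z \<bullet> x)))
           = complex_of_real (gauss_hat e x)"
proof -
  let ?g = "\<lambda>b t. complex_of_real (exp (- (e * t)\<^sup>2 / 2)) * exp (- \<i> * complex_of_real (t * (x \<bullet> b)))"
  have eq: "complex_of_real (gauss e z) * exp (- \<i> * complex_of_real (z \<bullet> x)) = (\<Prod>b\<in>Basis. ?g b (z \<bullet> b))"
    for z :: 'a
  proof -
    have "complex_of_real (z \<bullet> x) = (\<Sum>b\<in>Basis. complex_of_real ((z \<bullet> b) * (x \<bullet> b)))"
      by (subst euclidean_inner) (simp only: of_real_sum)
    then have "- \<i> * complex_of_real (z \<bullet> x) = (\<Sum>b\<in>Basis. - \<i> * complex_of_real ((z \<bullet> b) * (x \<bullet> b)))"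
      by (simp only: sum_distrib_left)
    then show ?thesis
      by (simp only: gauss_prod of_real_prod prod.distrib exp_sum[OF finite_Basis])
  qed
  show "integrable lborel (\<lambda>z. complex_of_real (gauss e z) * exp (- \<i> * complex_of_real (z \<bullet> x)))"
    unfolding eq by (rule lborel_integral_prod, rule gauss_fourier_real, rule assms)
  show "(LINT z|lborel. complex_of_real (gauss e z) * exp (- \<i> * complex_of_real (z \<bullet> x)))
           = complex_of_real (gauss_hat e x)"
    unfolding eq
    by (subst lborel_integral_prod, rule gauss_fourier_real, rule assms)
      (simp only: gauss_fourier_real[OF assms] gauss_hat_def of_real_prod)
qed

lemma borel_measurable_gauss[measurable]:
  "gauss e \<in> borel_measurable borel" "gauss_hat e \<in> borel_measurable borel"
  unfolding gauss_def[abs_def] gauss_hat_def[abs_def] by measurable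

lemma gauss_nonneg: "0 \<le> gauss e z" "gauss e z \<le> 1" "0 < e \<Longrightarrow> 0 \<le> gauss_hat e z"
  by (auto simp: gauss_def gauss_hat_def intro!: prod_nonneg)

lemma gauss_hat_integral:
  assumes "0 < e"
  shows "(\<integral>\<^sup>+x. ennreal (gauss_hat e (x::'a::euclidean_space)) \<partial>lborel) = ennreal ((2 * pi) ^ DIM('a))"
proof -
  have "(\<integral>\<^sup>+x. ennreal (gauss_hat e (x::'a)) \<partial>lborel)
     = (\<integral>\<^sup>+x. (\<Prod>b\<in>(Basis::'a set). ennreal (sqrt (2 * pi) / e * exp (- ((x \<bullet> b) / e)\<^sup>2 / 2))) \<partial>lborel)"
    unfolding gauss_hat_def using assms by (intro nn_integral_cong prod_ennreal[symmetric]) auto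
  also have "\<dots> = (\<Prod>b\<in>(Basis::'a set). \<integral>\<^sup>+x. ennreal (sqrt (2 * pi) / e * exp (- (x / e)\<^sup>2 / 2)) \<partial>lborel)"
    by (rule nn_integral_lborel_prod[where f="\<lambda>b y. ennreal (sqrt (2 * pi) / e * exp (- (y / e)\<^sup>2 / 2))"]) auto
  also have "\<dots> = ennreal ((2 * pi) ^ DIM('a))"
    unfolding gauss_integral_real[OF assms] prod_constant by (rule ennreal_power) simp
  finally show ?thesis .
qed

subsection \<open>The Fourier transform and the Plancherel inequality\<close>

lemma sigma_finite_lebesgue: "sigma_finite_measure (lebesgue :: 'a::euclidean_space measure)"
proof -
  obtain A :: "'a set set" where A: "countable A" "A \<subseteq> sets lborel" "\<Union>A = space lborel"
    "\<forall>a\<in>A. emeasure lborel a \<noteq> \<infinity>"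
    using lborel.sigma_finite_countable by blast
  then show ?thesis
    by (intro sigma_finite_measure.intro exI[of _ A]) (auto simp: subset_iff emeasure_completion)
qed

interpretation lebesgue: sigma_finite_measure "lebesgue :: 'a::euclidean_space measure"
  by (rule sigma_finite_lebesgue)

interpretation lebesgue_pair:
  pair_sigma_finite "lebesgue :: 'a::euclidean_space measure" "lebesgue :: 'b::euclidean_space measure"
  ..

text \<open>A product of completions is not the completion of the product, so a Borel kernel is
  pulled back along the identity, which is measurable from \<open>lebesgue\<close> to
  \<open>borel\<close> in each coordinate.\<close>

lemma borel_measurable_lebesgue_pair:
  assumes "(\<lambda>w. g (fst w) (snd w)) \<in> borel_measurable (borel \<Otimes>\<^sub>M borel)"
  shows "(\<lambda>w. g (fst w) (snd w)) \<in> borel_measurable (lebesgue \<Otimes>\<^sub>M lebesgue)"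
proof -
  have id[measurable]: "(\<lambda>x. x) \<in> lebesgue \<rightarrow>\<^sub>M borel"
    by (simp add: measurable_completion)
  have "(\<lambda>w. (fst w, snd w)) \<in> lebesgue \<Otimes>\<^sub>M lebesgue \<rightarrow>\<^sub>M borel \<Otimes>\<^sub>M borel"
    by (intro measurable_Pair measurable_compose[OF measurable_fst id] measurable_compose[OF measurable_snd id])
  from measurable_compose[OF this assms] show ?thesis by simp
qed

text \<open>Fubini: the modulus of the double integrand is at most |f x| |h z|, which is integrable
  on the product.\<close>

lemma integral_bounded_kernel_swap:
  fixes f :: "'a::euclidean_space \<Rightarrow> complex" and h :: "'b::euclidean_space \<Rightarrow> complex"
  assumes f: "integrable lebesgue f" and h: "integrable lebesgue h"
    and B: "(\<lambda>w. B (fst w) (snd w)) \<in> borel_measurable (borel \<Otimes>\<^sub>M borel)"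
    and le: "\<And>x z. cmod (B x z) \<le> 1"
  shows "(LINT z|lebesgue. h z * (LINT x|lebesgue. f x * B x z))
       = (LINT x|lebesgue. f x * (LINT z|lebesgue. h z * B x z))"
proof -
  note [measurable] = borel_measurable_integrable[OF f] borel_measurable_integrable[OF h]
    borel_measurable_lebesgue_pair[OF B]
  let ?k = "\<lambda>x z. f x * (h z * B x z)"
  have m: "(\<lambda>w. ?k (fst w) (snd w)) \<in> borel_measurable (lebesgue \<Otimes>\<^sub>M lebesgue)"
    by measurable
  have "integrable (lebesgue \<Otimes>\<^sub>M lebesgue) (\<lambda>w. ?k (fst w) (snd w))"
  proof (rule integrableI_bounded[OF m])
    have "(\<integral>\<^sup>+w. ennreal (cmod (?k (fst w) (snd w))) \<partial>(lebesgue \<Otimes>\<^sub>M lebesgue))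
        \<le> (\<integral>\<^sup>+w. ennreal (cmod (f (fst w))) * ennreal (cmod (h (snd w))) \<partial>(lebesgue \<Otimes>\<^sub>M lebesgue))"
      using le by (intro nn_integral_mono)
        (auto simp: norm_mult ennreal_mult[symmetric] intro!: ennreal_leI mult_left_mono mult_left_le)
    also have "\<dots> = (\<integral>\<^sup>+x. \<integral>\<^sup>+z. ennreal (cmod (f x)) * ennreal (cmod (h z)) \<partial>lebesgue \<partial>lebesgue)"
      by (subst lebesgue.nn_integral_fst[symmetric]) auto
    also have "\<dots> = (\<integral>\<^sup>+x. ennreal (cmod (f x)) \<partial>lebesgue) * (\<integral>\<^sup>+z. ennreal (cmod (h z)) \<partial>lebesgue)"
      by (simp add: nn_integral_cmult nn_integral_multc)
    also have "\<dots> < \<infinity>"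
      using f h by (auto simp: integrable_iff_bounded ennreal_mult_less_top)
    finally show "(\<integral>\<^sup>+w. ennreal (cmod (?k (fst w) (snd w))) \<partial>(lebesgue \<Otimes>\<^sub>M lebesgue)) < \<infinity>" .
  qed
  then have "(LINT z|lebesgue. LINT x|lebesgue. ?k x z) = (LINT x|lebesgue. LINT z|lebesgue. ?k x z)"
    by (intro lebesgue_pair.Fubini_integral) (simp add: case_prod_beta')
  moreover have "(LINT z|lebesgue. h z * (LINT x|lebesgue. f x * B x z)) = (LINT z|lebesgue. LINT x|lebesgue. ?k x z)"
    unfolding integral_mult_right_zero[symmetric] by (simp only: mult.left_commute)
  ultimately show ?thesis
    by simp
qed

section \<open>The Fourier kernel and the multiplication formula\<close>

definition wave :: "'a::euclidean_space \<Rightarrow> 'a \<Rightarrow> complex" where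
  "wave x z = exp (- \<i> * complex_of_real (x \<bullet> z))"

lemma norm_wave[simp]: "cmod (wave x z) = 1"
  by (simp add: wave_def norm_exp_eq_Re)

lemma wave_commute: "wave x z = wave z x"
  by (simp add: wave_def inner_commute)

lemma wave_diff: "wave x z * cnj (wave y z) = wave (x - y) z"
  by (simp add: wave_def exp_cnj exp_add[symmetric] inner_diff_left algebra_simps)

lemma borel_measurable_cnj[measurable (raw)]:
  assumes "f \<in> borel_measurable M"
  shows "(\<lambda>x. cnj (f x)) \<in> borel_measurable M"
  by (rule measurable_compose[OF assms]) (intro borel_measurable_continuous_onI continuous_intros)

lemma borel_measurable_wave[measurable (raw)]:
  assumes "f \<in> borel_measurable M" "g \<in> borel_measurable M"
  shows "(\<lambda>w. wave (f w) (g w)) \<in> borel_measurable M"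
  unfolding wave_def using assms by measurable

lemma borel_measurable_wave_lebesgue[measurable]: "wave x \<in> borel_measurable lebesgue" "(\<lambda>x. wave x z) \<in> borel_measurable lebesgue"
  by (intro measurable_completion; simp)+

lemma fourier_wave: "fourier f z = (LINT x|lebesgue. f x * wave x z)"
  by (simp add: fourier_def wave_def)

lemma integrable_wave:
  assumes "integrable lebesgue f"
  shows "integrable lebesgue (\<lambda>x. f x * wave x z)"
  using borel_measurable_integrable[OF assms] by (intro Bochner_Integration.integrable_bound[OF assms]) (auto simp: norm_mult)

lemma fourier_bound:
  assumes "integrable lebesgue f"
  shows "cmod (fourier f z) \<le> (LINT x|lebesgue. cmod (f x))"
  unfolding fourier_wave
  using integral_norm_bound[of lebesgue "\<lambda>x. f x * wave x z"] by (simp add: norm_mult)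

lemma borel_measurable_fourier[measurable]:
  assumes "f \<in> borel_measurable lebesgue"
  shows "fourier f \<in> borel_measurable lebesgue"
proof -
  have [measurable]: "(\<lambda>w. wave (snd w) (fst w)) \<in> borel_measurable (lebesgue \<Otimes>\<^sub>M lebesgue)"
    by (rule borel_measurable_lebesgue_pair) measurable
  have "(\<lambda>w. f (snd w) * wave (snd w) (fst w)) \<in> borel_measurable (lebesgue \<Otimes>\<^sub>M lebesgue)"
    using assms by measurable
  then show ?thesis
    unfolding fourier_wave[abs_def]
    by (intro lebesgue.borel_measurable_lebesgue_integral) (simp add: case_prod_beta')
qed

lemma fourier_add:
  assumes "integrable lebesgue f" "integrable lebesgue g"
  shows "fourier (\<lambda>x. f x + g x) z = fourier f z + fourier g z"
  using integrable_wave[OF assms(1)] integrable_wave[OF assms(2)] by (simp add: fourier_wave distrib_right)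

lemma fourier_mult_right: "fourier (\<lambda>x. c * f x) z = c * fourier f z"
  by (simp add: fourier_wave mult.assoc)

text \<open>The kernel is symmetric in its two arguments. This identity carries both the Plancherel
  inequality and the duality argument for case (b).\<close>

lemma fourier_multiplication:
  assumes "integrable lebesgue f" "integrable lebesgue h"
  shows "(LINT z|lebesgue. h z * fourier f z) = (LINT x|lebesgue. f x * fourier h x)"
  unfolding fourier_wave
  by (subst integral_bounded_kernel_swap[OF assms]) (auto simp: wave_commute[of _ x for x])

section \<open>Gaussian regularisation and the Plancherel inequality\<close>

lemma nn_integral_gauss_hat_translate:
  fixes x :: "'a::euclidean_space"
  assumes "0 < e"
  shows "(\<integral>\<^sup>+y. ennreal (gauss_hat e (y - x)) \<partial>lebesgue) = ennreal ((2 * pi) ^ DIM('a))"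
    and "(\<integral>\<^sup>+y. ennreal (gauss_hat e (x - y)) \<partial>lebesgue) = ennreal ((2 * pi) ^ DIM('a))"
proof -
  have "(\<integral>\<^sup>+y. ennreal (gauss_hat e (y - x)) \<partial>lebesgue) = (\<integral>\<^sup>+y. ennreal (gauss_hat e (y - x)) \<partial>distr lborel borel ((+) x))"
    by (simp add: nn_integral_completion lborel_distr_plus)
  also have "\<dots> = (\<integral>\<^sup>+y. ennreal (gauss_hat e (y::'a)) \<partial>lborel)"
    by (subst nn_integral_distr) auto
  finally show *: "(\<integral>\<^sup>+y. ennreal (gauss_hat e (y - x)) \<partial>lebesgue) = ennreal ((2 * pi) ^ DIM('a))"
    by (simp only: gauss_hat_integral[OF assms])
  have "gauss_hat e (x - y) = gauss_hat e (y - x)" for y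
    unfolding gauss_hat_def by (simp add: inner_diff_left power_divide power2_commute)
  with * show "(\<integral>\<^sup>+y. ennreal (gauss_hat e (x - y)) \<partial>lebesgue) = ennreal ((2 * pi) ^ DIM('a))"
    by simp
qed

lemma gauss_fourier_lebesgue:
  assumes "0 < e"
  shows "integrable lebesgue (\<lambda>z. complex_of_real (gauss e z) * wave x z)"
    and "(LINT z|lebesgue. complex_of_real (gauss e z) * wave x z) = complex_of_real (gauss_hat e x)"
  using gauss_fourier[OF assms, of x]
  by (auto simp: wave_commute[of x] wave_def[of _ x] integrable_completion integral_completion)

lemma integrable_gauss:
  assumes "0 < e"
  shows "integrable lebesgue (gauss e :: 'a::euclidean_space \<Rightarrow> real)"
  using integrable_norm[OF gauss_fourier_lebesgue(1)[OF assms, where x="0::'a"]]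
  by (simp add: norm_mult gauss_nonneg)

text \<open>With \<open>h = gauss e * cnj (fourier f)\<close> the energy is the integral of h times
  \<open>fourier f\<close>. The multiplication formula moves the transform to h, and
  \<open>fourier h\<close> is the convolution of \<open>cnj f\<close> with
  \<open>gauss_hat e\<close>. So the energy is a double integral of f(x) cnj f(y) gauss_hat(x - y);
  bounding |f(x)| |f(y)| by half the sum of the squares and integrating out one variable leaves the
  mass of \<open>gauss_hat\<close>. The right-hand side may be infinite.\<close>

lemma fourier_gauss_energy_le:
  fixes f :: "real ^ 'n \<Rightarrow> complex"
  assumes f: "integrable lebesgue f" and e: "0 < e"
  shows "(\<integral>\<^sup>+z. ennreal ((cmod (fourier f z))\<^sup>2 * gauss e z) \<partial>lebesgue)
       \<le> ennreal ((2 * pi) ^ CARD('n)) * (\<integral>\<^sup>+x. ennreal ((cmod (f x))\<^sup>2) \<partial>lebesgue)" (is "_ \<le> ?c * ?N")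
proof -
  note fm[measurable] = borel_measurable_integrable[OF f]
  define A where "A = (LINT x|lebesgue. cmod (f x))"
  have A: "cmod (fourier f z) \<le> A" for z
    unfolding A_def by (rule fourier_bound[OF f])
  have gm[measurable]: "gauss e \<in> borel_measurable lebesgue" "gauss_hat e \<in> borel_measurable lebesgue"
    by (intro measurable_completion; simp)+
  define h where "h z = complex_of_real (gauss e z) * cnj (fourier f z)" for z
  have hm[measurable]: "h \<in> borel_measurable lebesgue"
  proof -
    have "(\<lambda>z. complex_of_real (gauss e z)) \<in> borel_measurable lebesgue"
      by (intro measurable_completion) simp
    moreover have "(\<lambda>z. cnj (fourier f z)) \<in> borel_measurable lebesgue"
      by measurable
    ultimately show ?thesis
      unfolding h_def by (rule borel_measurable_times)
  qed
  have h: "integrable lebesgue h"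
  proof (rule Bochner_Integration.integrable_bound[OF integrable_mult_left[OF integrable_gauss[OF e], of A]])
    show "AE z in lebesgue. norm (h z) \<le> norm (gauss e z * A)"
      using A order_trans[OF norm_ge_zero A]
      by (auto simp: h_def norm_mult abs_mult gauss_nonneg intro!: mult_left_mono)
  qed simp
  have cf: "integrable lebesgue (\<lambda>y. cnj (f y))"
    using f by simp
  have inner: "fourier h x = (LINT y|lebesgue. cnj (f y) * complex_of_real (gauss_hat e (x - y)))" for x
  proof -
    have "cnj (fourier f z) = (LINT y|lebesgue. cnj (f y) * cnj (wave y z))" for z
      unfolding fourier_wave using Bochner_Integration.integral_cnj[of lebesgue "\<lambda>x. f x * wave x z"] by simp
    then have "fourier h x = (LINT z|lebesgue. (complex_of_real (gauss e z) * wave x z) * (LINT y|lebesgue. cnj (f y) * cnj (wave y z)))"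
      unfolding fourier_wave[of h] h_def by (simp add: wave_commute[of _ x] mult_ac)
    also have "\<dots> = (LINT y|lebesgue. cnj (f y) * (LINT z|lebesgue. (complex_of_real (gauss e z) * wave x z) * cnj (wave y z)))"
      by (rule integral_bounded_kernel_swap[OF cf gauss_fourier_lebesgue(1)[OF e]])
        (auto intro!: borel_measurable_cnj borel_measurable_wave)
    also have "\<dots> = (LINT y|lebesgue. cnj (f y) * complex_of_real (gauss_hat e (x - y)))"
      by (simp only: mult.assoc wave_diff gauss_fourier_lebesgue(2)[OF e])
    finally show ?thesis .
  qed
  have "integrable lebesgue (\<lambda>z. h z * fourier f z)"
  proof (rule Bochner_Integration.integrable_bound[OF integrable_mult_left[OF integrable_norm[OF h], of A]])
    show "AE z in lebesgue. norm (h z * fourier f z) \<le> norm (norm (h z) * A)"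
      using A order_trans[OF norm_ge_zero A]
      by (auto simp: norm_mult abs_mult intro!: mult_left_mono)
  qed simp
  moreover have hf: "h z * fourier f z = complex_of_real ((cmod (fourier f z))\<^sup>2 * gauss e z)" for z
    by (simp add: h_def mult_ac complex_norm_square del: of_real_power)
  ultimately have int: "integrable lebesgue (\<lambda>z. (cmod (fourier f z))\<^sup>2 * gauss e z)"
    by (simp only: complex_of_real_integrable_eq)
  have "(\<integral>\<^sup>+z. ennreal ((cmod (fourier f z))\<^sup>2 * gauss e z) \<partial>lebesgue)
      = ennreal (LINT z|lebesgue. (cmod (fourier f z))\<^sup>2 * gauss e z)"
    by (rule nn_integral_eq_integral[OF int]) (simp add: gauss_nonneg)
  also have "(LINT z|lebesgue. (cmod (fourier f z))\<^sup>2 * gauss e z) = cmod (LINT z|lebesgue. h z * fourier f z)"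
    unfolding hf integral_complex_of_real norm_of_real
    by (rule abs_of_nonneg[symmetric]) (simp add: gauss_nonneg integral_nonneg_AE)
  also have "(LINT z|lebesgue. h z * fourier f z) = (LINT x|lebesgue. f x * fourier h x)"
    by (rule fourier_multiplication[OF f h])
  \<comment> \<open>A non-integrable integrand has Bochner integral 0, so the bound by the integral
    of the modulus covers that case too.\<close>
  also have "ennreal (cmod (LINT x|lebesgue. f x * fourier h x)) \<le> (\<integral>\<^sup>+x. ennreal (cmod (f x * fourier h x)) \<partial>lebesgue)"
    by (cases "integrable lebesgue (\<lambda>x. f x * fourier h x)")
      (auto simp: not_integrable_integral_eq intro: integral_norm_bound_ennreal)
  also have "\<dots> \<le> (\<integral>\<^sup>+x. \<integral>\<^sup>+y. ennreal (1 / 2 * (cmod (f x))\<^sup>2 * gauss_hat e (x - y)) + ennreal (1 / 2 * (cmod (f y))\<^sup>2 * gauss_hat e (x - y)) \<partial>lebesgue \<partial>lebesgue)"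
  proof (rule nn_integral_mono)
    fix x :: "real ^ 'n"
    have mm[measurable]: "(\<lambda>y. gauss_hat e (x - y)) \<in> borel_measurable lebesgue"
      by (intro measurable_completion) simp
    have "ennreal (cmod (fourier h x)) \<le> (\<integral>\<^sup>+y. ennreal (cmod (cnj (f y) * complex_of_real (gauss_hat e (x - y)))) \<partial>lebesgue)"
      unfolding inner
      by (cases "integrable lebesgue (\<lambda>y. cnj (f y) * complex_of_real (gauss_hat e (x - y)))")
        (auto simp: not_integrable_integral_eq intro: integral_norm_bound_ennreal)
    then have "ennreal (cmod (f x * fourier h x)) \<le> ennreal (cmod (f x)) * (\<integral>\<^sup>+y. ennreal (cmod (cnj (f y) * complex_of_real (gauss_hat e (x - y)))) \<partial>lebesgue)"
      by (simp add: norm_mult ennreal_mult mult_left_mono)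
    also have "\<dots> = (\<integral>\<^sup>+y. ennreal (cmod (f x)) * ennreal (cmod (cnj (f y) * complex_of_real (gauss_hat e (x - y)))) \<partial>lebesgue)"
      by (rule nn_integral_cmult[symmetric]) measurable
    also have "\<dots> \<le> (\<integral>\<^sup>+y. ennreal (1 / 2 * (cmod (f x))\<^sup>2 * gauss_hat e (x - y)) + ennreal (1 / 2 * (cmod (f y))\<^sup>2 * gauss_hat e (x - y)) \<partial>lebesgue)"
    proof (rule nn_integral_mono)
      fix y :: "real ^ 'n"
      have g: "0 \<le> gauss_hat e (x - y)" by (rule gauss_nonneg(3)[OF e])
      have "cmod (f x) * cmod (f y) \<le> 1 / 2 * (cmod (f x))\<^sup>2 + 1 / 2 * (cmod (f y))\<^sup>2"
        using sum_squares_bound[of "cmod (f x)" "cmod (f y)"] by simp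
      from mult_right_mono[OF this g] g
      show "ennreal (cmod (f x)) * ennreal (cmod (cnj (f y) * complex_of_real (gauss_hat e (x - y))))
          \<le> ennreal (1 / 2 * (cmod (f x))\<^sup>2 * gauss_hat e (x - y)) + ennreal (1 / 2 * (cmod (f y))\<^sup>2 * gauss_hat e (x - y))"
        by (simp add: ennreal_mult[symmetric] ennreal_plus[symmetric] norm_mult algebra_simps del: ennreal_plus)
    qed
    finally show "ennreal (cmod (f x * fourier h x)) \<le> \<dots>" .
  qed
  also have "\<dots> = (\<integral>\<^sup>+x. \<integral>\<^sup>+y. ennreal (1 / 2 * (cmod (f x))\<^sup>2 * gauss_hat e (x - y)) \<partial>lebesgue \<partial>lebesgue)
      + (\<integral>\<^sup>+x. \<integral>\<^sup>+y. ennreal (1 / 2 * (cmod (f y))\<^sup>2 * gauss_hat e (x - y)) \<partial>lebesgue \<partial>lebesgue)"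
  proof -
    have pm[measurable]: "(\<lambda>w. gauss_hat e (fst w - snd w)) \<in> borel_measurable (lebesgue \<Otimes>\<^sub>M (lebesgue :: (real^'n) measure))"
      by (rule borel_measurable_lebesgue_pair[of "\<lambda>x y. gauss_hat e (x - y)"]) measurable
    have mm[measurable]: "(\<lambda>y. gauss_hat e (x - y)) \<in> borel_measurable lebesgue" for x :: "real ^ 'n"
      by (intro measurable_completion) simp
    have 1: "(\<lambda>w. ennreal (1 / 2 * (cmod (f (fst w)))\<^sup>2 * gauss_hat e (fst w - snd w))) \<in> borel_measurable (lebesgue \<Otimes>\<^sub>M lebesgue)"
      and 2: "(\<lambda>w. ennreal (1 / 2 * (cmod (f (snd w)))\<^sup>2 * gauss_hat e (fst w - snd w))) \<in> borel_measurable (lebesgue \<Otimes>\<^sub>M lebesgue)"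
      by measurable
    show ?thesis
      by (subst nn_integral_add[symmetric])
        (auto intro!: nn_integral_cong nn_integral_add
            lebesgue.borel_measurable_nn_integral_fst[OF 1, simplified] lebesgue.borel_measurable_nn_integral_fst[OF 2, simplified])
  qed
  also have "(\<integral>\<^sup>+x. \<integral>\<^sup>+y. ennreal (1 / 2 * (cmod (f y))\<^sup>2 * gauss_hat e (x - y)) \<partial>lebesgue \<partial>lebesgue)
      = (\<integral>\<^sup>+y. \<integral>\<^sup>+x. ennreal (1 / 2 * (cmod (f y))\<^sup>2 * gauss_hat e (x - y)) \<partial>lebesgue \<partial>lebesgue)"
  proof (rule lebesgue_pair.Fubini'[symmetric])
    have pm[measurable]: "(\<lambda>w. gauss_hat e (fst w - snd w)) \<in> borel_measurable (lebesgue \<Otimes>\<^sub>M (lebesgue :: (real^'n) measure))"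
      by (rule borel_measurable_lebesgue_pair[of "\<lambda>x y. gauss_hat e (x - y)"]) measurable
    show "(\<lambda>(x, y). ennreal (1 / 2 * (cmod (f y))\<^sup>2 * gauss_hat e (x - y))) \<in> borel_measurable (lebesgue \<Otimes>\<^sub>M lebesgue)"
      unfolding case_prod_beta' by measurable
  qed
  also have "(\<integral>\<^sup>+y. \<integral>\<^sup>+x. ennreal (1 / 2 * (cmod (f y))\<^sup>2 * gauss_hat e (x - y)) \<partial>lebesgue \<partial>lebesgue)
      = (\<integral>\<^sup>+y. ennreal (1 / 2 * (cmod (f y))\<^sup>2) * ?c \<partial>lebesgue)"
  proof (rule nn_integral_cong)
    fix y :: "real ^ 'n"
    have mm[measurable]: "(\<lambda>x. gauss_hat e (x - y)) \<in> borel_measurable lebesgue"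
      by (intro measurable_completion) simp
    show "(\<integral>\<^sup>+x. ennreal (1 / 2 * (cmod (f y))\<^sup>2 * gauss_hat e (x - y)) \<partial>lebesgue) = ennreal (1 / 2 * (cmod (f y))\<^sup>2) * ?c"
      using nn_integral_gauss_hat_translate(1)[OF e, of y]
      by (simp only: ennreal_mult[OF _ gauss_nonneg(3)[OF e]] mult_nonneg_nonneg zero_le_power2 zero_le_divide_1_iff zero_le_numeral)
        (subst nn_integral_cmult, auto)
  qed
  also have "(\<integral>\<^sup>+x. \<integral>\<^sup>+y. ennreal (1 / 2 * (cmod (f x))\<^sup>2 * gauss_hat e (x - y)) \<partial>lebesgue \<partial>lebesgue)
      = (\<integral>\<^sup>+x. ennreal (1 / 2 * (cmod (f x))\<^sup>2) * ?c \<partial>lebesgue)"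
  proof (rule nn_integral_cong)
    fix x :: "real ^ 'n"
    have mm[measurable]: "(\<lambda>y. gauss_hat e (x - y)) \<in> borel_measurable lebesgue"
      by (intro measurable_completion) simp
    show "(\<integral>\<^sup>+y. ennreal (1 / 2 * (cmod (f x))\<^sup>2 * gauss_hat e (x - y)) \<partial>lebesgue) = ennreal (1 / 2 * (cmod (f x))\<^sup>2) * ?c"
      using nn_integral_gauss_hat_translate(2)[OF e, of x]
      by (simp only: ennreal_mult[OF _ gauss_nonneg(3)[OF e]] mult_nonneg_nonneg zero_le_power2 zero_le_divide_1_iff zero_le_numeral)
        (subst nn_integral_cmult, auto)
  qed
  also have "(\<integral>\<^sup>+x. ennreal (1 / 2 * (cmod (f x))\<^sup>2) * ?c \<partial>lebesgue) + (\<integral>\<^sup>+x. ennreal (1 / 2 * (cmod (f x))\<^sup>2) * ?c \<partial>lebesgue) = ?c * ?N"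
  proof -
    have "ennreal (1 / 2 * (cmod (f x))\<^sup>2) * ?c + ennreal (1 / 2 * (cmod (f x))\<^sup>2) * ?c = ?c * ennreal ((cmod (f x))\<^sup>2)" for x
      by (simp add: ennreal_plus[symmetric] ennreal_mult[symmetric] mult.commute del: ennreal_plus)
    then show ?thesis
      by (simp add: nn_integral_add[symmetric] nn_integral_cmult[symmetric])
  qed
  finally show ?thesis .
qed

text \<open>\<open>gauss (1 / (k + 1))\<close> tends to 1 pointwise as k grows, and Fatou's lemma
  keeps the uniform bound. The factor (2 pi)^n belongs to the unnormalised transform.\<close>

lemma plancherel_le:
  fixes f :: "real ^ 'n \<Rightarrow> complex"
  assumes f: "integrable lebesgue f"
  shows "(\<integral>\<^sup>+z. ennreal ((cmod (fourier f z))\<^sup>2) \<partial>lebesgue)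
       \<le> ennreal ((2 * pi) ^ CARD('n)) * (\<integral>\<^sup>+x. ennreal ((cmod (f x))\<^sup>2) \<partial>lebesgue)" (is "_ \<le> ?R")
proof -
  let ?G = "\<lambda>k z. ennreal ((cmod (fourier f z))\<^sup>2 * gauss (1 / real (Suc k)) z)"
  have gm[measurable]: "gauss e \<in> borel_measurable lebesgue" for e
    by (intro measurable_completion; simp)
  note fm[measurable] = borel_measurable_integrable[OF f]
  have lim: "(\<lambda>k. ?G k z) \<longlonglongrightarrow> ennreal ((cmod (fourier f z))\<^sup>2)" for z
  proof -
    have "(\<lambda>k. exp (- ((1 / real (Suc k)) * norm z)\<^sup>2 / 2)) \<longlonglongrightarrow> exp (- (0 * norm z)\<^sup>2 / 2)"
      by (intro tendsto_intros LIMSEQ_Suc lim_1_over_n) auto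
    then have "(\<lambda>k. (cmod (fourier f z))\<^sup>2 * gauss (1 / real (Suc k)) z) \<longlonglongrightarrow> (cmod (fourier f z))\<^sup>2 * 1"
      unfolding gauss_def by (intro tendsto_intros) simp
    then show ?thesis by simp
  qed
  have "(\<integral>\<^sup>+z. ennreal ((cmod (fourier f z))\<^sup>2) \<partial>lebesgue) = (\<integral>\<^sup>+z. liminf (\<lambda>k. ?G k z) \<partial>lebesgue)"
    by (intro nn_integral_cong lim_imp_Liminf[symmetric] lim) simp
  also have "\<dots> \<le> liminf (\<lambda>k. \<integral>\<^sup>+z. ?G k z \<partial>lebesgue)"
    by (rule nn_integral_liminf) measurable
  also have "\<dots> \<le> limsup (\<lambda>k. \<integral>\<^sup>+z. ?G k z \<partial>lebesgue)"
    by (rule Liminf_le_Limsup) simp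
  also have "\<dots> \<le> ?R"
    by (intro Limsup_bounded always_eventually allI fourier_gauss_energy_le[OF f]) simp
  finally show ?thesis .
qed

subsection \<open>Weak Hausdorff-Young and Paley inequalities\<close>

lemma nn_integral_powr_from_0:
  fixes s y :: real
  assumes "0 < s" "0 \<le> y"
  shows "(\<integral>\<^sup>+t. (if 0 \<le> t \<and> t \<le> y then ennreal (t powr (s - 1)) else 0) \<partial>lborel) = ennreal (y powr s / s)"
proof -
  have "(\<integral>\<^sup>+t. ennreal (t powr (s - 1)) * indicator {0..y} t \<partial>lborel) = ennreal (y powr s / s)"
    using has_integral_powr_from_0[of "s - 1" y] assms
    by (intro nn_integral_has_integral_lebesgue') auto
  then show ?thesis
    by (simp add: indicator_def of_bool_def if_distrib[where f="\<lambda>x. _ * x"] cong: if_cong)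
qed

lemma nn_integral_powr_to_inf:
  fixes s y :: real
  assumes "0 < s" "0 < y"
  shows "(\<integral>\<^sup>+t. (if y \<le> t then ennreal (t powr (- s - 1)) else 0) \<partial>lborel) = ennreal (y powr (- s) / s)"
proof -
  have "(\<integral>\<^sup>+t. ennreal (t powr (- s - 1)) * indicator {y..} t \<partial>lborel) = ennreal (y powr (- s) / s)"
    using has_integral_powr_to_inf[of "- s - 1" y] assms
    by (intro nn_integral_has_integral_lebesgue') auto
  then show ?thesis
    by (simp add: indicator_def of_bool_def if_distrib[where f="\<lambda>x. _ * x"] cong: if_cong)
qed

text \<open>Layer cake: the square of \<phi> is the integral of 2 t over 0 < t < \<phi>, and with
  \<phi> \<le> b only heights up to b contribute; each gives at most 2 t * K/t = 2 K. Thus the set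
  {\<phi> \<le> b} has measure at most linear in b with respect to \<open>\<phi>\<^sup>2 dz\<close>,
  which is the weak (1,1) bound of the interpolation.\<close>

lemma weak_L1_square_le:
  fixes \<phi> :: "'a \<Rightarrow> real"
  assumes "sigma_finite_measure M" and \<phi>[measurable]: "\<phi> \<in> borel_measurable M" and nn: "\<And>z. 0 \<le> \<phi> z"
    and weak: "\<And>t. 0 < t \<Longrightarrow> emeasure M {z\<in>space M. t \<le> \<phi> z} \<le> ennreal (K / t)"
    and "0 \<le> K" "0 \<le> b"
  shows "(\<integral>\<^sup>+z. (if \<phi> z \<le> b then ennreal ((\<phi> z)\<^sup>2) else 0) \<partial>M) \<le> ennreal (2 * K * b)"
proof -
  interpret sigma_finite_measure M by fact
  interpret P: pair_sigma_finite "lborel :: real measure" M ..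
  let ?k = "\<lambda>t z. (if 0 \<le> t \<and> t \<le> b then ennreal (2 * t) else 0) * (if t \<le> \<phi> z then 1 else 0)"
  have "(\<integral>\<^sup>+z. (if \<phi> z \<le> b then ennreal ((\<phi> z)\<^sup>2) else 0) \<partial>M) \<le> (\<integral>\<^sup>+z. \<integral>\<^sup>+t. ?k t z \<partial>lborel \<partial>M)"
  proof (rule nn_integral_mono)
    fix z
    have "ennreal ((\<phi> z)\<^sup>2) = ennreal 2 * ennreal ((\<phi> z) powr 2 / 2)"
      using nn[of z] by (subst ennreal_mult[symmetric]) (auto simp: powr_numeral)
    also have "\<dots> = ennreal 2 * (\<integral>\<^sup>+t. (if 0 \<le> t \<and> t \<le> \<phi> z then ennreal (t powr (2 - 1)) else 0) \<partial>lborel)"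
      by (subst nn_integral_powr_from_0) (auto simp: nn)
    also have "\<dots> = (\<integral>\<^sup>+t. ennreal 2 * (if 0 \<le> t \<and> t \<le> \<phi> z then ennreal (t powr (2 - 1)) else 0) \<partial>lborel)"
      by (rule nn_integral_cmult[symmetric]) measurable
    also have "\<dots> \<le> (\<integral>\<^sup>+t. ?k t z \<partial>lborel)" if "\<phi> z \<le> b"
      using that by (intro nn_integral_mono) (auto simp: ennreal_mult)
    finally show "(if \<phi> z \<le> b then ennreal ((\<phi> z)\<^sup>2) else 0) \<le> (\<integral>\<^sup>+t. ?k t z \<partial>lborel)"
      by auto
  qed
  also have "\<dots> = (\<integral>\<^sup>+t. \<integral>\<^sup>+z. ?k t z \<partial>M \<partial>lborel)"
    by (rule P.Fubini') measurable
  also have "\<dots> \<le> (\<integral>\<^sup>+t. ennreal (2 * K) * indicator {0..b} t \<partial>lborel)"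
  proof (rule nn_integral_mono)
    fix t :: real
    have "(\<integral>\<^sup>+z. ?k t z \<partial>M) = (if 0 \<le> t \<and> t \<le> b then ennreal (2 * t) else 0) * (\<integral>\<^sup>+z. (if t \<le> \<phi> z then 1 else 0) \<partial>M)"
      by (rule nn_integral_cmult) measurable
    also have "(\<integral>\<^sup>+z. (if t \<le> \<phi> z then 1 else 0) \<partial>M) = (\<integral>\<^sup>+z. indicator {z\<in>space M. t \<le> \<phi> z} z \<partial>M)"
      by (intro nn_integral_cong) (auto simp: indicator_def)
    also have "\<dots> = emeasure M {z\<in>space M. t \<le> \<phi> z}"
      by (rule nn_integral_indicator) measurable
    also have "(if 0 \<le> t \<and> t \<le> b then ennreal (2 * t) else 0) * emeasure M {z\<in>space M. t \<le> \<phi> z} \<le> ennreal (2 * K) * indicator {0..b} t"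
    proof (cases "0 < t \<and> t \<le> b")
      case True
      then have "ennreal (2 * t) * emeasure M {z\<in>space M. t \<le> \<phi> z} \<le> ennreal (2 * t) * ennreal (K / t)"
        by (intro mult_left_mono weak) auto
      also have "\<dots> = ennreal (2 * K)"
        using True \<open>0 \<le> K\<close> by (simp add: ennreal_mult[symmetric])
      finally show ?thesis using True by simp
    \<comment> \<open>The hypothesis says nothing at height t = 0, but there the factor 2 t
      vanishes.\<close>
    qed (cases "t = 0"; auto)
    finally show "(\<integral>\<^sup>+z. ?k t z \<partial>M) \<le> ennreal (2 * K) * indicator {0..b} t" .
  qed
  also have "\<dots> = ennreal (2 * K * b)"
    using assms by (subst nn_integral_cmult_indicator) (auto simp: ennreal_mult[symmetric])
  finally show ?thesis .
qed

text \<open>Marcinkiewicz splitting at height t: the large values are estimated in L^1, the small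
  ones in L^2. Together with \<open>trunc_lo\<close>, which uses the negated condition, the parts
  add up to f exactly.\<close>

definition trunc_hi :: "real \<Rightarrow> ('a \<Rightarrow> complex) \<Rightarrow> 'a \<Rightarrow> complex" where
  "trunc_hi t f x = (if t < cmod (f x) then f x else 0)"

definition trunc_lo :: "real \<Rightarrow> ('a \<Rightarrow> complex) \<Rightarrow> 'a \<Rightarrow> complex" where
  "trunc_lo t f x = (if t < cmod (f x) then 0 else f x)"

lemma integrable_trunc:
  assumes f: "integrable M f"
  shows "integrable M (trunc_hi t f)" "integrable M (trunc_lo t f)"
proof -
  note [measurable] = borel_measurable_integrable[OF f]
  show "integrable M (trunc_hi t f)"
    by (rule Bochner_Integration.integrable_bound[OF f]) (auto simp: trunc_hi_def[abs_def])
  show "integrable M (trunc_lo t f)"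
    by (rule Bochner_Integration.integrable_bound[OF f]) (auto simp: trunc_lo_def[abs_def])
qed

lemma norm_fourier_trunc_le:
  fixes f :: "real ^ 'n \<Rightarrow> complex"
  assumes f: "integrable lebesgue f"
  shows "cmod (fourier f z) \<le> (LINT x|lebesgue. cmod (trunc_hi t f x)) + cmod (fourier (trunc_lo t f) z)"
proof -
  have "f = (\<lambda>x. trunc_hi t f x + trunc_lo t f x)"
    by (auto simp: trunc_hi_def trunc_lo_def)
  then have eq: "fourier f z = fourier (trunc_hi t f) z + fourier (trunc_lo t f) z"
    using fourier_add[OF integrable_trunc[OF f], of t t z] by simp
  show ?thesis
    unfolding eq using norm_triangle_ineq[of "fourier (trunc_hi t f) z" "fourier (trunc_lo t f) z"]
      fourier_bound[OF integrable_trunc(1)[OF f], of t z] by linarith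
qed

text \<open>Splitting at height h leaves at most l/4 of the transform to the large part, so on the
  set in question the transform of the small part is still at least l/4; Chebyshev and the
  Plancherel inequality bound the measure of that set.\<close>

lemma hausdorff_young_weak:
  fixes f :: "real ^ 'n \<Rightarrow> complex" and p l :: real
  assumes p: "1 < p" "p < 2" and f: "integrable lebesgue f"
    and N: "(\<integral>\<^sup>+x. ennreal (cmod (f x) powr p) \<partial>lebesgue) \<le> 1" and l: "0 < l"
  shows "emeasure lebesgue {z. l \<le> cmod (fourier f z)}
     \<le> ennreal (16 * 4 powr ((2 - p) / (p - 1)) * (2 * pi) ^ CARD('n) * l powr (- conj_exp p))"
proof -
  \<comment> \<open>Solves h powr (1 - p) = l / 4. Where |f| > h one has |f| \<le> h powr (1 - p) *
    |f| powr p, so this is the L^1 bound of the large part.\<close>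
  define h where "h = (l / 4) powr (- 1 / (p - 1))"
  note [measurable] = borel_measurable_integrable[OF f] borel_measurable_integrable[OF integrable_trunc(1)[OF f]] borel_measurable_integrable[OF integrable_trunc(2)[OF f]]
  have h: "0 < h" using l by (simp add: h_def)
  have h1: "h powr (1 - p) = l / 4"
    using l p by (simp add: h_def powr_powr minus_divide_left[symmetric] divide_minus_left[symmetric] del: divide_minus_left minus_divide_left)
  have "ennreal (LINT x|lebesgue. cmod (trunc_hi h f x)) = (\<integral>\<^sup>+x. ennreal (cmod (trunc_hi h f x)) \<partial>lebesgue)"
    using integrable_trunc(1)[OF f] by (intro nn_integral_eq_integral[symmetric]) auto
  also have "\<dots> \<le> (\<integral>\<^sup>+x. ennreal (h powr (1 - p)) * ennreal (cmod (f x) powr p) \<partial>lebesgue)"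
  proof (rule nn_integral_mono)
    fix x
    have "cmod (f x) \<le> h powr (1 - p) * cmod (f x) powr p" if "h < cmod (f x)"
    proof -
      have "cmod (f x) = cmod (f x) powr (1 - p) * cmod (f x) powr p"
        using that h by (simp add: powr_add[symmetric])
      also have "\<dots> \<le> h powr (1 - p) * cmod (f x) powr p"
        using that h p by (intro mult_right_mono powr_mono2') auto
      finally show ?thesis .
    qed
    then show "ennreal (cmod (trunc_hi h f x)) \<le> ennreal (h powr (1 - p)) * ennreal (cmod (f x) powr p)"
      by (auto simp: trunc_hi_def ennreal_mult[symmetric] intro!: ennreal_leI)
  qed
  also have "\<dots> = ennreal (h powr (1 - p)) * (\<integral>\<^sup>+x. ennreal (cmod (f x) powr p) \<partial>lebesgue)"
    by (rule nn_integral_cmult) measurable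
  also have "\<dots> \<le> ennreal (h powr (1 - p)) * 1"
    by (intro mult_left_mono N) auto
  finally have hi: "(LINT x|lebesgue. cmod (trunc_hi h f x)) \<le> l / 4"
    using l by (simp add: h1)
  have "(\<integral>\<^sup>+x. ennreal ((cmod (trunc_lo h f x))\<^sup>2) \<partial>lebesgue) \<le> (\<integral>\<^sup>+x. ennreal (h powr (2 - p)) * ennreal (cmod (f x) powr p) \<partial>lebesgue)"
  proof (rule nn_integral_mono)
    fix x
    have "(cmod (f x))\<^sup>2 \<le> h powr (2 - p) * cmod (f x) powr p" if "\<not> h < cmod (f x)"
    proof (cases "f x = 0")
      case False
      then have "(cmod (f x))\<^sup>2 = cmod (f x) powr (2 - p) * cmod (f x) powr p"
        by (simp add: powr_add[symmetric] powr_numeral)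
      also have "\<dots> \<le> h powr (2 - p) * cmod (f x) powr p"
        using that h p by (intro mult_right_mono powr_mono2) auto
      finally show ?thesis .
    qed simp
    then show "ennreal ((cmod (trunc_lo h f x))\<^sup>2) \<le> ennreal (h powr (2 - p)) * ennreal (cmod (f x) powr p)"
      by (auto simp: trunc_lo_def ennreal_mult[symmetric] intro!: ennreal_leI)
  qed
  also have "\<dots> = ennreal (h powr (2 - p)) * (\<integral>\<^sup>+x. ennreal (cmod (f x) powr p) \<partial>lebesgue)"
    by (rule nn_integral_cmult) measurable
  also have "\<dots> \<le> ennreal (h powr (2 - p)) * 1"
    by (intro mult_left_mono N) auto
  finally have lo: "(\<integral>\<^sup>+x. ennreal ((cmod (trunc_lo h f x))\<^sup>2) \<partial>lebesgue) \<le> ennreal (h powr (2 - p))"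
    by simp
  have sub: "{z. l \<le> cmod (fourier f z)} \<subseteq> {z\<in>UNIV. 1 \<le> ennreal (16 / l\<^sup>2) * ennreal ((cmod (fourier (trunc_lo h f) z))\<^sup>2)}"
  proof
    fix z assume "z \<in> {z. l \<le> cmod (fourier f z)}"
    then have "l / 4 \<le> cmod (fourier (trunc_lo h f) z)"
      using norm_fourier_trunc_le[OF f, of z h] hi l by simp
    then have "(l / 4)\<^sup>2 \<le> (cmod (fourier (trunc_lo h f) z))\<^sup>2"
      using l by (intro power_mono) auto
    then have "1 \<le> 16 / l\<^sup>2 * (cmod (fourier (trunc_lo h f) z))\<^sup>2"
      using l by (simp add: field_simps)
    then show "z \<in> {z\<in>UNIV. 1 \<le> ennreal (16 / l\<^sup>2) * ennreal ((cmod (fourier (trunc_lo h f) z))\<^sup>2)}"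
      by (auto simp: ennreal_mult[symmetric])
  qed
  have U[measurable]: "(UNIV :: (real ^ 'n) set) \<in> sets lebesgue"
    using sets.top[of "lebesgue :: (real ^ 'n) measure"] by simp
  have "emeasure lebesgue {z. l \<le> cmod (fourier f z)} \<le> emeasure lebesgue {z\<in>UNIV. 1 \<le> ennreal (16 / l\<^sup>2) * ennreal ((cmod (fourier (trunc_lo h f) z))\<^sup>2)}"
    by (rule emeasure_mono[OF sub]) measurable
  also have "\<dots> \<le> ennreal (16 / l\<^sup>2) * (\<integral>\<^sup>+z. ennreal ((cmod (fourier (trunc_lo h f) z))\<^sup>2) * indicator UNIV z \<partial>lebesgue)"
    by (rule nn_integral_Markov_inequality) (auto intro: U)
  also have "\<dots> \<le> ennreal (16 / l\<^sup>2) * (ennreal ((2 * pi) ^ CARD('n)) * ennreal (h powr (2 - p)))"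
    using order_trans[OF plancherel_le[OF integrable_trunc(2)[OF f]] mult_left_mono[OF lo]]
    by (intro mult_left_mono) auto
  also have "\<dots> = ennreal (16 / l\<^sup>2 * ((2 * pi) ^ CARD('n) * h powr (2 - p)))"
    by (simp only: ennreal_mult[symmetric] powr_ge_zero mult_nonneg_nonneg zero_le_power pi_ge_zero zero_le_numeral divide_nonneg_nonneg zero_le_power2)
  also have "16 / l\<^sup>2 * ((2 * pi) ^ CARD('n) * h powr (2 - p)) = 16 * 4 powr ((2 - p) / (p - 1)) * (2 * pi) ^ CARD('n) * l powr (- conj_exp p)"
  proof -
    have "h powr (2 - p) = (l / 4) powr (- ((2 - p) / (p - 1)))"
      by (simp add: h_def powr_powr)
    also have "\<dots> = 4 powr ((2 - p) / (p - 1)) * l powr (- ((2 - p) / (p - 1)))"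
      using l by (simp add: powr_divide powr_minus divide_simps)
    finally have "h powr (2 - p) = 4 powr ((2 - p) / (p - 1)) * l powr (- ((2 - p) / (p - 1)))" .
    moreover have "l powr (- conj_exp p) = l powr (- 2) * l powr (- ((2 - p) / (p - 1)))"
    proof -
      have "- conj_exp p = - 2 + - ((2 - p) / (p - 1))"
        using p by (simp add: conj_exp_def field_simps)
      then show ?thesis by (simp only: powr_add)
    qed
    moreover have "l powr (- 2) = 1 / l\<^sup>2"
      using l by (simp add: powr_minus powr_numeral divide_simps)
    ultimately show ?thesis by simp
  qed
  finally show ?thesis .
qed

text \<open>The integrand is (|fourier f| / \<phi>) powr p with respect to
  \<open>\<phi>\<^sup>2 dz\<close>. At level t of this quotient f is split at the same height t: the
  large part enters through its L^1 norm and the weak (1,1) bound, the small part through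
  Plancherel. Integrating the two bounds over t produces 1/(p - 1) and 1/(2 - p).\<close>

lemma paley:
  fixes f :: "real ^ 'n \<Rightarrow> complex" and p K :: real and \<phi> :: "real ^ 'n \<Rightarrow> real"
  assumes p: "1 < p" "p < 2" and f: "integrable lebesgue f"
    and \<phi>[measurable]: "\<phi> \<in> borel_measurable lebesgue" and nn: "\<And>z. 0 \<le> \<phi> z" and K: "0 \<le> K"
    and weak: "\<And>t. 0 < t \<Longrightarrow> emeasure lebesgue {z. t \<le> \<phi> z} \<le> ennreal (K / t)"
  shows "(\<integral>\<^sup>+z. ennreal (cmod (fourier f z) powr p * \<phi> z powr (2 - p)) \<partial>lebesgue)
     \<le> ennreal (4 * K * p / (p - 1) + 4 * (2 * pi) ^ CARD('n) * p / (2 - p))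
        * (\<integral>\<^sup>+x. ennreal (cmod (f x) powr p) \<partial>lebesgue)"
proof -
  interpret P: pair_sigma_finite "lborel :: real measure" "lebesgue :: (real^'n) measure" ..
  define c where "c = (2 * pi) ^ CARD('n)"
  have c: "0 \<le> c" by (simp add: c_def)
  note fm[measurable] = borel_measurable_integrable[OF f]
  define G where "G z = cmod (fourier f z)" for z
  have G[measurable]: "G \<in> borel_measurable lebesgue" and Gnn: "\<And>z. 0 \<le> G z"
    by (auto simp: G_def[abs_def])
  \<comment> \<open>Layer-cake integrand p t powr (p - 1) against the square of \<phi>. The
    condition |fourier f| / \<phi> \<ge> t is written as a product, so that zeros of \<phi> cause no
    division.\<close>
  define H where "H t z = (if 0 \<le> t \<and> t * \<phi> z \<le> G z then ennreal (p * t powr (p - 1)) else 0) * ennreal ((\<phi> z)\<^sup>2)" for t z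
  \<comment> \<open>\<open>a\<close> and \<open>b\<close> carry the power of t left by the estimate
    of the large and of the small part. The exponents are written so that the two power integrals
    apply with s = p - 1 and s = 2 - p.\<close>
  define a where "a t x = (if 0 \<le> t \<and> t \<le> cmod (f x) then ennreal (t powr (p - 1 - 1)) else 0) * ennreal (cmod (f x))" for t x
  define b where "b t x = (if cmod (f x) \<le> t then ennreal (t powr (- (2 - p) - 1)) else 0) * ennreal ((cmod (f x))\<^sup>2)" for t x
  have Hm[measurable]: "(\<lambda>(t, z). H t z) \<in> borel_measurable (lborel \<Otimes>\<^sub>M lebesgue)"
    unfolding H_def by measurable
  have am[measurable]: "(\<lambda>(t, z). a t z) \<in> borel_measurable (lborel \<Otimes>\<^sub>M lebesgue)"
    unfolding a_def by measurable
  have bm[measurable]: "(\<lambda>(t, z). b t z) \<in> borel_measurable (lborel \<Otimes>\<^sub>M lebesgue)"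
    unfolding b_def by measurable
  have "(\<integral>\<^sup>+z. ennreal (G z powr p * \<phi> z powr (2 - p)) \<partial>lebesgue) \<le> (\<integral>\<^sup>+z. \<integral>\<^sup>+t. H t z \<partial>lborel \<partial>lebesgue)"
  proof (rule nn_integral_mono)
    fix z
    show "ennreal (G z powr p * \<phi> z powr (2 - p)) \<le> (\<integral>\<^sup>+t. H t z \<partial>lborel)"
    proof (cases "\<phi> z = 0")
      case False
      with nn[of z] have pos: "0 < \<phi> z" by simp
      have "G z powr p * \<phi> z powr (2 - p) = p * ((G z / \<phi> z) powr p / p) * (\<phi> z)\<^sup>2"
        using pos Gnn[of z] p by (simp add: powr_divide powr_diff powr_numeral)
      then have "ennreal (G z powr p * \<phi> z powr (2 - p)) = ennreal p * ennreal ((G z / \<phi> z) powr p / p) * ennreal ((\<phi> z)\<^sup>2)"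
        using p by (simp add: ennreal_mult[symmetric])
      also have "ennreal ((G z / \<phi> z) powr p / p) = (\<integral>\<^sup>+t. (if 0 \<le> t \<and> t \<le> G z / \<phi> z then ennreal (t powr (p - 1)) else 0) \<partial>lborel)"
        using p pos Gnn[of z] by (subst nn_integral_powr_from_0) auto
      also have "ennreal p * \<dots> * ennreal ((\<phi> z)\<^sup>2) = (\<integral>\<^sup>+t. ennreal p * (if 0 \<le> t \<and> t \<le> G z / \<phi> z then ennreal (t powr (p - 1)) else 0) * ennreal ((\<phi> z)\<^sup>2) \<partial>lborel)"
        by (subst nn_integral_multc, measurable, subst nn_integral_cmult, auto)
      also have "\<dots> = (\<integral>\<^sup>+t. H t z \<partial>lborel)"
        using pos p by (intro nn_integral_cong) (auto simp: H_def ennreal_mult field_simps)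
      finally show ?thesis by simp
    qed simp
  qed
  also have "\<dots> = (\<integral>\<^sup>+t. \<integral>\<^sup>+z. H t z \<partial>lebesgue \<partial>lborel)"
    by (rule P.Fubini') measurable
  also have "\<dots> \<le> (\<integral>\<^sup>+t. ennreal (4 * K * p) * (\<integral>\<^sup>+x. a t x \<partial>lebesgue) + ennreal (4 * c * p) * (\<integral>\<^sup>+x. b t x \<partial>lebesgue) \<partial>lborel)"
  proof (rule nn_integral_mono)
    fix t :: real
    show "(\<integral>\<^sup>+z. H t z \<partial>lebesgue) \<le> ennreal (4 * K * p) * (\<integral>\<^sup>+x. a t x \<partial>lebesgue) + ennreal (4 * c * p) * (\<integral>\<^sup>+x. b t x \<partial>lebesgue)"
    proof (cases "0 < t")
      case False
      then have "H t z = 0" for z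
        by (cases "t = 0") (auto simp: H_def)
      then show ?thesis by simp
    next
      case t: True
      note hi = integrable_trunc(1)[OF f, of t] and lo = integrable_trunc(2)[OF f, of t]
      note [measurable] = borel_measurable_integrable[OF hi] borel_measurable_integrable[OF lo]
      define A where "A = (LINT x|lebesgue. cmod (trunc_hi t f x))"
      have A: "0 \<le> A" by (simp add: A_def)
      have eA: "ennreal A = (\<integral>\<^sup>+x. ennreal (cmod (trunc_hi t f x)) \<partial>lebesgue)"
        unfolding A_def using hi by (intro nn_integral_eq_integral[symmetric]) auto
      let ?L = "\<lambda>z. cmod (fourier (trunc_lo t f) z)"
      have fa: "ennreal (t powr (p - 1 - 1)) * ennreal A \<le> (\<integral>\<^sup>+x. a t x \<partial>lebesgue)"
        unfolding eA using t
        by (subst nn_integral_cmult[symmetric], measurable) (auto intro!: nn_integral_mono simp: a_def trunc_hi_def)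
      have fb: "(\<integral>\<^sup>+x. ennreal (t powr (- (2 - p) - 1)) * ennreal ((cmod (trunc_lo t f x))\<^sup>2) \<partial>lebesgue) \<le> (\<integral>\<^sup>+x. b t x \<partial>lebesgue)"
        by (intro nn_integral_mono) (auto simp: b_def trunc_lo_def)
      have "(\<integral>\<^sup>+z. H t z \<partial>lebesgue) \<le> (\<integral>\<^sup>+z. ennreal (p * t powr (p - 1)) *
          ((if \<phi> z \<le> 2 * A / t then ennreal ((\<phi> z)\<^sup>2) else 0) + ennreal (4 / t\<^sup>2) * ennreal ((?L z)\<^sup>2)) \<partial>lebesgue)"
      proof (rule nn_integral_mono)
        fix z
        \<comment> \<open>Here t \<phi> is at most A plus the transform of the small part: either
          \<phi> \<le> 2 A / t, or the second summand is at least half of t \<phi>.\<close>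
        have "ennreal ((\<phi> z)\<^sup>2) \<le> (if \<phi> z \<le> 2 * A / t then ennreal ((\<phi> z)\<^sup>2) else 0) + ennreal (4 / t\<^sup>2) * ennreal ((?L z)\<^sup>2)"
          if *: "t * \<phi> z \<le> G z"
        proof (cases "\<phi> z \<le> 2 * A / t")
          case False
          then have "2 * A < t * \<phi> z"
            using t by (simp add: field_simps)
          moreover have "G z \<le> A + ?L z"
            using norm_fourier_trunc_le[OF f, of z t] by (simp add: G_def A_def)
          ultimately have "t * \<phi> z \<le> 2 * ?L z"
            using * by linarith
          then have "(t * \<phi> z)\<^sup>2 \<le> (2 * ?L z)\<^sup>2"
            using t nn[of z] by (intro power_mono) auto
          then have "(\<phi> z)\<^sup>2 \<le> 4 / t\<^sup>2 * (?L z)\<^sup>2"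
            using t by (simp add: power_mult_distrib field_simps)
          then show ?thesis
            using False by (simp add: ennreal_mult[symmetric])
        qed simp
        then show "H t z \<le> ennreal (p * t powr (p - 1)) *
          ((if \<phi> z \<le> 2 * A / t then ennreal ((\<phi> z)\<^sup>2) else 0) + ennreal (4 / t\<^sup>2) * ennreal ((?L z)\<^sup>2))"
          using t by (auto simp: H_def intro!: mult_left_mono)
      qed
      also have "\<dots> = ennreal (p * t powr (p - 1)) * ((\<integral>\<^sup>+z. (if \<phi> z \<le> 2 * A / t then ennreal ((\<phi> z)\<^sup>2) else 0) \<partial>lebesgue)
          + ennreal (4 / t\<^sup>2) * (\<integral>\<^sup>+z. ennreal ((?L z)\<^sup>2) \<partial>lebesgue))"
        by (subst nn_integral_cmult, measurable, subst nn_integral_add, measurable, subst nn_integral_cmult, measurable)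
      also have "\<dots> \<le> ennreal (p * t powr (p - 1)) * (ennreal (2 * K * (2 * A / t))
          + ennreal (4 / t\<^sup>2) * (ennreal c * (\<integral>\<^sup>+x. ennreal ((cmod (trunc_lo t f x))\<^sup>2) \<partial>lebesgue)))"
        using weak_L1_square_le[OF sigma_finite_lebesgue \<phi> nn _ K, of "2 * A / t"] weak A t plancherel_le[OF lo]
        by (intro mult_left_mono add_mono) (auto simp: c_def)
      also have "\<dots> = ennreal (p * t powr (p - 1) * (2 * K * (2 / t))) * ennreal A
          + ennreal (p * t powr (p - 1) * (4 / t\<^sup>2) * c) * (\<integral>\<^sup>+x. ennreal ((cmod (trunc_lo t f x))\<^sup>2) \<partial>lebesgue)"
        using p t K A c by (simp add: distrib_left ennreal_mult[symmetric] mult.assoc[symmetric])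
      also have "p * t powr (p - 1) * (2 * K * (2 / t)) = 4 * K * p * t powr (p - 1 - 1)"
        using t by (simp add: powr_diff power2_eq_square)
      also have "p * t powr (p - 1) * (4 / t\<^sup>2) * c = 4 * c * p * t powr (- (2 - p) - 1)"
        using t by (simp add: powr_diff powr_minus powr_add powr_numeral power2_eq_square power3_eq_cube divide_simps)
      also have "ennreal (4 * K * p * t powr (p - 1 - 1)) * ennreal A = ennreal (4 * K * p) * (ennreal (t powr (p - 1 - 1)) * ennreal A)"
        using K p A by (simp add: ennreal_mult[symmetric] mult.assoc)
      also have "ennreal (4 * c * p * t powr (- (2 - p) - 1)) = ennreal (4 * c * p) * ennreal (t powr (- (2 - p) - 1))"
        using c p by (simp add: ennreal_mult)
      also have "\<dots> * (\<integral>\<^sup>+x. ennreal ((cmod (trunc_lo t f x))\<^sup>2) \<partial>lebesgue) = ennreal (4 * c * p) * (\<integral>\<^sup>+x. ennreal (t powr (- (2 - p) - 1)) * ennreal ((cmod (trunc_lo t f x))\<^sup>2) \<partial>lebesgue)"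
        by (subst nn_integral_cmult, measurable) (simp add: mult.assoc)
      also have "ennreal (4 * K * p) * (ennreal (t powr (p - 1 - 1)) * ennreal A)
          + ennreal (4 * c * p) * (\<integral>\<^sup>+x. ennreal (t powr (- (2 - p) - 1)) * ennreal ((cmod (trunc_lo t f x))\<^sup>2) \<partial>lebesgue)
          \<le> ennreal (4 * K * p) * (\<integral>\<^sup>+x. a t x \<partial>lebesgue) + ennreal (4 * c * p) * (\<integral>\<^sup>+x. b t x \<partial>lebesgue)"
        by (intro add_mono mult_left_mono fa fb) auto
      finally show ?thesis .
    qed
  qed
  also have "\<dots> = ennreal (4 * K * p) * (\<integral>\<^sup>+t. \<integral>\<^sup>+x. a t x \<partial>lebesgue \<partial>lborel) + ennreal (4 * c * p) * (\<integral>\<^sup>+t. \<integral>\<^sup>+x. b t x \<partial>lebesgue \<partial>lborel)"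
    by (subst nn_integral_add, measurable, subst nn_integral_cmult, measurable, subst nn_integral_cmult, auto)
  also have "(\<integral>\<^sup>+t. \<integral>\<^sup>+x. a t x \<partial>lebesgue \<partial>lborel) = (\<integral>\<^sup>+x. \<integral>\<^sup>+t. a t x \<partial>lborel \<partial>lebesgue)"
    by (rule P.Fubini'[symmetric]) measurable
  also have "\<dots> = (\<integral>\<^sup>+x. ennreal (1 / (p - 1)) * ennreal (cmod (f x) powr p) \<partial>lebesgue)"
  proof (rule nn_integral_cong)
    fix x
    have "(\<integral>\<^sup>+t. a t x \<partial>lborel) = ennreal (cmod (f x) powr (p - 1) / (p - 1)) * ennreal (cmod (f x))"
      unfolding a_def using p by (subst nn_integral_multc, measurable) (subst nn_integral_powr_from_0, auto)
    also have "\<dots> = ennreal (1 / (p - 1)) * ennreal (cmod (f x) powr p)"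
      using p by (cases "f x = 0") (auto simp: ennreal_mult[symmetric] powr_diff)
    finally show "(\<integral>\<^sup>+t. a t x \<partial>lborel) = ennreal (1 / (p - 1)) * ennreal (cmod (f x) powr p)" .
  qed
  also have "\<dots> = ennreal (1 / (p - 1)) * (\<integral>\<^sup>+x. ennreal (cmod (f x) powr p) \<partial>lebesgue)"
    by (rule nn_integral_cmult) measurable
  also have "(\<integral>\<^sup>+t. \<integral>\<^sup>+x. b t x \<partial>lebesgue \<partial>lborel) = (\<integral>\<^sup>+x. \<integral>\<^sup>+t. b t x \<partial>lborel \<partial>lebesgue)"
    by (rule P.Fubini'[symmetric]) measurable
  also have "\<dots> = (\<integral>\<^sup>+x. ennreal (1 / (2 - p)) * ennreal (cmod (f x) powr p) \<partial>lebesgue)"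
  proof (rule nn_integral_cong)
    fix x
    show "(\<integral>\<^sup>+t. b t x \<partial>lborel) = ennreal (1 / (2 - p)) * ennreal (cmod (f x) powr p)"
    proof (cases "f x = 0")
      case False
      have "(\<integral>\<^sup>+t. b t x \<partial>lborel) = ennreal (cmod (f x) powr (- (2 - p)) / (2 - p)) * ennreal ((cmod (f x))\<^sup>2)"
        unfolding b_def using p False by (subst nn_integral_multc, measurable) (subst nn_integral_powr_to_inf, auto)
      also have "\<dots> = ennreal (1 / (2 - p)) * ennreal (cmod (f x) powr p)"
        using p False by (auto simp: ennreal_mult[symmetric] powr_diff powr_numeral)
      finally show ?thesis .
    qed (simp add: b_def)
  qed
  also have "\<dots> = ennreal (1 / (2 - p)) * (\<integral>\<^sup>+x. ennreal (cmod (f x) powr p) \<partial>lebesgue)"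
    by (rule nn_integral_cmult) measurable
  also have "ennreal (4 * K * p) * (ennreal (1 / (p - 1)) * (\<integral>\<^sup>+x. ennreal (cmod (f x) powr p) \<partial>lebesgue))
     + ennreal (4 * c * p) * (ennreal (1 / (2 - p)) * (\<integral>\<^sup>+x. ennreal (cmod (f x) powr p) \<partial>lebesgue))
     = ennreal (4 * K * p / (p - 1) + 4 * c * p / (2 - p)) * (\<integral>\<^sup>+x. ennreal (cmod (f x) powr p) \<partial>lebesgue)"
    using p K c by (simp add: mult.assoc[symmetric] ennreal_mult[symmetric] distrib_right)
  finally show ?thesis by (simp add: G_def c_def)
qed

subsection \<open>The Paley inequality for weak-type weights\<close>

text \<open>Exhaustion by balls and continuity from below. It allows weak-type conditions to be
  tested on bounded sets, which lie in a cube and have a finite real measure.\<close>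

lemma emeasure_le_if_bounded_subsets:
  fixes E :: "'a::euclidean_space set"
  assumes E: "E \<in> sets lebesgue"
    and le: "\<And>E'. E' \<subseteq> E \<Longrightarrow> E' \<in> sets lebesgue \<Longrightarrow> bounded E' \<Longrightarrow> measure lebesgue E' \<le> c"
  shows "emeasure lebesgue E \<le> ennreal c"
proof -
  let ?E = "\<lambda>n::nat. E \<inter> cball 0 (real n)"
  have m: "?E n \<in> sets lebesgue" for n
    using E by (intro sets.Int) auto
  have "(\<Union>n. ?E n) = E"
    using real_arch_simple by (auto simp: dist_norm)
  moreover have "(SUP n. emeasure lebesgue (?E n)) = emeasure lebesgue (\<Union>n. ?E n)"
    using m by (intro SUP_emeasure_incseq) (auto simp: incseq_def)
  moreover have "emeasure lebesgue (?E n) \<le> ennreal c" for n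
  proof -
    have b: "bounded (?E n)" by (auto intro: bounded_subset[OF bounded_cball])
    then have "?E n \<in> lmeasurable"
      by (intro bounded_set_imp_lmeasurable m)
    then have "emeasure lebesgue (?E n) = ennreal (measure lebesgue (?E n))"
      by (intro emeasure_eq_measure2) (auto simp: fmeasurable_def)
    also have "\<dots> \<le> ennreal c"
      using le[of "?E n"] m b by (intro ennreal_leI) auto
    finally show ?thesis .
  qed
  ultimately show ?thesis
    by (metis SUP_least)
qed

text \<open>Taking the exponent 0 for \<open>\<beta>\<close> expresses \<open>g \<le> A\<close> almost everywhere, because
  \<open>0 powr 0 = 0\<close>.\<close>

definition weak_type :: "real \<Rightarrow> real \<Rightarrow> ('a::euclidean_space \<Rightarrow> real) \<Rightarrow> bool" where
  "weak_type \<beta> A g \<longleftrightarrow> (\<forall>t>0. \<forall>E\<in>sets lebesgue. bounded E \<longrightarrow> E \<subseteq> {x. t \<le> g x} \<longrightarrow>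
     t * measure lebesgue E powr \<beta> \<le> A)"

text \<open>For \<beta> > 0 the condition is solved for the measure. For \<beta> = 0 a bounded
  subset of positive measure would force t \<le> A, so beyond height A all of them are null.\<close>

lemma weak_type_emeasure:
  assumes w: "weak_type \<beta> A g" and g[measurable]: "g \<in> borel_measurable lebesgue" and t: "0 < t"
  shows "0 < \<beta> \<Longrightarrow> emeasure lebesgue {x. t \<le> g x} \<le> ennreal ((A / t) powr (1 / \<beta>))"
    and "\<beta> = 0 \<Longrightarrow> A < t \<Longrightarrow> emeasure lebesgue {x. t \<le> g x} = 0"
proof -
  have m: "{x. t \<le> g x} \<in> sets lebesgue"
    using measurable_sets[OF g, of "{t..}"] by (simp add: vimage_def)
  have le: "t * measure lebesgue E powr \<beta> \<le> A" if "E \<subseteq> {x. t \<le> g x}" "E \<in> sets lebesgue" "bounded E" for E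
    using w t that by (auto simp: weak_type_def)
  { assume b: "0 < \<beta>"
    show "emeasure lebesgue {x. t \<le> g x} \<le> ennreal ((A / t) powr (1 / \<beta>))"
    proof (rule emeasure_le_if_bounded_subsets[OF m])
      fix E assume "E \<subseteq> {x. t \<le> g x}" "E \<in> sets lebesgue" "bounded E"
      from le[OF this] have "measure lebesgue E powr \<beta> \<le> A / t"
        using t by (simp add: field_simps)
      then have "(measure lebesgue E powr \<beta>) powr (1 / \<beta>) \<le> (A / t) powr (1 / \<beta>)"
        using b by (intro powr_mono2) auto
      then show "measure lebesgue E \<le> (A / t) powr (1 / \<beta>)"
        using b by (simp add: powr_powr)
    qed }
  { assume b: "\<beta> = 0" "A < t"
    have "emeasure lebesgue {x. t \<le> g x} \<le> ennreal 0"
    proof (rule emeasure_le_if_bounded_subsets[OF m])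
      fix E assume "E \<subseteq> {x. t \<le> g x}" "E \<in> sets lebesgue" "bounded E"
      from le[OF this] show "measure lebesgue E \<le> 0"
        using b by (cases "measure lebesgue E = 0") auto
    qed
    then show "emeasure lebesgue {x. t \<le> g x} = 0" by simp }
qed

text \<open>Where \<phi> \<ge> t, either the transform is at least l or g is at least \<tau>, if l
  powr (q - p) * \<tau> = t powr (2 - p). The threshold l is taken so that the weak Hausdorff-Young
  bound decays like 1/t; then \<tau> is a multiple of t powr \<beta>, which the weak type of g turns
  into 1/t again. The normalisation of f makes the constant for \<phi> independent of f.\<close>

lemma fourier_weak_weight_unit:
  fixes p q A :: real and g :: "real ^ 'n \<Rightarrow> real"
  assumes p: "1 < p" "p < 2" and q: "p \<le> q" "q \<le> conj_exp p"
    and g[measurable]: "g \<in> borel_measurable lebesgue" and nn: "\<And>x. 0 \<le> g x"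
    and w: "weak_type (1 - q / conj_exp p) A g"
  shows "\<exists>C>0. \<forall>f. integrable lebesgue f \<longrightarrow> (\<integral>\<^sup>+x. ennreal (cmod (f x) powr p) \<partial>lebesgue) \<le> 1 \<longrightarrow>
           (\<integral>\<^sup>+z. ennreal (cmod (fourier f z) powr q * g z) \<partial>lebesgue) \<le> ennreal C"
proof -
  define \<beta> where "\<beta> = 1 - q / conj_exp p"
  have cp: "0 < conj_exp p" using p by (simp add: conj_exp_def)
  have b0: "0 \<le> \<beta>" using q cp by (simp add: \<beta>_def)
  note w = w[folded \<beta>_def]
  have pp: "2 - p = 1 - p / conj_exp p" using p by (simp add: conj_exp_def)
  have eqp: "(q - p) / conj_exp p = 2 - p - \<beta>"
    using pp by (simp add: \<beta>_def diff_divide_distrib)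
  define K1 where "K1 = 16 * 4 powr ((2 - p) / (p - 1)) * (2 * pi) ^ CARD('n)"
  have K1: "0 \<le> K1" by (simp add: K1_def)
  \<comment> \<open>A free parameter for \<beta> = 0, where \<tau> = \<kappa> powr (- (2 - p)) does
    not depend on t: the choice makes \<tau> = |A| + 1, a height that g reaches only on a null
    set.\<close>
  define \<kappa> where "\<kappa> = (if \<beta> = 0 then (\<bar>A\<bar> + 1) powr (- 1 / (2 - p)) else 1)"
  have \<kappa>: "0 < \<kappa>" using abs_ge_zero[of A] by (auto simp: \<kappa>_def simp del: abs_ge_zero)
  define K2 where "K2 = K1 / \<kappa> + (if \<beta> = 0 then 0 else A powr (1 / \<beta>))"
  have K2: "0 \<le> K2" using K1 \<kappa> by (simp add: K2_def)
  define D where "D = 4 * K2 * p / (p - 1) + 4 * (2 * pi) ^ CARD('n) * p / (2 - p)"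
  have D: "0 < D"
    using K2 p unfolding D_def by (intro add_nonneg_pos) auto
  show ?thesis
  proof (intro exI[of _ D] conjI allI impI D)
    fix f :: "real ^ 'n \<Rightarrow> complex"
    assume f: "integrable lebesgue f" and N: "(\<integral>\<^sup>+x. ennreal (cmod (f x) powr p) \<partial>lebesgue) \<le> 1"
    note [measurable] = borel_measurable_integrable[OF f]
    define G where "G z = cmod (fourier f z)" for z
    have Gm[measurable]: "G \<in> borel_measurable lebesgue" and Gnn: "\<And>z. 0 \<le> G z"
      by (auto simp: G_def[abs_def])
    define \<phi> where "\<phi> z = (G z powr (q - p) * g z) powr (1 / (2 - p))" for z
    have \<phi>m[measurable]: "\<phi> \<in> borel_measurable lebesgue" and \<phi>nn: "\<And>z. 0 \<le> \<phi> z"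
      by (auto simp: \<phi>_def[abs_def])
    have weak: "emeasure lebesgue {z. t \<le> \<phi> z} \<le> ennreal (K2 / t)" if t: "0 < t" for t
    proof -
      \<comment> \<open>Chosen so that l powr (- p') = 1 / (\<kappa> t), the decay wanted from the
        weak Hausdorff-Young inequality.\<close>
      define l where "l = (\<kappa> * t) powr (1 / conj_exp p)"
      have l: "0 < l" using t \<kappa> by (simp add: l_def)
      define \<tau> where "\<tau> = t powr \<beta> * \<kappa> powr (- (2 - p - \<beta>))"
      have \<tau>: "0 < \<tau>" using t \<kappa> by (simp add: \<tau>_def)
      have ltau: "l powr (q - p) * \<tau> = t powr (2 - p)"
      proof -
        have "l powr (q - p) = (\<kappa> * t) powr (2 - p - \<beta>)"
          by (simp add: l_def powr_powr eqp)
        also have "\<dots> = \<kappa> powr (2 - p - \<beta>) * t powr (2 - p - \<beta>)"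
          using \<kappa> t by (simp add: powr_mult)
        finally have "l powr (q - p) * \<tau> = (\<kappa> powr (2 - p - \<beta>) * \<kappa> powr (- (2 - p - \<beta>))) * (t powr (2 - p - \<beta>) * t powr \<beta>)"
          by (simp add: \<tau>_def)
        then show ?thesis
          using \<kappa> t by (simp only: powr_add[symmetric]) simp
      qed
      have sub: "{z. t \<le> \<phi> z} \<subseteq> {z. l \<le> G z} \<union> {z. \<tau> \<le> g z}"
      proof
        fix z assume "z \<in> {z. t \<le> \<phi> z}"
        then have "t powr (2 - p) \<le> \<phi> z powr (2 - p)"
          using t p by (intro powr_mono2) auto
        also have "\<phi> z powr (2 - p) = G z powr (q - p) * g z"
          using p nn[of z] by (simp add: \<phi>_def powr_powr)
        finally have 1: "l powr (q - p) * \<tau> \<le> G z powr (q - p) * g z"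
          by (simp add: ltau)
        have "\<tau> \<le> g z" if "G z < l"
        proof -
          have "G z powr (q - p) * g z \<le> l powr (q - p) * g z"
            using that Gnn[of z] q nn[of z] by (intro mult_right_mono powr_mono2) auto
          with 1 have "l powr (q - p) * \<tau> \<le> l powr (q - p) * g z" by linarith
          then show ?thesis using l by simp
        qed
        then show "z \<in> {z. l \<le> G z} \<union> {z. \<tau> \<le> g z}" by fastforce
      qed
      have m1: "{z. l \<le> G z} \<in> sets lebesgue" and m2: "{z. \<tau> \<le> g z} \<in> sets lebesgue"
        using measurable_sets[OF Gm, of "{l..}"] measurable_sets[OF g, of "{\<tau>..}"] by (simp_all add: vimage_def)
      have "emeasure lebesgue {z. t \<le> \<phi> z} \<le> emeasure lebesgue ({z. l \<le> G z} \<union> {z. \<tau> \<le> g z})"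
        using m1 m2 by (intro emeasure_mono sub) auto
      also have "\<dots> \<le> emeasure lebesgue {z. l \<le> G z} + emeasure lebesgue {z. \<tau> \<le> g z}"
        by (rule emeasure_subadditive[OF m1 m2])
      also have "emeasure lebesgue {z. l \<le> G z} \<le> ennreal (K1 / \<kappa> / t)"
      proof -
        have "l powr (- conj_exp p) = 1 / (\<kappa> * t)"
          using \<kappa> t cp by (simp add: l_def powr_powr powr_minus divide_simps)
        with hausdorff_young_weak[OF p f N l] show ?thesis
          by (simp add: K1_def G_def)
      qed
      also have "emeasure lebesgue {z. \<tau> \<le> g z} \<le> ennreal ((if \<beta> = 0 then 0 else A powr (1 / \<beta>)) / t)"
      proof (cases "\<beta> = 0")
        case True
        have e: "- 1 / (2 - p) * - (2 - p) = 1"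
          using p by (simp add: field_simps)
        have "\<kappa> = (\<bar>A\<bar> + 1) powr (- 1 / (2 - p))"
          using True by (simp add: \<kappa>_def)
        then have "\<kappa> powr (- (2 - p)) = (\<bar>A\<bar> + 1) powr (- 1 / (2 - p) * - (2 - p))"
          by (simp only: powr_powr)
        also have "\<dots> = \<bar>A\<bar> + 1"
          unfolding e by simp
        finally have "\<kappa> powr (- (2 - p)) = \<bar>A\<bar> + 1" .
        then have "\<tau> = \<bar>A\<bar> + 1"
          using True t by (simp add: \<tau>_def)
        then have "A < \<tau>" by simp
        with weak_type_emeasure(2)[OF w g \<tau> True] show ?thesis using True by simp
      next
        case False
        then have "\<tau> = t powr \<beta>" by (simp add: \<tau>_def \<kappa>_def)
        moreover have "0 \<le> A"
        proof -
          \<comment> \<open>The empty set is an admissible test set, and it yields 0 \<le>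
            A.\<close>
          have "t * measure lebesgue ({}::(real^'n) set) powr \<beta> \<le> A"
            using w t unfolding weak_type_def by (auto dest!: spec[of _ t] bspec[of _ _ "{}"])
          then show ?thesis by simp
        qed
        ultimately have "(A / \<tau>) powr (1 / \<beta>) = A powr (1 / \<beta>) / t"
          using False t by (simp add: powr_divide powr_powr)
        with weak_type_emeasure(1)[OF w g \<tau>] False b0 show ?thesis by simp
      qed
      finally have "emeasure lebesgue {z. t \<le> \<phi> z} \<le> ennreal (K1 / \<kappa> / t) + ennreal ((if \<beta> = 0 then 0 else A powr (1 / \<beta>)) / t)"
        by (simp add: add_mono)
      also have "\<dots> = ennreal (K2 / t)"
        using t K1 \<kappa> by (subst ennreal_plus[symmetric]) (auto simp: K2_def add_divide_distrib)
      finally show ?thesis .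
    qed
    \<comment> \<open>The surplus power stored in \<phi> is recovered: G powr p * G powr (q - p) = G
      powr q.\<close>
    have "G z powr q * g z = G z powr p * \<phi> z powr (2 - p)" for z
    proof -
      have "\<phi> z powr (2 - p) = G z powr (q - p) * g z"
        using p nn[of z] by (simp add: \<phi>_def powr_powr)
      moreover have "G z powr p * G z powr (q - p) = G z powr q"
        by (simp add: powr_add[symmetric])
      ultimately show ?thesis by (simp add: mult.assoc[symmetric])
    qed
    then have "(\<integral>\<^sup>+z. ennreal (cmod (fourier f z) powr q * g z) \<partial>lebesgue)
       = (\<integral>\<^sup>+z. ennreal (cmod (fourier f z) powr p * \<phi> z powr (2 - p)) \<partial>lebesgue)"
      by (simp add: G_def)
    also have "\<dots> \<le> ennreal D * (\<integral>\<^sup>+x. ennreal (cmod (f x) powr p) \<partial>lebesgue)"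
      unfolding D_def by (rule paley[OF p f \<phi>m \<phi>nn K2 weak])
    also have "\<dots> \<le> ennreal D * 1"
      by (intro mult_left_mono N) auto
    finally show "(\<integral>\<^sup>+z. ennreal (cmod (fourier f z) powr q * g z) \<partial>lebesgue) \<le> ennreal D"
      by simp
  qed
qed

text \<open>Homogeneity removes the normalisation: f is divided by B. For B = 0 the function is null
  and its transform vanishes identically. B is an upper bound for the norm rather than the norm, so
  that weighted estimates can be inserted directly.\<close>

lemma fourier_weak_weight:
  fixes p q A :: real and g :: "real ^ 'n \<Rightarrow> real"
  assumes p: "1 < p" "p < 2" and q: "p \<le> q" "q \<le> conj_exp p"
    and g[measurable]: "g \<in> borel_measurable lebesgue" and nn: "\<And>x. 0 \<le> g x"
    and w: "weak_type (1 - q / conj_exp p) A g"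
  obtains C where "0 < C"
    and "\<And>f B. integrable lebesgue f \<Longrightarrow> 0 \<le> B \<Longrightarrow>
      (\<integral>\<^sup>+x. ennreal (cmod (f x) powr p) \<partial>lebesgue) \<le> ennreal (B powr p) \<Longrightarrow>
      (\<integral>\<^sup>+z. ennreal (cmod (fourier f z) powr q * g z) \<partial>lebesgue) \<le> ennreal (C * B powr q)"
proof -
  obtain C where C: "0 < C" and le: "\<And>f. integrable lebesgue f \<Longrightarrow>
      (\<integral>\<^sup>+x. ennreal (cmod (f x) powr p) \<partial>lebesgue) \<le> 1 \<Longrightarrow>
      (\<integral>\<^sup>+z. ennreal (cmod (fourier f z) powr q * g z) \<partial>lebesgue) \<le> ennreal C"
    using fourier_weak_weight_unit[OF assms] by blast
  show ?thesis
  proof (rule that[OF C])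
    fix f :: "real ^ 'n \<Rightarrow> complex" and B :: real
    assume f: "integrable lebesgue f" and B: "0 \<le> B"
      and N: "(\<integral>\<^sup>+x. ennreal (cmod (f x) powr p) \<partial>lebesgue) \<le> ennreal (B powr p)"
    note [measurable] = borel_measurable_integrable[OF f]
    show "(\<integral>\<^sup>+z. ennreal (cmod (fourier f z) powr q * g z) \<partial>lebesgue) \<le> ennreal (C * B powr q)"
    proof (cases "B = 0")
      case True
      with N p have "(\<integral>\<^sup>+x. ennreal (cmod (f x) powr p) \<partial>lebesgue) = 0" by simp
      then have "AE x in lebesgue. ennreal (cmod (f x) powr p) = 0"
        by (subst (asm) nn_integral_0_iff_AE) auto
      then have "AE x in lebesgue. f x * wave x z = 0" for z
        by eventually_elim simp
      then have "fourier f z = 0" for z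
        unfolding fourier_wave by (rule integral_eq_zero_AE)
      then show ?thesis using q p by simp
    next
      case False
      with B have B: "0 < B" by simp
      define f' where "f' x = complex_of_real (1 / B) * f x" for x
      have f': "integrable lebesgue f'"
        unfolding f'_def by (intro integrable_mult_right f)
      note [measurable] = borel_measurable_integrable[OF f']
      have "(\<integral>\<^sup>+x. ennreal (cmod (f' x) powr p) \<partial>lebesgue) = (\<integral>\<^sup>+x. ennreal (B powr (- p)) * ennreal (cmod (f x) powr p) \<partial>lebesgue)"
        using B by (intro nn_integral_cong)
          (simp add: f'_def norm_mult norm_divide powr_divide powr_minus ennreal_mult[symmetric] divide_simps)
      also have "\<dots> = ennreal (B powr (- p)) * (\<integral>\<^sup>+x. ennreal (cmod (f x) powr p) \<partial>lebesgue)"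
        by (rule nn_integral_cmult) measurable
      also have "\<dots> \<le> ennreal (B powr (- p)) * ennreal (B powr p)"
        by (intro mult_left_mono N) auto
      also have "\<dots> = 1"
        using B by (simp add: ennreal_mult[symmetric] powr_add[symmetric])
      finally have 1: "(\<integral>\<^sup>+z. ennreal (cmod (fourier f' z) powr q * g z) \<partial>lebesgue) \<le> ennreal C"
        by (rule le[OF f'])
      have F: "fourier f' z = complex_of_real (1 / B) * fourier f z" for z
        unfolding f'_def by (rule fourier_mult_right)
      have "(\<integral>\<^sup>+z. ennreal (cmod (fourier f z) powr q * g z) \<partial>lebesgue)
          = (\<integral>\<^sup>+z. ennreal (B powr q) * ennreal (cmod (fourier f' z) powr q * g z) \<partial>lebesgue)"
        using B nn by (intro nn_integral_cong)
          (simp add: F norm_mult norm_divide powr_divide ennreal_mult[symmetric])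
      also have "\<dots> = ennreal (B powr q) * (\<integral>\<^sup>+z. ennreal (cmod (fourier f' z) powr q * g z) \<partial>lebesgue)"
        by (rule nn_integral_cmult) measurable
      also have "\<dots> \<le> ennreal (B powr q) * ennreal C"
        by (intro mult_left_mono 1) auto
      also have "\<dots> = ennreal (C * B powr q)"
        using C by (simp add: ennreal_mult[symmetric] mult.commute)
      finally show ?thesis .
    qed
  qed
qed

subsection \<open>Cubes of reciprocal sides\<close>

definition cube :: "real ^ 'n \<Rightarrow> real \<Rightarrow> (real ^ 'n) set" where
  "cube a s = cbox a (a + (\<chi> i. s))"

lemma mem_cube: "x \<in> cube a s \<longleftrightarrow> (\<forall>i. a $ i \<le> x $ i \<and> x $ i \<le> a $ i + s)"
  by (simp add: cube_def mem_box_cart)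

lemma cube_sets[simp, measurable]: "cube a s \<in> sets lebesgue"
  and cube_lmeasurable[simp]: "cube a s \<in> lmeasurable"
  by (simp_all add: cube_def)

lemma measure_cube: "0 \<le> s \<Longrightarrow> measure lebesgue (cube (a :: real ^ 'n) s) = s ^ CARD('n)"
  by (simp add: cube_def content_cbox_cart interval_ne_empty_cart)

lemma emeasure_cube: "0 \<le> s \<Longrightarrow> emeasure lebesgue (cube (a :: real ^ 'n) s) = ennreal (s ^ CARD('n))"
  by (simp add: emeasure_eq_measure2[OF cube_lmeasurable] measure_cube)

text \<open>Every large side is offered, not just one, since upper bounds on cube integrals will be
  available only for some arbitrarily large sides.\<close>

lemma bounded_subset_cube:
  fixes E :: "(real ^ 'n) set"
  assumes "bounded E"
  obtains s0 where "0 < s0" "\<And>s. s0 \<le> s \<Longrightarrow> E \<subseteq> cube (\<chi> i. - (s / 2)) s"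
proof -
  obtain B where B: "0 < B" "\<And>x. x \<in> E \<Longrightarrow> norm x \<le> B"
    using assms by (auto simp: bounded_pos)
  show ?thesis
  proof (rule that[of "2 * B"])
    fix s assume s: "2 * B \<le> s"
    show "E \<subseteq> cube (\<chi> i. - (s / 2)) s"
    proof
      fix x assume "x \<in> E"
      then have "\<bar>x $ i\<bar> \<le> B" for i
        using B(2) component_le_norm_cart[of x i] by (meson order_trans)
      then have "- (s / 2) \<le> x $ i \<and> x $ i \<le> s / 2" for i
        using s by (smt (verit) field_sum_of_halves)
      then show "x \<in> cube (\<chi> i. - (s / 2)) s"
        by (simp add: mem_cube)
    qed
  qed (use B in simp)
qed

text \<open>A dyadic cover of a set \<open>E\<close> of high values inside an open set of measure less than
  \<open>3/2 |E|\<close> replaces the Lebesgue differentiation theorem; this costs the factor 2.\<close>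

lemma cube_average_bound:
  fixes g :: "real ^ 'n \<Rightarrow> real"
  assumes g[measurable]: "g \<in> borel_measurable lebesgue" and M: "0 < M" and \<delta>: "0 < \<delta>"
    and avg: "\<And>a s. 0 < s \<Longrightarrow> s < \<delta> \<Longrightarrow> (\<integral>\<^sup>+x\<in>cube a s. ennreal (g x) \<partial>lebesgue) \<le> ennreal (M * s ^ CARD('n))"
  shows "AE x in lebesgue. g x \<le> 2 * M"
proof -
  have m: "{x. 2 * M < g x} \<in> sets lebesgue"
    using measurable_sets[OF g, of "{2 * M<..}"] by (simp add: vimage_def)
  have "emeasure lebesgue {x. 2 * M < g x} \<le> ennreal 0"
  proof (rule emeasure_le_if_bounded_subsets[OF m])
    fix E assume E: "E \<subseteq> {x. 2 * M < g x}" "E \<in> sets lebesgue" "bounded E"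
    show "measure lebesgue E \<le> 0"
    proof (rule ccontr)
      assume "\<not> measure lebesgue E \<le> 0"
      then have pos: "0 < measure lebesgue E" by simp
      have lE: "E \<in> lmeasurable"
        using E by (intro bounded_set_imp_lmeasurable)
      obtain U where U: "open U" "E \<subseteq> U" "U - E \<in> lmeasurable" "emeasure lebesgue (U - E) < ennreal (measure lebesgue E / 2)"
        using sets_lebesgue_outer_open[OF E(2), of "measure lebesgue E / 2"] pos by auto
      obtain s0 where s0: "0 < s0" "E \<subseteq> cube (\<chi> i. - (s0 / 2)) s0"
        using bounded_subset_cube[OF E(3)] by (metis order_refl)
      define lo hi where "lo = (\<chi> i::'n. - (s0 / 2))" and "hi = lo + (\<chi> i. s0)"
      \<comment> \<open>The gauge keeps a covering cube inside U and its diagonal below \<delta>,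
        hence also its side, as the hypothesis on averages requires. The values off U are arbitrary:
        the tags of the cover lie in E.\<close>
      define \<gamma> where "\<gamma> x = (if x \<in> U then U \<inter> ball x (\<delta> / 2) else ball x 1)" for x
      have gauge: "gauge \<gamma>"
        using U(1) \<delta> by (auto simp: gauge_def \<gamma>_def)
      have ne: "box lo hi \<noteq> {}"
        using s0 by (simp add: interval_ne_empty_cart lo_def hi_def)
      have sub: "E \<subseteq> cbox lo hi"
        using s0(2) by (simp add: lo_def hi_def cube_def)
      obtain \<D> where D: "countable \<D>" "\<And>K. K \<in> \<D> \<Longrightarrow> interior K \<noteq> {} \<and> (\<exists>c d. K = cbox c d)"
          "pairwise (\<lambda>A B. interior A \<inter> interior B = {}) \<D>"
          "\<And>K. K \<in> \<D> \<Longrightarrow> \<exists>x \<in> E \<inter> K. K \<subseteq> \<gamma> x"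
          "\<And>u v. cbox u v \<in> \<D> \<Longrightarrow> \<exists>n. \<forall>i \<in> Basis. v \<bullet> i - u \<bullet> i = (hi \<bullet> i - lo \<bullet> i) / 2^n"
          "E \<subseteq> \<Union>\<D>"
        using covering_lemma[OF sub ne gauge] by metis
      have K: "\<exists>a s. 0 < s \<and> s < \<delta> \<and> K = cube a s \<and> K \<subseteq> U" if KD: "K \<in> \<D>" for K
      proof -
        obtain u v where uv: "K = cbox u v" "interior K \<noteq> {}" using D(2)[OF KD] by blast
        obtain n where n: "\<forall>i \<in> Basis. v \<bullet> i - u \<bullet> i = (hi \<bullet> i - lo \<bullet> i) / 2^n"
          using D(5) KD uv by blast
        define s where "s = s0 / 2 ^ n"
        have "v $ i - u $ i = s" for i
        proof -
          have "axis i 1 \<in> (Basis :: (real ^ 'n) set)" by (simp add: axis_in_Basis_iff)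
          with n have "v \<bullet> axis i 1 - u \<bullet> axis i 1 = (hi \<bullet> axis i 1 - lo \<bullet> axis i 1) / 2 ^ n" by blast
          then show ?thesis by (simp add: cart_eq_inner_axis[symmetric] hi_def s_def)
        qed
        then have v: "v = u + (\<chi> i. s)"
          by (simp add: vec_eq_iff) (metis add.commute diff_add_cancel)
        obtain x where x: "x \<in> E" "x \<in> K" "K \<subseteq> \<gamma> x" using D(4)[OF KD] by blast
        then have "\<gamma> x = U \<inter> ball x (\<delta> / 2)" using U(2) by (auto simp: \<gamma>_def)
        with x(3) have sub: "K \<subseteq> U" "K \<subseteq> ball x (\<delta> / 2)" by auto
        have s: "0 < s" using s0 by (simp add: s_def)
        have "u \<in> K" "v \<in> K" using s unfolding uv v by (simp_all add: mem_box_cart)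
        with sub have "dist x u < \<delta> / 2" "dist x v < \<delta> / 2" by auto
        then have "norm (v - u) < \<delta>"
          using dist_triangle_half_r[of x u \<delta> v] by (simp add: dist_norm norm_minus_commute)
        moreover have "s \<le> norm (v - u)"
          using component_le_norm_cart[of "v - u" undefined] s by (simp add: v)
        ultimately show ?thesis
          using s sub(1) uv(1) v by (intro exI[of _ u] exI[of _ s]) (auto simp: cube_def)
      qed
      \<comment> \<open>The cubes of the cover meet only in their boundaries. Countable additivity
        of the measure g dx is applied to the interiors, and the null set \<open>Z\<close> of all
        boundaries is discarded.\<close>
      define N where "N = density lebesgue (\<lambda>x. ennreal (g x))"
      have sN[simp]: "sets N = sets lebesgue" by (simp add: N_def)
      have Nle: "emeasure N (interior K) \<le> ennreal M * emeasure lebesgue (interior K)" if KD: "K \<in> \<D>" for K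
      proof -
        obtain a s where as: "0 < s" "s < \<delta>" "K = cube a s" using K[OF KD] by blast
        have mi: "interior K \<in> sets lebesgue" by auto
        have "emeasure N (interior K) \<le> emeasure N K"
          using as by (intro emeasure_mono interior_subset) auto
        also have "\<dots> = (\<integral>\<^sup>+x\<in>K. ennreal (g x) \<partial>lebesgue)"
          unfolding N_def using as by (subst emeasure_density) auto
        also have "\<dots> \<le> ennreal (M * s ^ CARD('n))"
          using avg as by simp
        also have "\<dots> = ennreal M * emeasure lebesgue K"
          using as M by (simp add: emeasure_cube ennreal_mult del: emeasure_completion)
        also have "emeasure lebesgue K = emeasure lebesgue (interior K)"
          unfolding as(3) cube_def interior_cbox
          by (simp add: emeasure_lborel_cbox_eq emeasure_lborel_box_eq)
        finally show ?thesis .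
      qed
      have disj: "disjoint_family_on interior \<D>"
        using D(3) by (auto simp: disjoint_family_on_def pairwise_def)
      define Z where "Z = (\<Union>K\<in>\<D>. K - interior K)"
      have "K - interior K \<in> null_sets lebesgue" if KD: "K \<in> \<D>" for K
      proof -
        obtain a s where "K = cube a s" using K[OF KD] by blast
        then show ?thesis
          using negligible_frontier_interval by (simp add: cube_def interior_cbox negligible_iff_null_sets)
      qed
      then have "Z \<in> null_sets lebesgue"
        unfolding Z_def by (intro null_sets_UN' D(1))
      then have Z: "AE x in lebesgue. x \<notin> Z" by (rule AE_not_in)
      have E1: "2 * M \<le> g x" if "x \<in> E" for x
        using E(1) that by auto
      have V: "(\<Union>K\<in>\<D>. interior K) \<in> sets lebesgue"
        using D(1) by (intro sets.countable_UN') auto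
      have "ennreal (2 * M) * emeasure lebesgue E = (\<integral>\<^sup>+x. ennreal (2 * M) * indicator E x \<partial>lebesgue)"
        using E(2) by (simp add: nn_integral_cmult_indicator)
      also have "\<dots> \<le> (\<integral>\<^sup>+x\<in>(\<Union>K\<in>\<D>. interior K). ennreal (g x) \<partial>lebesgue)"
        using Z by (intro nn_integral_mono_AE, eventually_elim)
          (use E1 D(6) in \<open>auto simp: Z_def indicator_def intro!: ennreal_leI\<close>)
      also have "\<dots> = emeasure N (\<Union>K\<in>\<D>. interior K)"
        unfolding N_def using V by (subst emeasure_density) auto
      also have "\<dots> = (\<integral>\<^sup>+K. emeasure N (interior K) \<partial>count_space \<D>)"
        using D(1) disj by (intro emeasure_UN_countable) auto
      also have "\<dots> \<le> (\<integral>\<^sup>+K. ennreal M * emeasure lebesgue (interior K) \<partial>count_space \<D>)"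
        using Nle by (intro nn_integral_mono) auto
      also have "\<dots> = ennreal M * emeasure lebesgue (\<Union>K\<in>\<D>. interior K)"
        using D(1) disj by (subst emeasure_UN_countable) (auto simp: nn_integral_cmult)
      also have "\<dots> \<le> ennreal M * emeasure lebesgue U"
      proof (intro mult_left_mono emeasure_mono)
        show "(\<Union>K\<in>\<D>. interior K) \<subseteq> U"
          using K interior_subset by blast
        show "U \<in> sets lebesgue" using U(1) by auto
      qed simp
      also have "\<dots> \<le> ennreal M * (emeasure lebesgue E + emeasure lebesgue (U - E))"
      proof (intro mult_left_mono)
        have "E \<union> (U - E) = U" using U(2) by auto
        then show "emeasure lebesgue U \<le> emeasure lebesgue E + emeasure lebesgue (U - E)"
          using emeasure_subadditive[of E lebesgue "U - E"] E(2) U(3) by (auto dest: fmeasurableD)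
      qed simp
      also have "emeasure lebesgue E = ennreal (measure lebesgue E)"
        using lE by (intro emeasure_eq_measure2) (auto simp: fmeasurable_def)
      also have "ennreal M * (ennreal (measure lebesgue E) + emeasure lebesgue (U - E))
          \<le> ennreal M * (ennreal (measure lebesgue E) + ennreal (measure lebesgue E / 2))"
        using U(4) by (intro mult_left_mono add_left_mono) auto
      \<comment> \<open>This reads 2 M |E| \<le> (3/2) M |E|, against |E| > 0.\<close>
      finally have "ennreal (2 * M * measure lebesgue E) \<le> ennreal (M * (measure lebesgue E + measure lebesgue E / 2))"
        using M pos by (simp add: ennreal_mult[symmetric] ennreal_plus[symmetric] del: ennreal_plus)
      then show False
        using M pos by (subst (asm) ennreal_le_iff) (auto simp: field_simps)
    qed
  qed
  then have "emeasure lebesgue {x. 2 * M < g x} = 0" by simp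
  then show ?thesis
    using m by (intro AE_I[where N="{x. 2 * M < g x}"]) auto
qed

lemma set_lint_nonneg:
  fixes f :: "'a \<Rightarrow> real"
  assumes "\<And>x. 0 \<le> f x"
  shows "0 \<le> (LINT x:A|M. f x)"
  unfolding set_lebesgue_integral_def using assms by (intro Bochner_Integration.integral_nonneg) auto

lemma nn_set_integral_eq_set_lint:
  fixes f :: "'a \<Rightarrow> real"
  assumes "set_integrable M A f" "\<And>x. 0 \<le> f x"
  shows "(\<integral>\<^sup>+x\<in>A. ennreal (f x) \<partial>M) = ennreal (LINT x:A|M. f x)"
proof -
  have "(\<integral>\<^sup>+x\<in>A. ennreal (f x) \<partial>M) = (\<integral>\<^sup>+x. ennreal (indicator A x *\<^sub>R f x) \<partial>M)"
    by (intro nn_integral_cong) (auto simp: indicator_def)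
  also have "\<dots> = ennreal (LINT x:A|M. f x)"
    using assms unfolding set_lebesgue_integral_def set_integrable_def by (intro nn_integral_eq_integral) auto
  finally show ?thesis .
qed

text \<open>In a dual pair, \<open>h\<close> lives on the Fourier side: a cube of side \<open>1/(n s)\<close> lies in a
  translate of the polar of a cube of side \<open>s\<close>.\<close>

locale dual_pair =
  fixes g h :: "real ^ 'n \<Rightarrow> real" and \<alpha> \<beta> C n :: real
  assumes n: "n = real CARD('n)" and g[measurable]: "g \<in> borel_measurable lebesgue" and g_nn: "\<And>x. 0 \<le> g x"
    and g_int: "\<And>a s. set_integrable lebesgue (cube a s) g"
    and h[measurable]: "h \<in> borel_measurable lebesgue" and h_nn: "\<And>x. 0 \<le> h x"
    and h_int: "\<And>a s. set_integrable lebesgue (cube a s) h"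
    and \<alpha>: "0 < \<alpha>" and \<beta>: "0 < \<beta>"
    and product_le: "\<And>a b s. 0 < s \<Longrightarrow>
      (LINT x:cube a s|lebesgue. g x) powr \<alpha> * (LINT x:cube b (1 / (n * s))|lebesgue. h x) powr \<beta> \<le> C"
begin

lemma n_pos: "0 < n" by (simp add: n)

lemma h_cube_le_iff:
  assumes "0 \<le> c"
  shows "(\<integral>\<^sup>+x\<in>cube b s. ennreal (h x) \<partial>lebesgue) \<le> ennreal c \<longleftrightarrow> (LINT x:cube b s|lebesgue. h x) \<le> c"
  using nn_set_integral_eq_set_lint[OF h_int[of b s] h_nn] assms by simp

lemma C_nonneg: "0 \<le> C"
  using product_le[of 1 0 0] by (smt (verit) mult_nonneg_nonneg powr_ge_zero)

text \<open>If h is not null, it is not bounded by 2 M for some M > 0; by the averaging lemma its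
  average exceeds M on cubes of arbitrarily small side t. The opposite cube has side s = 1/(n t),
  and the product bound controls g on it wherever it lies. M is fixed before \<open>s0\<close>, so c
  does not depend on s; but only some arbitrarily large sides are reached.\<close>

lemma cube_integral_upper:
  assumes "\<not> (AE x in lebesgue. h x = 0)"
  obtains c where "0 \<le> c"
    and "\<And>s0. 0 < s0 \<Longrightarrow> \<exists>s\<ge>s0. \<forall>a. (LINT x:cube a s|lebesgue. g x) \<le> c * s powr (n * \<beta> / \<alpha>)"
proof -
  have "\<exists>M>0. \<not> (AE x in lebesgue. h x \<le> 2 * M)"
  proof (rule ccontr)
    assume *: "\<not> ?thesis"
    have "\<forall>k::nat. AE x in lebesgue. h x \<le> 2 * (1 / real (Suc k))"
      using * by (metis divide_pos_pos of_nat_0_less_iff zero_less_Suc zero_less_one)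
    then have "AE x in lebesgue. \<forall>k::nat. h x \<le> 2 * (1 / real (Suc k))"
      by (simp add: AE_all_countable)
    then have "AE x in lebesgue. h x = 0"
    proof eventually_elim
      case (elim x)
      have "(\<lambda>k. 2 * (1 / real (Suc k))) \<longlonglongrightarrow> 2 * 0"
        by (intro tendsto_intros LIMSEQ_Suc lim_1_over_n)
      then have "h x \<le> 2 * 0"
        by (rule LIMSEQ_le_const) (use elim in auto)
      then show ?case using h_nn[of x] by simp
    qed
    with assms show False by contradiction
  qed
  then obtain M where M: "0 < M" "\<not> (AE x in lebesgue. h x \<le> 2 * M)" by blast
  \<comment> \<open>Solves \<open>I powr \<alpha> * (M * t powr n) powr \<beta> \<le> C\<close> for
    I; the power of n comes from t = 1/(n s).\<close>
  define c where "c = (C * M powr (- \<beta>) * n powr (n * \<beta>)) powr (1 / \<alpha>)"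
  show ?thesis
  proof (rule that[of c])
    fix s0 :: real assume s0: "0 < s0"
    have "\<exists>b t. 0 < t \<and> t < 1 / (n * s0) \<and> M * t ^ CARD('n) < (LINT x:cube b t|lebesgue. h x)"
    proof (rule ccontr)
      assume *: "\<not> ?thesis"
      have "AE x in lebesgue. h x \<le> 2 * M"
      proof (rule cube_average_bound[OF h M(1)])
        show "0 < 1 / (n * s0)" using s0 n_pos by simp
        fix b :: "real ^ 'n" and t :: real assume t: "0 < t" "t < 1 / (n * s0)"
        then have "(LINT x:cube b t|lebesgue. h x) \<le> M * t ^ CARD('n)"
          using * by (meson not_less)
        then show "(\<integral>\<^sup>+x\<in>cube b t. ennreal (h x) \<partial>lebesgue) \<le> ennreal (M * t ^ CARD('n))"
          using t M by (subst h_cube_le_iff) auto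
      qed
      with M(2) show False by contradiction
    qed
    then obtain b t where t: "0 < t" "t < 1 / (n * s0)" and big: "M * t ^ CARD('n) < (LINT x:cube b t|lebesgue. h x)"
      by blast
    define s where "s = 1 / (n * t)"
    have s: "0 < s" "s0 \<le> s" using t s0 n_pos by (auto simp: s_def field_simps)
    have ts: "1 / (n * s) = t" using t n_pos by (simp add: s_def)
    have "(LINT x:cube a s|lebesgue. g x) \<le> c * s powr (n * \<beta> / \<alpha>)" for a
    proof -
      let ?I = "LINT x:cube a s|lebesgue. g x"
      have Mt: "0 < M * t powr n" using M t by simp
      have tn: "t ^ CARD('n) = t powr n" using t by (simp add: n powr_realpow)
      have "?I powr \<alpha> * (M * t powr n) powr \<beta> \<le> ?I powr \<alpha> * (LINT x:cube b t|lebesgue. h x) powr \<beta>"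
        using big Mt \<beta> tn by (intro mult_left_mono powr_mono2) auto
      also have "\<dots> \<le> C" using product_le[OF s(1), of a b] by (simp add: ts)
      finally have "?I powr \<alpha> \<le> C / (M * t powr n) powr \<beta>"
        using Mt by (subst pos_le_divide_eq) auto
      also have "\<dots> = C * M powr (- \<beta>) * t powr (- (n * \<beta>))"
        using M t by (simp add: powr_mult powr_powr powr_minus divide_simps)
      also have "t powr (- (n * \<beta>)) = n powr (n * \<beta>) * s powr (n * \<beta>)"
        using t n_pos by (simp add: s_def powr_mult powr_divide powr_minus divide_simps)
      finally have "(?I powr \<alpha>) powr (1 / \<alpha>) \<le> ((C * M powr (- \<beta>) * n powr (n * \<beta>)) * s powr (n * \<beta>)) powr (1 / \<alpha>)"
        using \<alpha> by (intro powr_mono2) (auto simp: mult.assoc)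
      also have "\<dots> = c * s powr (n * \<beta> / \<alpha>)"
        using C_nonneg by (simp add: c_def powr_mult powr_powr)
      finally show ?thesis
        using \<alpha> set_lint_nonneg[OF g_nn, of lebesgue "cube a s"] by (simp add: powr_powr)
    qed
    with s show "\<exists>s\<ge>s0. \<forall>a. (LINT x:cube a s|lebesgue. g x) \<le> c * s powr (n * \<beta> / \<alpha>)"
      by blast
  qed (simp add: c_def)
qed

text \<open>The converse use of the product bound: large mass of g on some cube of each large side s
  caps h on every cube of side 1/(n s), and bounded averages over all small cubes bound h
  itself.\<close>

lemma dual_bounded:
  assumes c: "0 < c" and s0: "0 < s0"
    and low: "\<And>s. s0 \<le> s \<Longrightarrow> \<exists>a. c * s powr (n * \<beta> / \<alpha>) \<le> (LINT x:cube a s|lebesgue. g x)"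
  obtains M where "0 < M" "AE x in lebesgue. h x \<le> M"
proof -
  define D where "D = (C * c powr (- \<alpha>)) powr (1 / \<beta>) * n powr n"
  have D: "0 \<le> D" by (simp add: D_def)
  \<comment> \<open>D bounds the averages of h. The averaging lemma requires a positive constant,
    hence D + 1, and loses a factor 2.\<close>
  have "AE x in lebesgue. h x \<le> 2 * (D + 1)"
  proof (rule cube_average_bound[OF h])
    show "0 < D + 1" using D by simp
    show "0 < 1 / (n * s0)" using s0 n_pos by simp
    fix b :: "real ^ 'n" and t :: real assume t: "0 < t" "t < 1 / (n * s0)"
    define s where "s = 1 / (n * t)"
    have s: "0 < s" "s0 \<le> s" using t s0 n_pos by (auto simp: s_def field_simps)
    have ts: "1 / (n * s) = t" using t n_pos by (simp add: s_def)
    obtain a where a: "c * s powr (n * \<beta> / \<alpha>) \<le> (LINT x:cube a s|lebesgue. g x)" using low[OF s(2)] by blast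
    let ?J = "LINT x:cube b t|lebesgue. h x"
    have pos: "0 < c * s powr (n * \<beta> / \<alpha>)" using c s by simp
    have "(c * s powr (n * \<beta> / \<alpha>)) powr \<alpha> * ?J powr \<beta> \<le> (LINT x:cube a s|lebesgue. g x) powr \<alpha> * ?J powr \<beta>"
      using a pos \<alpha> by (intro mult_right_mono powr_mono2) auto
    also have "\<dots> \<le> C" using product_le[OF s(1), of a b] by (simp add: ts)
    finally have "?J powr \<beta> \<le> C / (c * s powr (n * \<beta> / \<alpha>)) powr \<alpha>"
      using pos by (subst pos_le_divide_eq) (auto simp: mult.commute)
    also have "\<dots> = C * c powr (- \<alpha>) * s powr (- (n * \<beta>))"
      using c s \<alpha> by (simp add: powr_mult powr_powr powr_minus divide_simps)
    also have "s powr (- (n * \<beta>)) = n powr (n * \<beta>) * t powr (n * \<beta>)"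
      using t n_pos by (simp add: s_def powr_mult powr_divide powr_minus divide_simps)
    finally have "(?J powr \<beta>) powr (1 / \<beta>) \<le> (C * c powr (- \<alpha>) * (n powr (n * \<beta>) * t powr (n * \<beta>))) powr (1 / \<beta>)"
      using \<beta> by (intro powr_mono2) auto
    also have "\<dots> = D * t powr n"
      using C_nonneg \<beta> by (simp add: D_def powr_mult powr_powr)
    also have "\<dots> \<le> (D + 1) * t ^ CARD('n)"
      using t by (simp add: n powr_realpow mult_right_mono)
    finally have "?J \<le> (D + 1) * t ^ CARD('n)"
      using \<beta> set_lint_nonneg[OF h_nn, of lebesgue "cube b t"] by (simp add: powr_powr)
    then show "(\<integral>\<^sup>+x\<in>cube b t. ennreal (h x) \<partial>lebesgue) \<le> ennreal ((D + 1) * t ^ CARD('n))"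
      using t D by (subst h_cube_le_iff) auto
  qed
  with D show ?thesis by (intro that[of "2 * (D + 1)"]) auto
qed

text \<open>The density estimate \<open>dens\<close> is used in two directions. For an arbitrary
  bounded E, a large cube of controlled mass cancels the power of s and leaves the weak type. For
  one fixed E of positive measure it is a lower bound for the mass of g on all large centred cubes,
  with the same growth exponent n \<beta> / \<alpha>, and this bounds h.\<close>

lemma weak_type_and_dual_bounded:
  assumes g0: "\<not> (AE x in lebesgue. g x = 0)" and h0: "\<not> (AE x in lebesgue. h x = 0)"
    and dens: "\<And>a s t E. 0 < s \<Longrightarrow> 0 < t \<Longrightarrow> E \<in> sets lebesgue \<Longrightarrow> E \<subseteq> cube a s \<Longrightarrow> E \<subseteq> {x. t \<le> g x} \<Longrightarrow>
      t * measure lebesgue E powr (1 - \<beta> / \<alpha>) \<le> D * (LINT x:cube a s|lebesgue. g x) * s powr (- (n * \<beta> / \<alpha>))"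
  shows "\<exists>A. weak_type (1 - \<beta> / \<alpha>) A g" "\<exists>M>0. AE x in lebesgue. h x \<le> M"
proof -
  define D' where "D' = \<bar>D\<bar> + 1"
  have D': "0 < D'" by (simp add: D'_def)
  have dens': "t * measure lebesgue E powr (1 - \<beta> / \<alpha>) \<le> D' * (LINT x:cube a s|lebesgue. g x) * s powr (- (n * \<beta> / \<alpha>))"
    if "0 < s" "0 < t" "E \<in> sets lebesgue" "E \<subseteq> cube a s" "E \<subseteq> {x. t \<le> g x}" for a s t E
    using dens[OF that]
    by (rule order_trans) (intro mult_right_mono, auto simp: D'_def set_lint_nonneg g_nn)
  show "\<exists>A. weak_type (1 - \<beta> / \<alpha>) A g"
  proof -
    obtain c where c: "0 \<le> c"
      "\<And>s0. 0 < s0 \<Longrightarrow> \<exists>s\<ge>s0. \<forall>a. (LINT x:cube a s|lebesgue. g x) \<le> c * s powr (n * \<beta> / \<alpha>)"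
      using cube_integral_upper[OF h0] by blast
    have "t * measure lebesgue E powr (1 - \<beta> / \<alpha>) \<le> D' * c"
      if E: "0 < t" "E \<in> sets lebesgue" "bounded E" "E \<subseteq> {x. t \<le> g x}" for t E
    proof -
      obtain s0 where s0: "0 < s0" "\<And>s. s0 \<le> s \<Longrightarrow> E \<subseteq> cube (\<chi> i. - (s / 2)) s"
        using bounded_subset_cube[OF E(3)] by blast
      obtain s where s: "s0 \<le> s" "\<forall>a. (LINT x:cube a s|lebesgue. g x) \<le> c * s powr (n * \<beta> / \<alpha>)"
        using c(2)[OF s0(1)] by blast
      have "t * measure lebesgue E powr (1 - \<beta> / \<alpha>)
          \<le> D' * (LINT x:cube (\<chi> i. - (s / 2)) s|lebesgue. g x) * s powr (- (n * \<beta> / \<alpha>))"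
        using s0 s E by (intro dens') auto
      also have "\<dots> \<le> D' * (c * s powr (n * \<beta> / \<alpha>)) * s powr (- (n * \<beta> / \<alpha>))"
        using D' s by (intro mult_right_mono mult_left_mono) auto
      also have "\<dots> = D' * c"
        using s s0 by (simp add: powr_minus)
      finally show ?thesis .
    qed
    then show ?thesis unfolding weak_type_def by blast
  qed
  show "\<exists>M>0. AE x in lebesgue. h x \<le> M"
  proof -
    have "\<exists>t>0. emeasure lebesgue {x. t \<le> g x} \<noteq> 0"
    proof (rule ccontr)
      assume *: "\<not> ?thesis"
      have m: "{x. t \<le> g x} \<in> sets lebesgue" for t
        using measurable_sets[OF g, of "{t..}"] by (simp add: vimage_def)
      have "AE x in lebesgue. \<not> 1 / real (Suc k) \<le> g x" for k
        using * m[of "1 / real (Suc k)"]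
        by (intro AE_I[where N="{x. 1 / real (Suc k) \<le> g x}"]) (auto simp del: emeasure_completion)
      then have "AE x in lebesgue. \<forall>k. \<not> 1 / real (Suc k) \<le> g x"
        by (simp only: AE_all_countable) blast
      then have "AE x in lebesgue. g x = 0"
      proof eventually_elim
        case (elim x)
        have "\<not> 0 < g x"
          using elim by (metis less_imp_le nat_approx_posE)
        then show ?case using g_nn[of x] by simp
      qed
      with g0 show False by contradiction
    qed
    then obtain t where t: "0 < t" "emeasure lebesgue {x. t \<le> g x} \<noteq> 0" by blast
    have m: "{x. t \<le> g x} \<in> sets lebesgue"
      using measurable_sets[OF g, of "{t..}"] by (simp add: vimage_def)
    have "\<exists>E. E \<subseteq> {x. t \<le> g x} \<and> E \<in> sets lebesgue \<and> bounded E \<and> 0 < measure lebesgue E"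
    proof (rule ccontr)
      assume *: "\<not> ?thesis"
      have "emeasure lebesgue {x. t \<le> g x} \<le> ennreal 0"
        by (rule emeasure_le_if_bounded_subsets[OF m]) (use * not_le in blast)
      with t(2) show False by (simp del: emeasure_completion)
    qed
    then obtain E where E: "E \<subseteq> {x. t \<le> g x}" "E \<in> sets lebesgue" "bounded E" "0 < measure lebesgue E"
      by blast
    obtain s0 where s0: "0 < s0" "\<And>s. s0 \<le> s \<Longrightarrow> E \<subseteq> cube (\<chi> i. - (s / 2)) s"
      using bounded_subset_cube[OF E(3)] by blast
    define c where "c = t * measure lebesgue E powr (1 - \<beta> / \<alpha>) / D'"
    have c: "0 < c" using t E D' by (simp add: c_def)
    obtain M where "0 < M" "AE x in lebesgue. h x \<le> M"
    proof (rule dual_bounded[OF c s0(1)])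
      fix s assume s: "s0 \<le> s"
      have "t * measure lebesgue E powr (1 - \<beta> / \<alpha>)
          \<le> D' * (LINT x:cube (\<chi> i. - (s / 2)) s|lebesgue. g x) * s powr (- (n * \<beta> / \<alpha>))"
        using s0 s E t by (intro dens') auto
      then have "c * s powr (n * \<beta> / \<alpha>) \<le> (LINT x:cube (\<chi> i. - (s / 2)) s|lebesgue. g x)"
        using D' s s0 by (simp add: c_def powr_minus field_simps)
      then show "\<exists>a. c * s powr (n * \<beta> / \<alpha>) \<le> (LINT x:cube a s|lebesgue. g x)" by blast
    qed
    then show ?thesis by blast
  qed
qed

end

subsection \<open>Dual weights and polars\<close>

lemma ennreal_powr_ennreal: "0 \<le> x \<Longrightarrow> 0 < a \<Longrightarrow> ennreal_powr (ennreal x) a = ennreal (x powr a)"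
  by (auto simp: ennreal_powr_def)

lemma ennreal_powr_mono:
  assumes "0 < a" "x \<le> y"
  shows "ennreal_powr x a \<le> ennreal_powr y a"
proof (cases y)
  case (real r)
  with assms(2) obtain s where s: "x = ennreal s" "0 \<le> s" by (cases x) (auto simp: top_unique)
  with real assms have "s \<le> r" by simp
  then show ?thesis
    using s real assms by (auto simp: ennreal_powr_ennreal intro!: ennreal_leI powr_mono2)
qed (use assms(1) in \<open>auto simp: ennreal_powr_def\<close>)

text \<open>Young's inequality for f / A^(1/p) and g / B^(1/p'), integrated. Upper bounds A and B
  stand in place of the norms, so that estimates can be inserted directly; if one of them is 0, the
  product vanishes almost everywhere.\<close>

lemma nn_integral_Holder:
  fixes f g :: "'a \<Rightarrow> real" and p :: real
  assumes p: "1 < p" and f[measurable]: "f \<in> borel_measurable M" and g[measurable]: "g \<in> borel_measurable M"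
    and nn: "\<And>x. 0 \<le> f x" "\<And>x. 0 \<le> g x" and "0 \<le> A" "0 \<le> B"
    and A: "(\<integral>\<^sup>+x. ennreal (f x powr p) \<partial>M) \<le> ennreal A"
    and B: "(\<integral>\<^sup>+x. ennreal (g x powr conj_exp p) \<partial>M) \<le> ennreal B"
  shows "(\<integral>\<^sup>+x. ennreal (f x * g x) \<partial>M) \<le> ennreal (A powr (1 / p) * B powr (1 / conj_exp p))"
proof (cases "A = 0 \<or> B = 0")
  case True
  have "AE x in M. f x * g x = 0"
    using True
  proof
    assume "A = 0"
    with A have "(\<integral>\<^sup>+x. ennreal (f x powr p) \<partial>M) = 0" by simp
    then have "AE x in M. ennreal (f x powr p) = 0"
      by (subst (asm) nn_integral_0_iff_AE) auto
    then show ?thesis by eventually_elim simp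
  next
    assume "B = 0"
    with B have "(\<integral>\<^sup>+x. ennreal (g x powr conj_exp p) \<partial>M) = 0" by simp
    then have "AE x in M. ennreal (g x powr conj_exp p) = 0"
      by (subst (asm) nn_integral_0_iff_AE) auto
    then show ?thesis by eventually_elim simp
  qed
  then have "AE x in M. ennreal (f x * g x) = 0" by eventually_elim auto
  then have "(\<integral>\<^sup>+x. ennreal (f x * g x) \<partial>M) = 0"
    by (subst nn_integral_0_iff_AE) auto
  then show ?thesis by simp
next
  case False
  then have AB: "0 < A" "0 < B" using assms by auto
  define q where "q = conj_exp p"
  have q: "1 < q" "1 / p + 1 / q = 1" using p by (auto simp: q_def conj_exp_def field_simps)
  define c where "c = A powr (1 / p) * B powr (1 / q)"
  have c: "0 < c" using AB by (simp add: c_def)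
  have "f x * g x \<le> c / (p * A) * f x powr p + c / (q * B) * g x powr q" for x
  proof -
    have "(f x / A powr (1 / p)) * (g x / B powr (1 / q))
        \<le> (f x / A powr (1 / p)) powr p / p + (g x / B powr (1 / q)) powr q / q"
      using p q nn AB by (intro Youngs_inequality) auto
    then have "f x * g x / c \<le> f x powr p / (p * A) + g x powr q / (q * B)"
      using p q nn AB by (simp add: powr_divide powr_powr c_def mult.commute)
    then have "f x * g x \<le> c * (f x powr p / (p * A) + g x powr q / (q * B))"
      using c by (simp add: pos_divide_le_eq mult.commute)
    then show ?thesis by (simp add: distrib_left)
  qed
  then have "(\<integral>\<^sup>+x. ennreal (f x * g x) \<partial>M) \<le> (\<integral>\<^sup>+x. ennreal (c / (p * A)) * ennreal (f x powr p) + ennreal (c / (q * B)) * ennreal (g x powr q) \<partial>M)"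
    using c p q AB by (intro nn_integral_mono)
      (simp add: ennreal_mult[symmetric] ennreal_plus[symmetric] ennreal_leI del: ennreal_plus)
  also have "\<dots> = ennreal (c / (p * A)) * (\<integral>\<^sup>+x. ennreal (f x powr p) \<partial>M) + ennreal (c / (q * B)) * (\<integral>\<^sup>+x. ennreal (g x powr q) \<partial>M)"
    by (subst nn_integral_add, measurable, subst nn_integral_cmult, measurable, subst nn_integral_cmult, measurable)
  also have "\<dots> \<le> ennreal (c / (p * A)) * ennreal A + ennreal (c / (q * B)) * ennreal B"
    using A B by (intro add_mono mult_left_mono) (auto simp: q_def)
  also have "\<dots> = ennreal (c / (p * A) * A + c / (q * B) * B)"
    using c p q AB by (simp add: ennreal_mult[symmetric] ennreal_plus[symmetric] del: ennreal_plus)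
  also have "c / (p * A) * A + c / (q * B) * B = c * (1 / p + 1 / q)"
    using AB by (simp add: distrib_left)
  finally show ?thesis using q by (simp add: c_def q_def)
qed

section \<open>Weights as real functions on cubes\<close>

lemma cubes_eq: "cubes = {cube a s |a s. 0 < s}"
  by (simp add: cubes_def cube_def)

lemma weightD:
  fixes u :: "real ^ 'n \<Rightarrow> real"
  assumes "weight u"
  shows "u \<in> borel_measurable lebesgue" "\<And>x. 0 \<le> u x" "set_integrable lebesgue (cube a s) u"
    and "mass (\<lambda>x. ennreal (u x)) (cube a s) = ennreal (LINT x:cube a s|lebesgue. u x)"
proof -
  show nn: "\<And>x. 0 \<le> u x" using assms by (simp add: weight_def)
  have m: "(\<lambda>x. ennreal (u x)) \<in> borel_measurable lebesgue"
    using assms by (simp add: weight_def locally_integrable_def)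
  have "(\<lambda>x. enn2real (ennreal (u x))) \<in> borel_measurable lebesgue"
    by (rule measurable_compose[OF m]) simp
  then show um[measurable]: "u \<in> borel_measurable lebesgue"
    by (simp add: nn)
  have "(\<integral>\<^sup>+x\<in>cube a s. ennreal (u x) \<partial>lebesgue) < \<infinity>"
    using assms by (simp add: weight_def locally_integrable_def cube_def)
  also have "(\<integral>\<^sup>+x\<in>cube a s. ennreal (u x) \<partial>lebesgue) = (\<integral>\<^sup>+x. ennreal (norm (indicator (cube a s) x *\<^sub>R u x)) \<partial>lebesgue)"
    by (intro nn_integral_cong) (auto simp: indicator_def nn)
  finally show si: "set_integrable lebesgue (cube a s) u"
    unfolding set_integrable_def by (intro integrableI_bounded) auto
  show "mass (\<lambda>x. ennreal (u x)) (cube a s) = ennreal (LINT x:cube a s|lebesgue. u x)"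
    unfolding mass_def by (rule nn_set_integral_eq_set_lint[OF si nn])
qed

text \<open>Trades the extended-valued dual weight for a real function. On each cube of an
  exhaustion, a finite integral makes \<open>dual_weight p v\<close> finite almost everywhere, which
  excludes v = 0. The real \<open>powr\<close> agrees with it where v > 0, while at zeros of v it
  gives 0 instead of \<infinity>.\<close>

lemma dual_weight_AE:
  fixes v :: "real ^ 'n \<Rightarrow> real"
  assumes p: "1 < p" and v: "weight v" and w: "locally_integrable (dual_weight p v)"
  shows "AE x in lebesgue. 0 < v x"
    and "AE x in lebesgue. dual_weight p v x = ennreal (v x powr (- conj_exp p / p))"
    and "weight (\<lambda>x. v x powr (- conj_exp p / p))"
proof -
  note vm[measurable] = weightD(1)[OF v] and nn = weightD(2)[OF v]
  have e: "- conj_exp p / p \<noteq> 0" "\<not> 0 < - conj_exp p / p" using p by (auto simp: conj_exp_def)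
  have fin: "AE x in lebesgue. x \<in> cube (\<chi> i. - (real (Suc k) / 2)) (real (Suc k)) \<longrightarrow> dual_weight p v x \<noteq> \<infinity>" for k
  proof -
    have [measurable]: "dual_weight p v \<in> borel_measurable lebesgue"
      using w by (simp add: locally_integrable_def)
    have "(\<integral>\<^sup>+x\<in>cube (\<chi> i. - (real (Suc k) / 2)) (real (Suc k)). dual_weight p v x \<partial>lebesgue) \<noteq> \<infinity>"
      using w unfolding locally_integrable_def cube_def by (metis compact_cbox less_irrefl)
    then have "AE x in lebesgue. dual_weight p v x * indicator (cube (\<chi> i. - (real (Suc k) / 2)) (real (Suc k))) x \<noteq> \<infinity>"
      by (intro nn_integral_PInf_AE) auto
    then show ?thesis by eventually_elim (auto simp: indicator_def split: if_splits)
  qed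
  then have "AE x in lebesgue. \<forall>k. x \<in> cube (\<chi> i. - (real (Suc k) / 2)) (real (Suc k)) \<longrightarrow> dual_weight p v x \<noteq> \<infinity>"
    by (simp only: AE_all_countable) blast
  then show pos: "AE x in lebesgue. 0 < v x"
  proof eventually_elim
    case (elim x)
    obtain s0 where s0: "0 < s0" "\<And>s. s0 \<le> s \<Longrightarrow> {x} \<subseteq> cube (\<chi> i. - (s / 2)) s"
      using bounded_subset_cube[of "{x}"] by auto
    obtain k where "s0 \<le> real k" using real_arch_simple by blast
    then have "x \<in> cube (\<chi> i. - (real (Suc k) / 2)) (real (Suc k))" using s0(2)[of "real (Suc k)"] by simp
    with elim have "dual_weight p v x \<noteq> \<infinity>" by blast
    then have "v x \<noteq> 0" unfolding dual_weight_def ennreal_powr_def using e by (auto simp only: if_False if_True simp_thms ennreal_0)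
    then show ?case using nn[of x] by simp
  qed
  show eq: "AE x in lebesgue. dual_weight p v x = ennreal (v x powr (- conj_exp p / p))"
    using pos by eventually_elim (unfold dual_weight_def ennreal_powr_def, use e in \<open>auto simp del: divide_minus_left\<close>)
  have "(\<integral>\<^sup>+x\<in>K. ennreal (v x powr (- conj_exp p / p)) \<partial>lebesgue) = (\<integral>\<^sup>+x\<in>K. dual_weight p v x \<partial>lebesgue)" for K
    using eq by (intro nn_integral_cong_AE, eventually_elim) simp
  then show "weight (\<lambda>x. v x powr (- conj_exp p / p))"
    using w by (simp add: weight_def locally_integrable_def)
qed

text \<open>Translation by -a moves the cube to [0, s]^n. The inner product of a point of it with a
  point of [0, 1/(n s)]^n is a sum of n terms between 0 and s * 1/(n s), so it lies in [0, 1]; this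
  is where the dimension enters.\<close>

lemma cube_subset_polar:
  fixes a b :: "real ^ 'n"
  assumes "0 < s"
  shows "cube b (1 / (real CARD('n) * s)) \<subseteq> translate (polar (translate (cube a s) (- a))) b"
proof
  fix y assume y: "y \<in> cube b (1 / (real CARD('n) * s))"
  have "\<bar>x \<bullet> (y - b)\<bar> \<le> 1" if "x + a \<in> cube a s" for x
  proof -
    have x: "0 \<le> x $ i" "x $ i \<le> s" for i
      using that by (auto simp: mem_cube)
    have yb: "0 \<le> (y - b) $ i" "(y - b) $ i \<le> 1 / (real CARD('n) * s)" for i
      using y by (auto simp: mem_cube algebra_simps)
    have "x \<bullet> (y - b) = (\<Sum>i\<in>UNIV. x $ i * (y - b) $ i)"
      by (simp add: inner_vec_def)
    moreover have "0 \<le> (\<Sum>i\<in>UNIV. x $ i * (y - b) $ i)"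
      using x yb by (intro sum_nonneg) auto
    moreover have "(\<Sum>i\<in>UNIV. x $ i * (y - b) $ i) \<le> (\<Sum>i\<in>(UNIV :: 'n set). s * (1 / (real CARD('n) * s)))"
      using x yb assms by (intro sum_mono mult_mono) auto
    moreover have "\<dots> = 1" using assms by simp
    ultimately show ?thesis by simp
  qed
  then have "y - b \<in> polar (translate (cube a s) (- a))"
    by (auto simp: polar_def translate_def)
  then show "y \<in> translate (polar (translate (cube a s) (- a))) b"
    unfolding translate_def by (force intro: image_eqI[of _ _ "y - b"])
qed

lemma mass_mono: "A \<subseteq> B \<Longrightarrow> mass g A \<le> mass g B"
  unfolding mass_def by (intro nn_integral_mono mult_left_mono) (auto simp: indicator_def)

text \<open>The choice \<mu> = -a, \<tau> = b places both cubes freely. The two inequalities of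
  \<open>N_Q\<close> yield the two orders of the pair: case (a) takes u first, case (b) takes w
  first.\<close>

lemma N_Q_dual_pairs:
  fixes u v :: "real ^ 'n \<Rightarrow> real"
  assumes p: "1 < p" "p \<le> q" and u: "weight u" and v: "weight v"
    and lw: "locally_integrable (dual_weight p v)" and N: "N_Q p q u v"
  defines "w \<equiv> \<lambda>x. v x powr (- conj_exp p / p)"
  obtains C where "dual_pair u w (1 / q) (1 / conj_exp p) C (real CARD('n))"
    and "dual_pair w u (1 / conj_exp p) (1 / q) C (real CARD('n))"
proof -
  have w: "weight w" unfolding w_def by (rule dual_weight_AE[OF p(1) v lw])
  have cp: "0 < conj_exp p" and q: "0 < q" using p by (auto simp: conj_exp_def)
  have mw: "mass (dual_weight p v) A = mass (\<lambda>x. ennreal (w x)) A" for A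
    unfolding mass_def w_def using dual_weight_AE(2)[OF p(1) v lw]
    by (intro nn_integral_cong_AE, eventually_elim) simp
  obtain C0 :: real where C0: "\<forall>Q\<in>cubes. \<forall>\<mu> \<tau>. - \<mu> \<in> Q \<longrightarrow>
        ennreal_powr (mass (\<lambda>x. ennreal (u x)) Q) (1 / q) *
          ennreal_powr (mass (dual_weight p v) (translate (polar (translate Q \<mu>)) \<tau>)) (1 / conj_exp p)
          \<le> ennreal C0 \<and>
        ennreal_powr (mass (\<lambda>x. ennreal (u x)) (translate (polar (translate Q \<mu>)) \<tau>)) (1 / q) *
          ennreal_powr (mass (dual_weight p v) Q) (1 / conj_exp p)
          \<le> ennreal C0"
    using N unfolding N_Q_def by blast
  \<comment> \<open>\<open>ennreal\<close> sends negative reals to 0, so passing to the positive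
    part leaves the bound unchanged.\<close>
  define C where "C = max C0 0"
  have eC: "ennreal C0 = ennreal C" by (auto simp: C_def max_def ennreal_neg)
  have C: "0 \<le> C" by (simp add: C_def)
  have lint: "0 \<le> (LINT x:A|lebesgue. u x)" "0 \<le> (LINT x:A|lebesgue. w x)" for A
    using weightD(2)[OF u] weightD(2)[OF w] by (auto intro: set_lint_nonneg)
  have both: "(LINT x:cube a s|lebesgue. u x) powr (1 / q) * (LINT x:cube b (1 / (real CARD('n) * s))|lebesgue. w x) powr (1 / conj_exp p) \<le> C"
      "(LINT x:cube b (1 / (real CARD('n) * s))|lebesgue. u x) powr (1 / q) * (LINT x:cube a s|lebesgue. w x) powr (1 / conj_exp p) \<le> C"
    if s: "0 < s" for a b s
  proof -
    let ?P = "translate (polar (translate (cube a s) (- a))) b" and ?c = "cube b (1 / (real CARD('n) * s))"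
    have sub: "?c \<subseteq> ?P" by (rule cube_subset_polar[OF s])
    have "cube a s \<in> cubes" "- (- a) \<in> cube a s"
      using s by (auto simp: cubes_eq mem_cube)
    with C0 have C1: "ennreal_powr (mass (\<lambda>x. ennreal (u x)) (cube a s)) (1 / q) *
          ennreal_powr (mass (dual_weight p v) ?P) (1 / conj_exp p) \<le> ennreal C0"
      and C2: "ennreal_powr (mass (\<lambda>x. ennreal (u x)) ?P) (1 / q) *
          ennreal_powr (mass (dual_weight p v) (cube a s)) (1 / conj_exp p) \<le> ennreal C0" by blast+
    have "ennreal_powr (mass (\<lambda>x. ennreal (u x)) (cube a s)) (1 / q) *
          ennreal_powr (mass (dual_weight p v) ?c) (1 / conj_exp p)
        \<le> ennreal_powr (mass (\<lambda>x. ennreal (u x)) (cube a s)) (1 / q) *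
          ennreal_powr (mass (dual_weight p v) ?P) (1 / conj_exp p)"
      using cp by (intro mult_left_mono ennreal_powr_mono mass_mono sub) auto
    also note C1
    finally show "(LINT x:cube a s|lebesgue. u x) powr (1 / q) * (LINT x:?c|lebesgue. w x) powr (1 / conj_exp p) \<le> C"
      using cp q C lint unfolding mw weightD(4)[OF u] weightD(4)[OF w] eC
      by (simp add: ennreal_powr_ennreal ennreal_mult[symmetric])
    have "ennreal_powr (mass (\<lambda>x. ennreal (u x)) ?c) (1 / q) *
          ennreal_powr (mass (dual_weight p v) (cube a s)) (1 / conj_exp p)
        \<le> ennreal_powr (mass (\<lambda>x. ennreal (u x)) ?P) (1 / q) *
          ennreal_powr (mass (dual_weight p v) (cube a s)) (1 / conj_exp p)"
      using q by (intro mult_right_mono ennreal_powr_mono mass_mono sub) auto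
    also note C2
    finally show "(LINT x:?c|lebesgue. u x) powr (1 / q) * (LINT x:cube a s|lebesgue. w x) powr (1 / conj_exp p) \<le> C"
      using cp q C lint unfolding mw weightD(4)[OF u] weightD(4)[OF w] eC
      by (simp add: ennreal_powr_ennreal ennreal_mult[symmetric])
  qed
  show ?thesis
  proof (rule that[of C])
    show "dual_pair u w (1 / q) (1 / conj_exp p) C (real CARD('n))"
      using both(1) cp q by unfold_locales (auto intro: weightD[OF u] weightD[OF w])
    show "dual_pair w u (1 / conj_exp p) (1 / q) C (real CARD('n))"
      using both(2) cp q by unfold_locales (auto intro: weightD[OF u] weightD[OF w] simp: mult.commute)
  qed
qed

text \<open>Reduces the claim to finite norms: if the right-hand integral is infinite, a positive
  constant times \<infinity> is \<infinity>. What remains is a q-th root.\<close>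

lemma fourier_inequalityI:
  fixes u v :: "real ^ 'n \<Rightarrow> real"
  assumes p: "0 < p" "0 < q" and K: "0 < K"
    and le: "\<And>f N. integrable lebesgue f \<Longrightarrow> 0 \<le> N \<Longrightarrow>
      (\<integral>\<^sup>+x. ennreal (cmod (f x) powr p * v x) \<partial>lebesgue) = ennreal N \<Longrightarrow>
      (\<integral>\<^sup>+x. ennreal (cmod (fourier f x) powr q * u x) \<partial>lebesgue) \<le> ennreal (K * N powr (q / p))"
  shows "\<exists>C::real. 0 < C \<and> (\<forall>f :: real ^ 'n \<Rightarrow> complex. integrable lebesgue f \<longrightarrow>
           ennreal_powr (\<integral>\<^sup>+x. ennreal (cmod (fourier f x) powr q * u x) \<partial>lebesgue) (1 / q)
             \<le> ennreal C * ennreal_powr (\<integral>\<^sup>+x. ennreal (cmod (f x) powr p * v x) \<partial>lebesgue) (1 / p))"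
proof (intro exI[of _ "K powr (1 / q)"] conjI allI impI)
  fix f :: "real ^ 'n \<Rightarrow> complex" assume f: "integrable lebesgue f"
  let ?N = "\<integral>\<^sup>+x. ennreal (cmod (f x) powr p * v x) \<partial>lebesgue"
  show "ennreal_powr (\<integral>\<^sup>+x. ennreal (cmod (fourier f x) powr q * u x) \<partial>lebesgue) (1 / q)
             \<le> ennreal (K powr (1 / q)) * ennreal_powr ?N (1 / p)"
  proof (cases ?N)
    case (real N)
    have "ennreal_powr (\<integral>\<^sup>+x. ennreal (cmod (fourier f x) powr q * u x) \<partial>lebesgue) (1 / q)
        \<le> ennreal_powr (ennreal (K * N powr (q / p))) (1 / q)"
      using p by (intro ennreal_powr_mono le[OF f _ real(2)] real) auto
    also have "\<dots> = ennreal (K powr (1 / q) * N powr (1 / p))"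
      using p K by (simp add: ennreal_powr_ennreal powr_mult powr_powr)
    finally show ?thesis
      using p K real by (simp add: ennreal_powr_ennreal ennreal_mult)
  next
    case top
    then have "ennreal_powr ?N (1 / p) = \<top>" using p by (simp add: ennreal_powr_def)
    then show ?thesis using K by (simp add: ennreal_mult_top)
  qed
qed (use K in simp)

subsection \<open>Consequences of the conditions (a) and (b)\<close>

lemma set_lint_lower:
  fixes g :: "real ^ 'n \<Rightarrow> real"
  assumes g: "set_integrable lebesgue (cube a s) g" "\<And>x. 0 \<le> g x"
    and E: "E \<in> sets lebesgue" "E \<subseteq> cube a s" "E \<subseteq> {x. t \<le> g x}"
  shows "t * measure lebesgue E \<le> (LINT x:E|lebesgue. g x)"
    and "(LINT x:E|lebesgue. g x) \<le> (LINT x:cube a s|lebesgue. g x)"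
proof -
  have Em: "E \<in> lmeasurable"
    using E by (meson cube_lmeasurable fmeasurableI2)
  have gE: "set_integrable lebesgue E g"
    by (rule set_integrable_subset[OF g(1) E(1,2)])
  have "t * measure lebesgue E = (LINT x:E|lebesgue. t)"
    using Em by (simp add: set_lebesgue_integral_def mult.commute fmeasurable_def)
  also have "\<dots> \<le> (LINT x:E|lebesgue. g x)"
    using E Em by (intro set_integral_mono gE) (auto simp: set_integrable_def fmeasurable_def intro!: integrable_mult_left)
  finally show "t * measure lebesgue E \<le> (LINT x:E|lebesgue. g x)" .
  show "(LINT x:E|lebesgue. g x) \<le> (LINT x:cube a s|lebesgue. g x)"
    using gE g E(2) unfolding set_lebesgue_integral_def set_integrable_def
    by (intro integral_mono) (auto simp: indicator_def)
qed

lemma power_conv_powr: "0 < s \<Longrightarrow> s ^ CARD('n) = s powr real CARD('n)" for s :: real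
  by (simp add: powr_realpow)

text \<open>A real power of a positive number is positive. This is the nontriviality of w that the
  growth argument requires.\<close>

lemma not_AE_powr_eq_0:
  fixes v :: "'a::euclidean_space \<Rightarrow> real"
  assumes "AE x in lebesgue. 0 < v x"
  shows "\<not> (AE x in lebesgue. v x powr a = 0)"
proof
  assume "AE x in lebesgue. v x powr a = 0"
  with assms have "AE x in (lebesgue :: 'a measure). False" by eventually_elim simp
  moreover have "(UNIV :: 'a set) \<in> sets lebesgue"
    using sets.top[of "lebesgue :: 'a measure"] by simp
  ultimately have "emeasure lebesgue (UNIV :: 'a set) = 0"
    using AE_iff_measurable[of UNIV "lebesgue :: 'a measure" "\<lambda>_. False"] by (simp del: emeasure_completion)
  then show False by simp
qed

text \<open>Chebyshev gives t |E| \<le> u(E); the condition bounds u(E) by a multiple of u(Q) (|E| /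
  s^n)^\<gamma>, and division by |E|^\<gamma> leaves the density estimate.\<close>

lemma reverse_condition_density:
  fixes u :: "real ^ 'n \<Rightarrow> real" and C \<gamma> :: real
  assumes u: "weight u"
    and cond: "\<forall>Q\<in>cubes. \<forall>E\<in>sets lebesgue. E \<subseteq> Q \<longrightarrow>
               (LINT x:E|lebesgue. u x) / (LINT x:Q|lebesgue. u x) \<le> C * (measure lebesgue E / measure lebesgue Q) powr \<gamma>"
    and s: "0 < s" and t: "0 < t" and E: "E \<in> sets lebesgue" "E \<subseteq> cube a s" "E \<subseteq> {x. t \<le> u x}"
  shows "t * measure lebesgue E powr (1 - \<gamma>) \<le> \<bar>C\<bar> * (LINT x:cube a s|lebesgue. u x) * s powr (- (real CARD('n) * \<gamma>))"
proof (cases "measure lebesgue E = 0")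
  case True
  then show ?thesis by (simp add: set_lint_nonneg weightD(2)[OF u])
next
  case False
  then have m: "0 < measure lebesgue E" by (simp add: less_le)
  note low = set_lint_lower[OF weightD(3,2)[OF u] E]
  let ?uQ = "LINT x:cube a s|lebesgue. u x"
  have uE: "0 < t * measure lebesgue E" using m t by simp
  \<comment> \<open>Positivity makes the quotient by u(Q) genuine: in HOL a quotient by 0 is 0, and
    the condition would then carry no information on u(E).\<close>
  then have uQ: "0 < ?uQ" using low by linarith
  have "cube a s \<in> cubes" using s by (auto simp: cubes_eq)
  with cond E have "(LINT x:E|lebesgue. u x) / ?uQ \<le> C * (measure lebesgue E / measure lebesgue (cube a s)) powr \<gamma>" by blast
  also have "\<dots> \<le> \<bar>C\<bar> * (measure lebesgue E / measure lebesgue (cube a s)) powr \<gamma>"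
    by (intro mult_right_mono) auto
  finally have "t * measure lebesgue E \<le> \<bar>C\<bar> * (measure lebesgue E / measure lebesgue (cube a s)) powr \<gamma> * ?uQ"
    using low(1) uQ by (simp add: pos_divide_le_eq)
  also have "(measure lebesgue E / measure lebesgue (cube a s)) powr \<gamma> = measure lebesgue E powr \<gamma> * s powr (- (real CARD('n) * \<gamma>))"
    using s m by (simp only: measure_cube[OF less_imp_le] power_conv_powr)
      (simp add: powr_divide powr_powr powr_minus divide_simps)
  finally have "t * measure lebesgue E / measure lebesgue E powr \<gamma> \<le> \<bar>C\<bar> * ?uQ * s powr (- (real CARD('n) * \<gamma>))"
    using m by (subst pos_divide_le_eq) (auto simp: mult_ac)
  moreover have "measure lebesgue E powr (1 - \<gamma>) = measure lebesgue E / measure lebesgue E powr \<gamma>"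
    using m by (simp add: powr_diff)
  ultimately show ?thesis by simp
qed

text \<open>Hoelder's inequality for 1 = v powr (1/p) * w powr (1/p') on the cube. It bounds v(Q)
  from below in terms of w(Q), which is how condition (b) on v becomes one on w.\<close>

lemma cube_measure_Holder:
  fixes v :: "real ^ 'n \<Rightarrow> real"
  assumes p: "1 < p" and v: "weight v" and lw: "locally_integrable (dual_weight p v)" and s: "0 < s"
  shows "s powr real CARD('n) \<le> (LINT x:cube a s|lebesgue. v x) powr (1 / p)
     * (LINT x:cube a s|lebesgue. v x powr (- conj_exp p / p)) powr (1 / conj_exp p)"
proof -
  define w where "w x = v x powr (- conj_exp p / p)" for x
  have w: "weight w" unfolding w_def[abs_def] by (rule dual_weight_AE[OF p v lw])
  note [measurable] = weightD(1)[OF v] weightD(1)[OF w]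
  have cp: "0 < conj_exp p" using p by (simp add: conj_exp_def)
  let ?i = "indicator (cube a s) :: real ^ 'n \<Rightarrow> real"
  have "ennreal (s powr real CARD('n)) = emeasure lebesgue (cube a s)"
    using s by (simp only: emeasure_cube[OF less_imp_le] power_conv_powr)
  also have "\<dots> = (\<integral>\<^sup>+x. indicator (cube a s) x \<partial>lebesgue)"
    by (rule nn_integral_indicator[symmetric]) simp
  also have "\<dots> = (\<integral>\<^sup>+x. ennreal ((?i x * v x powr (1 / p)) * (?i x * w x powr (1 / conj_exp p))) \<partial>lebesgue)"
    using dual_weight_AE(1)[OF p v lw]
  proof (intro nn_integral_cong_AE, eventually_elim)
    case (elim x)
    have "v x powr (1 / p) * w x powr (1 / conj_exp p) = 1"
    proof -
      have "- conj_exp p / p * (1 / conj_exp p) = - (1 / p)" using cp by simp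
      then have "w x powr (1 / conj_exp p) = v x powr (- (1 / p))"
        unfolding w_def powr_powr by simp
      then show ?thesis using elim by (simp add: powr_minus)
    qed
    then show ?case by (auto simp: indicator_def)
  qed
  also have "\<dots> \<le> ennreal ((LINT x:cube a s|lebesgue. v x) powr (1 / p) * (LINT x:cube a s|lebesgue. w x) powr (1 / conj_exp p))"
  proof (rule nn_integral_Holder[OF p])
    have "(\<integral>\<^sup>+x. ennreal ((?i x * v x powr (1 / p)) powr p) \<partial>lebesgue) = (\<integral>\<^sup>+x\<in>cube a s. ennreal (v x) \<partial>lebesgue)"
      using p weightD(2)[OF v] by (intro nn_integral_cong) (auto simp: indicator_def powr_powr)
    also have "\<dots> = ennreal (LINT x:cube a s|lebesgue. v x)"
      by (rule nn_set_integral_eq_set_lint[OF weightD(3,2)[OF v]])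
    finally show "(\<integral>\<^sup>+x. ennreal ((?i x * v x powr (1 / p)) powr p) \<partial>lebesgue) \<le> ennreal (LINT x:cube a s|lebesgue. v x)" by simp
    have "(\<integral>\<^sup>+x. ennreal ((?i x * w x powr (1 / conj_exp p)) powr conj_exp p) \<partial>lebesgue) = (\<integral>\<^sup>+x\<in>cube a s. ennreal (w x) \<partial>lebesgue)"
      using cp weightD(2)[OF w] by (intro nn_integral_cong) (auto simp: indicator_def powr_powr)
    also have "\<dots> = ennreal (LINT x:cube a s|lebesgue. w x)"
      by (rule nn_set_integral_eq_set_lint[OF weightD(3,2)[OF w]])
    finally show "(\<integral>\<^sup>+x. ennreal ((?i x * w x powr (1 / conj_exp p)) powr conj_exp p) \<partial>lebesgue) \<le> ennreal (LINT x:cube a s|lebesgue. w x)" by simp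
  qed (auto intro: set_lint_nonneg weightD(2)[OF v] weightD(2)[OF w])
  finally show ?thesis
    by (simp add: w_def)
qed

text \<open>On E, w \<ge> t means v \<le> t powr (- (p - 1)), so v(E) \<le> t powr (- (p - 1)) |E|;
  Hoelder gives 1/v(Q) \<le> w(Q) powr (p - 1) * s powr (- (n p)). Both go into the condition, which
  is then raised to a power that makes t and w(Q) appear linearly.\<close>

lemma Muckenhoupt_condition_density:
  fixes v :: "real ^ 'n \<Rightarrow> real" and C p q :: real
  assumes p: "1 < p" "p \<le> q" and v: "weight v" and lw: "locally_integrable (dual_weight p v)"
    and cond: "\<forall>Q\<in>cubes. \<forall>E\<in>sets lebesgue. E \<subseteq> Q \<longrightarrow>
               measure lebesgue E / measure lebesgue Q
                 \<le> C * ((LINT x:E|lebesgue. v x) / (LINT x:Q|lebesgue. v x)) powr (conj_exp q / p)"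
    and s: "0 < s" and t: "0 < t" and E: "E \<in> sets lebesgue" "E \<subseteq> cube a s"
      "E \<subseteq> {x. t \<le> v x powr (- conj_exp p / p)}"
  shows "t * measure lebesgue E powr (1 - conj_exp p / q)
    \<le> \<bar>C\<bar> powr (p / (conj_exp q * (p - 1))) * (LINT x:cube a s|lebesgue. v x powr (- conj_exp p / p))
        * s powr (- (real CARD('n) * (conj_exp p / q)))"
proof (cases "measure lebesgue E = 0")
  case True
  then show ?thesis by (simp add: set_lint_nonneg)
next
  case False
  then have m: "0 < measure lebesgue E" by (simp add: less_le)
  define n where "n = real CARD('n)"
  define w where "w x = v x powr (- conj_exp p / p)" for x
  have w: "weight w" unfolding w_def[abs_def] by (rule dual_weight_AE[OF p(1) v lw])
  define vQ wQ \<mu> where "vQ = (LINT x:cube a s|lebesgue. v x)" and "wQ = (LINT x:cube a s|lebesgue. w x)"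
    and "\<mu> = measure lebesgue E"
  define \<kappa> where "\<kappa> = conj_exp q / p"
  \<comment> \<open>Undoes the exponent \<kappa> (p - 1) of 1/t and of w(Q). In other terms b = p' -
    p'/q, whence the exponents of |E| and s below.\<close>
  define b where "b = 1 / (\<kappa> * (p - 1))"
  have \<kappa>: "0 < \<kappa>" using p by (simp add: \<kappa>_def conj_exp_def)
  have b: "0 < b" using \<kappa> p by (simp add: b_def)
  have \<kappa>b: "\<kappa> * b = 1 / (p - 1)" using \<kappa> by (simp add: b_def)
  have expo: "- conj_exp p / p = - (1 / (p - 1))" using p by (simp add: conj_exp_def)
  have b1: "b - 1 / (p - 1) = 1 - conj_exp p / q"
  proof -
    have nz: "p \<noteq> 0" "q \<noteq> 0" "p - 1 \<noteq> 0" "q - 1 \<noteq> 0" using p by auto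
    then have "b = p * (q - 1) / (q * (p - 1))"
      by (simp add: b_def \<kappa>_def conj_exp_def)
    moreover have "p * (q - 1) / (q * (p - 1)) - 1 / (p - 1) = 1 - p / (p - 1) / q"
      using nz by (simp add: divide_simps) (simp add: algebra_simps)
    ultimately show ?thesis by (simp add: conj_exp_def)
  qed
  have b2: "p / (p - 1) - b = conj_exp p / q"
  proof -
    have "p / (p - 1) = 1 + 1 / (p - 1)" using p by (simp add: field_simps)
    with b1 show ?thesis by linarith
  qed
  have \<mu>: "0 < \<mu>" using m by (simp add: \<mu>_def)
  have "t * \<mu> \<le> wQ"
    using set_lint_lower[OF weightD(3,2)[OF w] E(1,2), of t] E(3) by (simp add: w_def \<mu>_def wQ_def)
  then have wQ: "0 < wQ" using t \<mu> by (smt (verit) mult_pos_pos)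
  have H: "s powr n \<le> vQ powr (1 / p) * wQ powr (1 / conj_exp p)"
    using cube_measure_Holder[OF p(1) v lw s, of a] by (simp add: n_def vQ_def wQ_def w_def)
  have vQ0: "0 \<le> vQ" unfolding vQ_def by (intro set_lint_nonneg weightD(2)[OF v])
  have vQ: "0 < vQ"
  proof (rule ccontr)
    assume "\<not> 0 < vQ"
    with vQ0 have "vQ = 0" by simp
    with H s show False by simp
  qed
  have vb: "v x \<le> t powr (- (p - 1))" if "x \<in> E" for x
  proof -
    have tw: "t \<le> v x powr (- (1 / (p - 1)))" using E(3) that unfolding expo by auto
    then have vx: "v x \<noteq> 0" using t by auto
    with weightD(2)[OF v, of x] have vx: "0 < v x" by simp
    have "(v x powr (- (1 / (p - 1)))) powr (- (p - 1)) \<le> t powr (- (p - 1))"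
      using tw t p by (intro powr_mono2') auto
    moreover have "- (1 / (p - 1)) * - (p - 1) = 1" using p by (simp add: field_simps)
    then have "(v x powr (- (1 / (p - 1)))) powr (- (p - 1)) = v x"
      unfolding powr_powr using vx by (simp only: powr_one)
    ultimately show ?thesis by simp
  qed
  have Em: "E \<in> lmeasurable"
    using E by (meson cube_lmeasurable fmeasurableI2)
  have vE: "(LINT x:E|lebesgue. v x) \<le> t powr (- (p - 1)) * \<mu>"
  proof -
    have "(LINT x:E|lebesgue. v x) \<le> (LINT x:E|lebesgue. t powr (- (p - 1)))"
      using Em vb by (intro set_integral_mono set_integrable_subset[OF weightD(3)[OF v] E(1,2)])
        (auto simp: set_integrable_def fmeasurable_def intro!: integrable_mult_left)
    also have "\<dots> = t powr (- (p - 1)) * \<mu>"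
      using Em by (simp add: set_lebesgue_integral_def mult.commute fmeasurable_def \<mu>_def)
    finally show ?thesis .
  qed
  have vE0: "0 \<le> (LINT x:E|lebesgue. v x)" by (intro set_lint_nonneg weightD(2)[OF v])
  have inv: "1 / vQ \<le> wQ powr (p - 1) * s powr (- (n * p))"
  proof -
    have "(s powr n) powr p \<le> (vQ powr (1 / p) * wQ powr (1 / conj_exp p)) powr p"
      using H p by (intro powr_mono2) auto
    also have "\<dots> = vQ * wQ powr (p - 1)"
      using p vQ wQ by (simp add: powr_mult powr_powr conj_exp_def)
    finally have "s powr (n * p) \<le> vQ * wQ powr (p - 1)" by (simp add: powr_powr)
    then show ?thesis using vQ s by (simp add: powr_minus field_simps)
  qed
  have "cube a s \<in> cubes" using s by (auto simp: cubes_eq)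
  with cond E have "\<mu> / measure lebesgue (cube a s) \<le> C * ((LINT x:E|lebesgue. v x) / vQ) powr \<kappa>"
    unfolding \<mu>_def vQ_def \<kappa>_def by blast
  also have "\<dots> \<le> \<bar>C\<bar> * ((t powr (- (p - 1)) * \<mu>) * (wQ powr (p - 1) * s powr (- (n * p)))) powr \<kappa>"
  proof (rule mult_mono)
    have "(LINT x:E|lebesgue. v x) / vQ = (LINT x:E|lebesgue. v x) * (1 / vQ)" by simp
    also have "\<dots> \<le> (t powr (- (p - 1)) * \<mu>) * (wQ powr (p - 1) * s powr (- (n * p)))"
      using vE inv vQ vE0 \<mu> by (intro mult_mono) auto
    finally show "((LINT x:E|lebesgue. v x) / vQ) powr \<kappa> \<le> ((t powr (- (p - 1)) * \<mu>) * (wQ powr (p - 1) * s powr (- (n * p)))) powr \<kappa>"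
      using vE0 vQ \<kappa> by (intro powr_mono2) auto
  qed auto
  finally have "\<mu> * s powr (- n) \<le> \<bar>C\<bar> * ((t powr (- (p - 1)) * \<mu>) * (wQ powr (p - 1) * s powr (- (n * p)))) powr \<kappa>"
    using s by (simp add: measure_cube powr_minus powr_realpow n_def divide_inverse)
  then have "(\<mu> * s powr (- n)) powr b \<le> (\<bar>C\<bar> * ((t powr (- (p - 1)) * \<mu>) * (wQ powr (p - 1) * s powr (- (n * p)))) powr \<kappa>) powr b"
    using b \<mu> by (intro powr_mono2) auto
  also have "\<dots> = \<bar>C\<bar> powr b * (((t powr (- (p - 1)) * \<mu>) * (wQ powr (p - 1) * s powr (- (n * p)))) powr \<kappa>) powr b"
    by (rule powr_mult)
  also have "(((t powr (- (p - 1)) * \<mu>) * (wQ powr (p - 1) * s powr (- (n * p)))) powr \<kappa>) powr b = ((t powr (- (p - 1)) * \<mu>) * (wQ powr (p - 1) * s powr (- (n * p)))) powr (1 / (p - 1))"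
    by (simp only: powr_powr \<kappa>b)
  also have "((t powr (- (p - 1)) * \<mu>) * (wQ powr (p - 1) * s powr (- (n * p)))) powr (1 / (p - 1))
      = t powr (- (p - 1) * (1 / (p - 1))) * \<mu> powr (1 / (p - 1)) * (wQ powr ((p - 1) * (1 / (p - 1))) * s powr (- (n * p) * (1 / (p - 1))))"
    using \<mu> by (simp only: powr_mult mult_nonneg_nonneg powr_ge_zero less_imp_le powr_powr)
  also have "- (p - 1) * (1 / (p - 1)) = - 1" using p by (simp add: field_simps)
  also have "(p - 1) * (1 / (p - 1)) = 1" using p by simp
  finally have main: "\<mu> powr b * s powr (- n * b)
      \<le> \<bar>C\<bar> powr b * (t powr (- 1) * \<mu> powr (1 / (p - 1)) * (wQ powr 1 * s powr (- (n * p) * (1 / (p - 1)))))"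
    using \<mu> by (simp add: powr_mult powr_powr)
  \<comment> \<open>A factor 1, inserted so that the power of s on the left of \<open>main\<close>
    can be moved to the right.\<close>
  have ss: "s powr (- n * b) * s powr (n * b) = 1"
    using s by (simp add: powr_add[symmetric])
  have "t * \<mu> powr (b - 1 / (p - 1)) = t * (\<mu> powr b * \<mu> powr (- (1 / (p - 1)))) * (s powr (- n * b) * s powr (n * b))"
    unfolding ss by (simp only: powr_add[symmetric]) simp
  also have "\<dots> = (\<mu> powr b * s powr (- n * b)) * (t * \<mu> powr (- (1 / (p - 1))) * s powr (n * b))"
    by (simp only: mult_ac)
  also have "\<dots> \<le> (\<bar>C\<bar> powr b * (t powr (- 1) * \<mu> powr (1 / (p - 1)) * (wQ powr 1 * s powr (- (n * p) * (1 / (p - 1))))))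
      * (t * \<mu> powr (- (1 / (p - 1))) * s powr (n * b))"
    using t by (intro mult_right_mono[OF main]) auto
  also have "\<dots> = \<bar>C\<bar> powr b * wQ * (s powr (- (n * p) * (1 / (p - 1))) * s powr (n * b)) * (t powr (- 1) * t) * (\<mu> powr (1 / (p - 1)) * \<mu> powr (- (1 / (p - 1))))"
    using wQ by (simp add: mult_ac)
  also have "\<dots> = \<bar>C\<bar> powr b * wQ * s powr (- (n * (p / (p - 1) - b)))"
  proof -
    have "s powr (- (n * p) * (1 / (p - 1))) * s powr (n * b) = s powr (- (n * (p / (p - 1) - b)))"
      unfolding powr_add[symmetric] by (simp add: right_diff_distrib)
    moreover have "t powr (- 1) * t = 1"
      using t by (simp add: powr_minus)
    moreover have "\<mu> powr (1 / (p - 1)) * \<mu> powr (- (1 / (p - 1))) = 1"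
      using \<mu> by (simp add: powr_add[symmetric])
    ultimately show ?thesis by (simp only: mult_1_right)
  qed
  finally show ?thesis
    unfolding b1 b2 by (simp add: b_def \<kappa>_def wQ_def w_def n_def \<mu>_def)
qed

subsection \<open>The weighted Fourier inequality\<close>

text \<open>w \<le> M means v \<ge> M powr (- (p - 1)), so the unweighted L^p norm of f is at most a
  multiple of the weighted one, and the Paley inequality for the weak-type weight u applies.\<close>

lemma fourier_inequality_reverse_condition:
  fixes u v :: "real ^ 'n \<Rightarrow> real"
  assumes p: "1 < p" "p \<le> q" and u: "weight u" and v: "weight v"
    and lw: "locally_integrable (dual_weight p v)" and N: "N_Q p q u v"
    and q: "q \<le> conj_exp p" "p \<noteq> 2"
    and cond: "\<forall>Q\<in>cubes. \<forall>E\<in>sets lebesgue. E \<subseteq> Q \<longrightarrow>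
               (LINT x:E|lebesgue. u x) / (LINT x:Q|lebesgue. u x)
                 \<le> C * (measure lebesgue E / measure lebesgue Q) powr (q / conj_exp p)"
  obtains K where "0 < K" and "\<And>f N. integrable lebesgue f \<Longrightarrow> 0 \<le> N \<Longrightarrow>
      (\<integral>\<^sup>+x. ennreal (cmod (f x) powr p * v x) \<partial>lebesgue) = ennreal N \<Longrightarrow>
      (\<integral>\<^sup>+x. ennreal (cmod (fourier f x) powr q * u x) \<partial>lebesgue) \<le> ennreal (K * N powr (q / p))"
proof -
  define w where "w = (\<lambda>x. v x powr (- conj_exp p / p))"
  note vpos = dual_weight_AE(1)[OF p(1) v lw]
  note [measurable] = weightD(1)[OF u] weightD(1)[OF v]
  have cp: "0 < conj_exp p" and q0: "0 < q" using p by (auto simp: conj_exp_def)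
  \<comment> \<open>p \<le> q \<le> p' implies p \<le> 2, and the excluded value makes it
    strict.\<close>
  have "p \<le> p / (p - 1)" using p q by (simp add: conj_exp_def)
  then have "p \<le> 2" using p by (simp add: field_simps)
  with q have p2: "p < 2" by simp
  show ?thesis
  proof (cases "AE x in lebesgue. u x = 0")
    case True
    have "(\<integral>\<^sup>+x. ennreal (cmod (fourier f x) powr q * u x) \<partial>lebesgue) = integral\<^sup>N (lebesgue :: (real ^ 'n) measure) (\<lambda>x. 0)" for f
      using True by (intro nn_integral_cong_AE, eventually_elim) simp
    then show ?thesis by (intro that[of 1]) auto
  next
    case u0: False
    obtain D where "dual_pair u w (1 / q) (1 / conj_exp p) D (real CARD('n))"
      using N_Q_dual_pairs[OF p u v lw N] unfolding w_def by blast
    then interpret dual_pair u w "1 / q" "1 / conj_exp p" D "real CARD('n)" .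
    have w0: "\<not> (AE x in lebesgue. w x = 0)"
      unfolding w_def by (rule not_AE_powr_eq_0[OF vpos])
    have g: "1 / conj_exp p / (1 / q) = q / conj_exp p" by simp
    have g': "real CARD('n) * (1 / conj_exp p) / (1 / q) = real CARD('n) * (q / conj_exp p)" by simp
    note concl = weak_type_and_dual_bounded[OF u0 w0, unfolded g g']
    have "\<exists>A. weak_type (1 - q / conj_exp p) A u"
      by (rule concl(1)) (rule reverse_condition_density[OF u cond])
    moreover have "\<exists>M>0. AE x in lebesgue. w x \<le> M"
      by (rule concl(2)) (rule reverse_condition_density[OF u cond])
    ultimately obtain A M where wt: "weak_type (1 - q / conj_exp p) A u" and M: "0 < M" "AE x in lebesgue. w x \<le> M"
      by blast
    obtain K where K: "0 < K" and le: "\<And>f B. integrable lebesgue f \<Longrightarrow> 0 \<le> B \<Longrightarrow>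
      (\<integral>\<^sup>+x. ennreal (cmod (f x) powr p) \<partial>lebesgue) \<le> ennreal (B powr p) \<Longrightarrow>
      (\<integral>\<^sup>+z. ennreal (cmod (fourier f z) powr q * u z) \<partial>lebesgue) \<le> ennreal (K * B powr q)"
      using fourier_weak_weight[OF p(1) p2 p(2) q(1) weightD(1,2)[OF u] wt] by blast
    show ?thesis
    proof (rule that[of "K * M powr ((p - 1) * (q / p))"])
      show "0 < K * M powr ((p - 1) * (q / p))" using K M by simp
      fix f :: "real ^ 'n \<Rightarrow> complex" and N :: real
      assume f: "integrable lebesgue f" and N0: "0 \<le> N"
        and fN: "(\<integral>\<^sup>+x. ennreal (cmod (f x) powr p * v x) \<partial>lebesgue) = ennreal N"
      note [measurable] = borel_measurable_integrable[OF f]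
      have lower: "AE x in lebesgue. 1 \<le> M powr (p - 1) * v x"
        using vpos M(2)
      proof eventually_elim
        case (elim x)
        have e: "- conj_exp p / p * - (p - 1) = 1" using p by (simp add: conj_exp_def field_simps)
        have "M powr (- (p - 1)) \<le> w x powr (- (p - 1))"
          using elim p by (intro powr_mono2') (auto simp: w_def)
        also have "\<dots> = v x"
          unfolding w_def powr_powr e using elim by simp
        finally have "M powr (- (p - 1)) \<le> v x" .
        then have "M powr (p - 1) * M powr (- (p - 1)) \<le> M powr (p - 1) * v x"
          by (intro mult_left_mono) auto
        then show ?case using M(1) by (simp add: powr_add[symmetric])
      qed
      define B where "B = (M powr (p - 1) * N) powr (1 / p)"
      have "(\<integral>\<^sup>+x. ennreal (cmod (f x) powr p) \<partial>lebesgue) \<le> (\<integral>\<^sup>+x. ennreal (M powr (p - 1)) * ennreal (cmod (f x) powr p * v x) \<partial>lebesgue)"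
        using lower
      proof (intro nn_integral_mono_AE, eventually_elim)
        case (elim x)
        from mult_left_mono[OF elim(2), of "cmod (f x) powr p"]
        have "cmod (f x) powr p \<le> M powr (p - 1) * (cmod (f x) powr p * v x)" by (simp add: mult_ac)
        then show ?case using weightD(2)[OF v] by (simp add: ennreal_mult[symmetric] ennreal_leI)
      qed
      also have "\<dots> = ennreal (M powr (p - 1)) * ennreal N"
        unfolding fN[symmetric] by (rule nn_integral_cmult) measurable
      also have "\<dots> = ennreal (B powr p)"
        using p N0 by (simp add: B_def powr_powr ennreal_mult[symmetric])
      finally have "(\<integral>\<^sup>+x. ennreal (cmod (fourier f x) powr q * u x) \<partial>lebesgue) \<le> ennreal (K * B powr q)"
        by (intro le f) (simp add: B_def)
      also have "B powr q = M powr ((p - 1) * (q / p)) * N powr (q / p)"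
        using N0 by (simp add: B_def powr_powr powr_mult)
      finally show "(\<integral>\<^sup>+x. ennreal (cmod (fourier f x) powr q * u x) \<partial>lebesgue)
          \<le> ennreal (K * M powr ((p - 1) * (q / p)) * N powr (q / p))"
        by (simp add: mult.assoc)
    qed
  qed
qed

text \<open>The Paley inequality for the exponent r = q' < 2 and the weight w says that the
  transform maps L^r into L^p'(w). Tested on |fourier f|^(q-2) cnj (fourier f), cut off to a ball,
  the multiplication formula and Hoelder bound the integral J of |fourier f|^q over the ball by a
  constant times N^(1/p) J^(1/r). The cut-off makes J finite, so it can be divided out, leaving
  J^(1/q) because 1 - 1/r = 1/q.\<close>

lemma fourier_dual_inequality:
  fixes v :: "real ^ 'n \<Rightarrow> real"
  assumes p: "1 < p" "p \<le> q" and q: "2 < q" "conj_exp p \<le> q"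
    and v: "weight v" and lw: "locally_integrable (dual_weight p v)"
    and wt: "weak_type (1 - conj_exp p / q) A (\<lambda>x. v x powr (- conj_exp p / p))"
  obtains K where "0 < K" and "\<And>f N. integrable lebesgue f \<Longrightarrow> 0 \<le> N \<Longrightarrow>
      (\<integral>\<^sup>+x. ennreal (cmod (f x) powr p * v x) \<partial>lebesgue) = ennreal N \<Longrightarrow>
      (\<integral>\<^sup>+x. ennreal (cmod (fourier f x) powr q) \<partial>lebesgue) \<le> ennreal (K * N powr (q / p))"
proof -
  define w where "w = (\<lambda>x. v x powr (- conj_exp p / p))"
  have w: "weight w" unfolding w_def by (rule dual_weight_AE[OF p(1) v lw])
  note vpos = dual_weight_AE(1)[OF p(1) v lw]
  note [measurable] = weightD(1)[OF v] weightD(1)[OF w]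
  have cp: "0 < conj_exp p" and q0: "0 < q" using p by (auto simp: conj_exp_def)
  define r where "r = conj_exp q"
  have r: "1 < r" "r < 2" "r \<le> conj_exp p" "conj_exp r = q"
    using p q by (auto simp: r_def conj_exp_def field_simps)
  have wt': "weak_type (1 - conj_exp p / conj_exp r) A w" using wt by (simp add: r(4) w_def)
  have "conj_exp p \<le> conj_exp r" using q by (simp add: r(4))
  from fourier_weak_weight[OF r(1-3) this weightD(1,2)[OF w] wt']
  obtain K where K: "0 < K" and le: "\<And>h B. integrable lebesgue h \<Longrightarrow> 0 \<le> B \<Longrightarrow>
      (\<integral>\<^sup>+x. ennreal (cmod (h x) powr r) \<partial>lebesgue) \<le> ennreal (B powr r) \<Longrightarrow>
      (\<integral>\<^sup>+z. ennreal (cmod (fourier h z) powr conj_exp p * w z) \<partial>lebesgue) \<le> ennreal (K * B powr conj_exp p)"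
    by blast
  show ?thesis
  proof (rule that[of "K powr (q / conj_exp p)"])
    show "0 < K powr (q / conj_exp p)" using K by simp
    fix f :: "real ^ 'n \<Rightarrow> complex" and N :: real
    assume f: "integrable lebesgue f" and N0: "0 \<le> N"
      and fN: "(\<integral>\<^sup>+x. ennreal (cmod (f x) powr p * v x) \<partial>lebesgue) = ennreal N"
    note [measurable] = borel_measurable_integrable[OF f]
    define F where "F z = cmod (fourier f z)" for z
    have F[measurable]: "F \<in> borel_measurable lebesgue" and F0: "\<And>z. 0 \<le> F z" by (auto simp: F_def[abs_def])
    define c where "c = (LINT x|lebesgue. cmod (f x))"
    have Fc: "F z \<le> c" for z unfolding F_def c_def by (rule fourier_bound[OF f])
    have ball: "(\<integral>\<^sup>+z\<in>cball 0 (real k). ennreal (F z powr q) \<partial>lebesgue) \<le> ennreal (K powr (q / conj_exp p) * N powr (q / p))" for k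
    proof -
      let ?S = "cball 0 (real k) :: (real ^ 'n) set"
      have S[measurable]: "?S \<in> sets lebesgue" by simp
      have Sl: "?S \<in> lmeasurable" by simp
      have Sint: "integrable lebesgue (\<lambda>z. indicator ?S z * a)" for a :: real
        using Sl by (intro integrable_mult_left) (auto simp: fmeasurable_def simp del: emeasure_completion)
      \<comment> \<open>The extremal function for the duality of L^q and L^r: on the ball, h *
        fourier f and |h| powr r both equal |fourier f| powr q. The cut-off makes h integrable, as
        the transform is bounded.\<close>
      define h where "h z = complex_of_real (indicator ?S z * F z powr (q - 2)) * cnj (fourier f z)" for z
      have hm[measurable]: "h \<in> borel_measurable lebesgue" unfolding h_def by measurable
      have normh: "cmod (h z) = indicator ?S z * F z powr (q - 1)" for z
      proof -
        have "F z powr (q - 2) * F z = F z powr (q - 1)"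
          using F0[of z] by (cases "F z = 0") (auto simp: powr_diff powr_numeral power2_eq_square)
        then show ?thesis by (simp add: h_def norm_mult F_def[symmetric] abs_mult mult.assoc)
      qed
      have h: "integrable lebesgue h"
      proof (rule Bochner_Integration.integrable_bound[OF Sint[of "c powr (q - 1)"]])
        show "AE z in lebesgue. norm (h z) \<le> norm (indicator ?S z * c powr (q - 1))"
          using Fc F0 q by (auto simp: normh abs_mult intro!: mult_left_mono powr_mono2)
      qed simp
      have Jint: "integrable lebesgue (\<lambda>z. indicator ?S z * F z powr q)"
      proof (rule Bochner_Integration.integrable_bound[OF Sint[of "c powr q"]])
        show "AE z in lebesgue. norm (indicator ?S z * F z powr q) \<le> norm (indicator ?S z * c powr q)"
          using Fc F0 q by (auto simp: abs_mult intro!: mult_left_mono powr_mono2)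
      qed simp
      define J where "J = (LINT z|lebesgue. indicator ?S z * F z powr q)"
      have J0: "0 \<le> J" unfolding J_def by (intro Bochner_Integration.integral_nonneg) auto
      have eJ: "(\<integral>\<^sup>+z. ennreal (indicator ?S z * F z powr q) \<partial>lebesgue) = ennreal J"
        unfolding J_def by (rule nn_integral_eq_integral[OF Jint]) auto
      have "cmod (h z) powr r = indicator ?S z * F z powr q" for z
      proof -
        have "(q - 1) * r = q" using q by (simp add: r_def conj_exp_def)
        then show ?thesis by (auto simp: normh indicator_def powr_powr)
      qed
      then have "(\<integral>\<^sup>+z. ennreal (cmod (h z) powr r) \<partial>lebesgue) = ennreal ((J powr (1 / r)) powr r)"
        using eJ r J0 by (simp add: powr_powr)
      then have hw: "(\<integral>\<^sup>+z. ennreal (cmod (fourier h z) powr conj_exp p * w z) \<partial>lebesgue) \<le> ennreal (K * (J powr (1 / r)) powr conj_exp p)"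
        by (intro le h) auto
      have "complex_of_real J = (LINT z|lebesgue. h z * fourier f z)"
      proof -
        have "h z * fourier f z = complex_of_real (indicator ?S z * F z powr q)" for z
        proof -
          have "h z * fourier f z = complex_of_real (indicator ?S z * F z powr (q - 2)) * complex_of_real ((F z)\<^sup>2)"
            unfolding h_def F_def complex_norm_square by (simp add: mult_ac)
          also have "F z powr (q - 2) * (F z)\<^sup>2 = F z powr q"
            using F0[of z] by (cases "F z = 0") (auto simp: powr_diff powr_numeral)
          then have "complex_of_real (indicator ?S z * F z powr (q - 2)) * complex_of_real ((F z)\<^sup>2) = complex_of_real (indicator ?S z * F z powr q)"
            by (simp only: of_real_mult[symmetric] mult.assoc)
          finally show ?thesis .
        qed
        then show ?thesis by (simp only: J_def integral_complex_of_real)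
      qed
      also have "\<dots> = (LINT x|lebesgue. f x * fourier h x)"
        by (rule fourier_multiplication[OF f h])
      finally have "ennreal J = ennreal (cmod (LINT x|lebesgue. f x * fourier h x))"
        using J0 by (metis abs_of_nonneg norm_of_real)
      also have "\<dots> \<le> (\<integral>\<^sup>+x. ennreal (cmod (f x * fourier h x)) \<partial>lebesgue)"
        by (cases "integrable lebesgue (\<lambda>x. f x * fourier h x)")
          (auto simp: not_integrable_integral_eq intro: integral_norm_bound_ennreal)
      \<comment> \<open>Inserts 1 = v powr (1/p) * w powr (1/p'), valid almost everywhere because v
        > 0 there.\<close>
      also have "\<dots> = (\<integral>\<^sup>+x. ennreal ((cmod (f x) * v x powr (1 / p)) * (cmod (fourier h x) * w x powr (1 / conj_exp p))) \<partial>lebesgue)"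
        using vpos
      proof (intro nn_integral_cong_AE, eventually_elim)
        case (elim x)
        have "- conj_exp p / p * (1 / conj_exp p) = - (1 / p)" using cp by simp
        then have "w x powr (1 / conj_exp p) = v x powr (- (1 / p))"
          unfolding w_def powr_powr by simp
        then have "v x powr (1 / p) * w x powr (1 / conj_exp p) = 1"
          using elim by (simp add: powr_minus)
        then have "(cmod (f x) * v x powr (1 / p)) * (cmod (fourier h x) * w x powr (1 / conj_exp p)) = cmod (f x) * cmod (fourier h x)"
          by (simp add: mult_ac)
        then show ?case by (simp add: norm_mult)
      qed
      also have "\<dots> \<le> ennreal (N powr (1 / p) * (K * (J powr (1 / r)) powr conj_exp p) powr (1 / conj_exp p))"
      proof (rule nn_integral_Holder[OF p(1)])
        have "(\<integral>\<^sup>+x. ennreal ((cmod (f x) * v x powr (1 / p)) powr p) \<partial>lebesgue) = (\<integral>\<^sup>+x. ennreal (cmod (f x) powr p * v x) \<partial>lebesgue)"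
          using p weightD(2)[OF v] by (intro nn_integral_cong) (simp add: powr_mult powr_powr)
        then show "(\<integral>\<^sup>+x. ennreal ((cmod (f x) * v x powr (1 / p)) powr p) \<partial>lebesgue) \<le> ennreal N" by (simp add: fN)
        have "(\<integral>\<^sup>+x. ennreal ((cmod (fourier h x) * w x powr (1 / conj_exp p)) powr conj_exp p) \<partial>lebesgue) = (\<integral>\<^sup>+x. ennreal (cmod (fourier h x) powr conj_exp p * w x) \<partial>lebesgue)"
          using cp weightD(2)[OF w] by (intro nn_integral_cong) (simp add: powr_mult powr_powr)
        then show "(\<integral>\<^sup>+x. ennreal ((cmod (fourier h x) * w x powr (1 / conj_exp p)) powr conj_exp p) \<partial>lebesgue) \<le> ennreal (K * (J powr (1 / r)) powr conj_exp p)"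
          using hw by simp
      qed (use N0 K in auto)
      finally have "J \<le> N powr (1 / p) * (K * (J powr (1 / r)) powr conj_exp p) powr (1 / conj_exp p)"
        by (subst (asm) ennreal_le_iff) auto
      also have "(K * (J powr (1 / r)) powr conj_exp p) powr (1 / conj_exp p) = K powr (1 / conj_exp p) * J powr (1 / r)"
        using K cp by (simp add: powr_mult powr_powr)
      finally have J1: "J \<le> N powr (1 / p) * K powr (1 / conj_exp p) * J powr (1 / r)" by (simp add: mult.assoc)
      have "J \<le> K powr (q / conj_exp p) * N powr (q / p)"
      proof (cases "J = 0")
        case False
        with J0 have J: "0 < J" by simp
        have "1 / r = 1 - 1 / q" using q by (simp add: r_def conj_exp_def field_simps)
        then have "J powr (1 / r) = J * J powr (- (1 / q))"
          using J by (simp add: powr_diff powr_minus divide_inverse)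
        with J1 have "J * 1 \<le> J * (N powr (1 / p) * K powr (1 / conj_exp p) * J powr (- (1 / q)))" by (simp add: mult_ac)
        then have "1 \<le> N powr (1 / p) * K powr (1 / conj_exp p) * J powr (- (1 / q))"
          using J by (simp only: mult_le_cancel_left_pos)
        then have "J powr (1 / q) \<le> N powr (1 / p) * K powr (1 / conj_exp p)"
          using J by (simp add: powr_minus field_simps)
        then have "(J powr (1 / q)) powr q \<le> (N powr (1 / p) * K powr (1 / conj_exp p)) powr q"
          using q by (intro powr_mono2) auto
        then show ?thesis
          using q J by (simp add: powr_powr powr_mult mult.commute)
      qed simp
      moreover have "(\<integral>\<^sup>+z\<in>?S. ennreal (F z powr q) \<partial>lebesgue) = ennreal J"
        unfolding eJ[symmetric] by (intro nn_integral_cong) (auto simp: indicator_def)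
      ultimately show ?thesis by (simp add: ennreal_leI)
    qed
    \<comment> \<open>The bound on balls does not depend on k; continuity from below of the measure
      with this density removes the cut-off.\<close>
    let ?D = "density lebesgue (\<lambda>z. ennreal (F z powr q))"
    have U: "(\<Union>k::nat. cball 0 (real k)) = (UNIV :: (real ^ 'n) set)"
      using real_arch_simple by (auto simp: dist_norm)
    have "(\<integral>\<^sup>+z. ennreal (F z powr q) \<partial>lebesgue) = emeasure ?D (\<Union>k::nat. cball 0 (real k))"
      unfolding U using emeasure_density[of "\<lambda>z. ennreal (F z powr q)" lebesgue UNIV] sets.top[of "lebesgue :: (real ^ 'n) measure"] by simp
    also have "\<dots> = (SUP k. emeasure ?D (cball 0 (real k)))"
      by (rule SUP_emeasure_incseq[symmetric]) (auto simp: incseq_def)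
    also have "\<dots> \<le> ennreal (K powr (q / conj_exp p) * N powr (q / p))"
      using ball by (intro SUP_least) (subst emeasure_density, auto)
    finally show "(\<integral>\<^sup>+x. ennreal (cmod (fourier f x) powr q) \<partial>lebesgue) \<le> ennreal (K powr (q / conj_exp p) * N powr (q / p))"
      by (simp add: F_def)
  qed
qed

text \<open>Condition (b) concerns v, so the pair is taken in the order w, u: w is of weak type and
  u \<le> M. The latter reduces the claim to the inequality with weight 1 on the Fourier
  side.\<close>

lemma fourier_inequality_Muckenhoupt_condition:
  fixes u v :: "real ^ 'n \<Rightarrow> real"
  assumes p: "1 < p" "p \<le> q" and u: "weight u" and v: "weight v"
    and lw: "locally_integrable (dual_weight p v)" and N: "N_Q p q u v"
    and q: "conj_exp p \<le> q" "q \<noteq> 2"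
    and cond: "\<forall>Q\<in>cubes. \<forall>E\<in>sets lebesgue. E \<subseteq> Q \<longrightarrow>
               measure lebesgue E / measure lebesgue Q
                 \<le> C * ((LINT x:E|lebesgue. v x) / (LINT x:Q|lebesgue. v x)) powr (conj_exp q / p)"
  obtains K where "0 < K" and "\<And>f N. integrable lebesgue f \<Longrightarrow> 0 \<le> N \<Longrightarrow>
      (\<integral>\<^sup>+x. ennreal (cmod (f x) powr p * v x) \<partial>lebesgue) = ennreal N \<Longrightarrow>
      (\<integral>\<^sup>+x. ennreal (cmod (fourier f x) powr q * u x) \<partial>lebesgue) \<le> ennreal (K * N powr (q / p))"
proof -
  define w where "w = (\<lambda>x. v x powr (- conj_exp p / p))"
  note vpos = dual_weight_AE(1)[OF p(1) v lw]
  note [measurable] = weightD(1)[OF u] weightD(1)[OF v]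
  have cp: "0 < conj_exp p" and q0: "0 < q" using p by (auto simp: conj_exp_def)
  \<comment> \<open>If q < 2, then p < 2 and p' > 2 > q, against p' \<le> q; so q \<ge> 2, and
    equality is excluded.\<close>
  have q2: "2 < q"
  proof -
    have "2 \<le> q"
    proof (rule ccontr)
      assume "\<not> 2 \<le> q"
      then have "p < 2" using p by simp
      then have "2 < conj_exp p" using p by (simp add: conj_exp_def field_simps)
      with q \<open>\<not> 2 \<le> q\<close> show False by simp
    qed
    with q show ?thesis by simp
  qed
  show ?thesis
  proof (cases "AE x in lebesgue. u x = 0")
    case True
    have "(\<integral>\<^sup>+x. ennreal (cmod (fourier f x) powr q * u x) \<partial>lebesgue) = integral\<^sup>N (lebesgue :: (real ^ 'n) measure) (\<lambda>x. 0)" for f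
      using True by (intro nn_integral_cong_AE, eventually_elim) simp
    then show ?thesis by (intro that[of 1]) auto
  next
    case u0: False
    obtain D where "dual_pair w u (1 / conj_exp p) (1 / q) D (real CARD('n))"
      using N_Q_dual_pairs[OF p u v lw N] unfolding w_def by blast
    then interpret dual_pair w u "1 / conj_exp p" "1 / q" D "real CARD('n)" .
    have w0: "\<not> (AE x in lebesgue. w x = 0)"
      unfolding w_def by (rule not_AE_powr_eq_0[OF vpos])
    have g: "1 / q / (1 / conj_exp p) = conj_exp p / q" by simp
    have g': "real CARD('n) * (1 / q) / (1 / conj_exp p) = real CARD('n) * (conj_exp p / q)" by simp
    note concl = weak_type_and_dual_bounded[OF w0 u0, unfolded g g']
    note dens = Muckenhoupt_condition_density[OF p v lw cond]
    have "\<exists>A. weak_type (1 - conj_exp p / q) A w"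
      by (rule concl(1), unfold w_def) (rule dens)
    moreover have "\<exists>M>0. AE x in lebesgue. u x \<le> M"
      by (rule concl(2), unfold w_def) (rule dens)
    ultimately obtain A M where wt: "weak_type (1 - conj_exp p / q) A w" and M: "0 < M" "AE x in lebesgue. u x \<le> M"
      by blast
    obtain K where K: "0 < K" and le: "\<And>f N. integrable lebesgue f \<Longrightarrow> 0 \<le> N \<Longrightarrow>
      (\<integral>\<^sup>+x. ennreal (cmod (f x) powr p * v x) \<partial>lebesgue) = ennreal N \<Longrightarrow>
      (\<integral>\<^sup>+x. ennreal (cmod (fourier f x) powr q) \<partial>lebesgue) \<le> ennreal (K * N powr (q / p))"
      using fourier_dual_inequality[OF p q2 q(1) v lw wt[unfolded w_def]] by blast
    show ?thesis
    proof (rule that[of "M * K"])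
      show "0 < M * K" using K M by simp
      fix f :: "real ^ 'n \<Rightarrow> complex" and N :: real
      assume f: "integrable lebesgue f" and N0: "0 \<le> N"
        and fN: "(\<integral>\<^sup>+x. ennreal (cmod (f x) powr p * v x) \<partial>lebesgue) = ennreal N"
      note [measurable] = borel_measurable_integrable[OF f]
      have "(\<integral>\<^sup>+x. ennreal (cmod (fourier f x) powr q * u x) \<partial>lebesgue) \<le> (\<integral>\<^sup>+x. ennreal M * ennreal (cmod (fourier f x) powr q) \<partial>lebesgue)"
        using M(2)
      proof (intro nn_integral_mono_AE, eventually_elim)
        case (elim x)
        then have "cmod (fourier f x) powr q * u x \<le> M * cmod (fourier f x) powr q"
          by (subst mult.commute) (intro mult_right_mono, auto)
        then show ?case using M(1) by (simp add: ennreal_mult[symmetric] ennreal_leI)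
      qed
      also have "\<dots> = ennreal M * (\<integral>\<^sup>+x. ennreal (cmod (fourier f x) powr q) \<partial>lebesgue)"
        by (rule nn_integral_cmult) measurable
      also have "\<dots> \<le> ennreal M * ennreal (K * N powr (q / p))"
        by (intro mult_left_mono le f N0 fN) auto
      finally show "(\<integral>\<^sup>+x. ennreal (cmod (fourier f x) powr q * u x) \<partial>lebesgue) \<le> ennreal (M * K * N powr (q / p))"
        using M K by (simp add: ennreal_mult[symmetric] mult.assoc)
    qed
  qed
qed

theorem theorem8:
  fixes p q :: real and u v :: "real ^ 'n \<Rightarrow> real"
  assumes "1 < p" and "p \<le> q"
    and "weight u" and "weight v"
    and "locally_integrable (dual_weight p v)"
    and "N_Q p q u v"
    and "(conj_exp p \<ge> q \<and> p \<noteq> 2 \<and>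
            (\<exists>C::real. \<forall>Q\<in>cubes. \<forall>E\<in>sets lebesgue. E \<subseteq> Q \<longrightarrow>
               (LINT x:E|lebesgue. u x) / (LINT x:Q|lebesgue. u x)
                 \<le> C * (measure lebesgue E / measure lebesgue Q) powr (q / conj_exp p)))
         \<or> (conj_exp p \<le> q \<and> q \<noteq> 2 \<and>
            (\<exists>C::real. \<forall>Q\<in>cubes. \<forall>E\<in>sets lebesgue. E \<subseteq> Q \<longrightarrow>
               measure lebesgue E / measure lebesgue Q
                 \<le> C * ((LINT x:E|lebesgue. v x) / (LINT x:Q|lebesgue. v x)) powr (conj_exp q / p)))"
  shows "\<exists>C::real. 0 < C \<and> (\<forall>f :: real ^ 'n \<Rightarrow> complex. integrable lebesgue f \<longrightarrow>
           ennreal_powr (\<integral>\<^sup>+x. ennreal (cmod (fourier f x) powr q * u x) \<partial>lebesgue) (1 / q)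
             \<le> ennreal C * ennreal_powr (\<integral>\<^sup>+x. ennreal (cmod (f x) powr p * v x) \<partial>lebesgue) (1 / p))"
proof -
  have pq: "0 < p" "0 < q" using assms by auto
  obtain K where "0 < K" and "\<And>f N. integrable lebesgue f \<Longrightarrow> 0 \<le> N \<Longrightarrow>
      (\<integral>\<^sup>+x. ennreal (cmod (f x) powr p * v x) \<partial>lebesgue) = ennreal N \<Longrightarrow>
      (\<integral>\<^sup>+x. ennreal (cmod (fourier f x) powr q * u x) \<partial>lebesgue) \<le> ennreal (K * N powr (q / p))"
    using assms(7)
  proof (elim disjE conjE exE)
    fix C assume "q \<le> conj_exp p" "p \<noteq> 2" "\<forall>Q\<in>cubes. \<forall>E\<in>sets lebesgue. E \<subseteq> Q \<longrightarrow>
               (LINT x:E|lebesgue. u x) / (LINT x:Q|lebesgue. u x)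
                 \<le> C * (measure lebesgue E / measure lebesgue Q) powr (q / conj_exp p)"
    from fourier_inequality_reverse_condition[OF assms(1-6) this] that show thesis by blast
  next
    fix C assume "conj_exp p \<le> q" "q \<noteq> 2" "\<forall>Q\<in>cubes. \<forall>E\<in>sets lebesgue. E \<subseteq> Q \<longrightarrow>
               measure lebesgue E / measure lebesgue Q
                 \<le> C * ((LINT x:E|lebesgue. v x) / (LINT x:Q|lebesgue. v x)) powr (conj_exp q / p)"
    from fourier_inequality_Muckenhoupt_condition[OF assms(1-6) this] that show thesis by blast
  qed
  then show ?thesis by (rule fourier_inequalityI[OF pq])
qed

end
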